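(* Let $n\ge3$ and let $M$ be a connected hyperbolic conformal surface endowed with the Poincaré metric $\mathcal{P}_M$. Every conformal harmonic map $f:M\to\mathbb{B}^n$ satisfies $$\mathcal{CK}\big(f(p),df_p(\xi)\big)\ \le\ \mathcal{P}_M(p,\xi),\qquad p\in M,\ \xi\in T_pM.\qquad( * )$$ Hence, $f$ is distance-decreasing with respect to the Poincaré metric on $M$ and the Cayley–Klein metric on $\mathbb{B}^n$ (that is, it does not increase distances). If equality holds in $( * )$ for some point $p\in M$ and vector $0\ne\xi\in T_pM$, or if $f$ preserves the distance between some pair of distinct points of $M$, then $M=\mathbb{D}$ (up to conformal equivalence) and $f$ is a conformal diffeomorphism onto an affine disc in $\mathbb{B}^n$.
   Context: $\mathbb{D}=\{z\in\mathbb{C}:|z|<1\}$, $\mathbb{B}^n$ is the open unit ball of $\mathbb{R}^n$. The Cayley–Klein metric on $\mathbb{B}^n$ is, for $\mathbf{x}\in\mathbb{B}^n$ and $\mathbf{v}\in\mathbb{R}^n$, $$\mathcal{CK}(\mathbf{x},\mathbf{v})^2=\frac{|\mathbf{v}|^2}{1-|\mathbf{x}|^2}+\frac{|\mathbf{x}\cdot\mathbf{v}|^2}{(1-|\mathbf{x}|^2)^2}.$$ A conformal surface is a topological surface with an atlas whose transition maps are conformal diffeomorphisms (orientation preserving or reversing) between plane domains; it may be nonorientable. It is hyperbolic if its universal conformal covering space is $\mathbb{D}$. The Poincaré metric on $\mathbb{D}$ is $\mathcal{P}_{\mathbb{D}}(z,\xi)=|\xi|/(1-|z|^2)$, and $\mathcal{P}_M$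 is the unique Riemannian metric on $M$ for which a universal conformal covering map $h:\mathbb{D}\to M$ is a local isometry. A map $f:M\to\mathbb{R}^n$ is conformal harmonic if in every conformal chart $z=x+iy$ its components are harmonic and $|f_x|=|f_y|$, $f_x\cdot f_y=0$ at every point (points with $df=0$ are allowed). Distances are the infima of lengths of piecewise smooth paths in the given metrics. An affine disc in $\mathbb{B}^n$ means here a nonempty intersection of $\mathbb{B}^n$ with an affine 2-plane in $\mathbb{R}^n$. *)

theory Defs
  imports "HOL-Analysis.Analysis"
begin

section \<open>Calculus on plane domains\<close>

abbreviation unit_disc :: "complex set" (\<open>\<D>\<close>)
  where "\<D> \<equiv> ball 0 1"

definition dir_deriv :: "complex \<Rightarrow> (complex \<Rightarrow> 'b::real_normed_vector) \<Rightarrow> complex \<Rightarrow> 'b"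
  where "dir_deriv v u z = frechet_derivative u (at z) v"

abbreviation dx :: "(complex \<Rightarrow> 'b::real_normed_vector) \<Rightarrow> complex \<Rightarrow> 'b"
  where "dx \<equiv> dir_deriv 1"

abbreviation dy :: "(complex \<Rightarrow> 'b::real_normed_vector) \<Rightarrow> complex \<Rightarrow> 'b"
  where "dy \<equiv> dir_deriv \<i>"

definition C1_on :: "complex set \<Rightarrow> (complex \<Rightarrow> 'b::real_normed_vector) \<Rightarrow> bool"
  where "C1_on S u \<longleftrightarrow> (\<forall>z\<in>S. u differentiable (at z)) \<and> continuous_on S (dx u) \<and> continuous_on S (dy u)"

definition C2_on :: "complex set \<Rightarrow> (complex \<Rightarrow> 'b::real_normed_vector) \<Rightarrow> bool"
  where "C2_on S u \<longleftrightarrow> C1_on S u \<and> C1_on S (dx u) \<and> C1_on S (dy u)"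

definition harmonic_on :: "complex set \<Rightarrow> (complex \<Rightarrow> real) \<Rightarrow> bool"
  where "harmonic_on S u \<longleftrightarrow> C2_on S u \<and> (\<forall>z\<in>S. dx (dx u) z + dy (dy u) z = 0)"

text \<open>
  A conformal map of an open set \<open>S\<close> of the plane into the plane preserves or reverses the
  orientation on each component of \<open>S\<close>, so it is holomorphic or antiholomorphic there, with
  nowhere vanishing derivative.  Different components may have different orientation behaviour.
\<close>

definition conformal_map_on :: "complex set \<Rightarrow> (complex \<Rightarrow> complex) \<Rightarrow> bool"
  where "conformal_map_on S g \<longleftrightarrow>
    (\<forall>C\<in>components S.
        (g holomorphic_on C \<and> (\<forall>z\<in>C. deriv g z \<noteq> 0)) \<or>
        ((cnj \<circ> g) holomorphic_on C \<and> (\<forall>z\<in>C. deriv (cnj \<circ> g) z \<noteq> 0)))"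


section \<open>Conformal surfaces\<close>

text \<open>
  A surface is a set \<open>M\<close> with its subspace topology in a second countable Hausdorff space.
  A chart is a pair \<open>(U, \<phi>)\<close>; the values of \<open>\<phi>\<close> outside \<open>U\<close> are irrelevant.
\<close>

type_synonym 'a chart = "'a set \<times> ('a \<Rightarrow> complex)"

definition surface_chart :: "'a::{t2_space,second_countable_topology} set \<Rightarrow> 'a chart \<Rightarrow> bool"
  where "surface_chart M c \<longleftrightarrow> (case c of (U, \<phi>) \<Rightarrow>
    openin (top_of_set M) U \<and> open (\<phi> ` U) \<and> (\<exists>\<psi>. homeomorphism U (\<phi> ` U) \<phi> \<psi>))"

definition conformal_surface ::
    "'a::{t2_space,second_countable_topology} set \<Rightarrow> 'a chart set \<Rightarrow> bool"
  where "conformal_surface M A \<longleftrightarrow>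
    (\<forall>c\<in>A. surface_chart M c) \<and> (\<Union>c\<in>A. fst c) = M \<and>
    (\<forall>(U, \<phi>)\<in>A. \<forall>(V, \<psi>)\<in>A. conformal_map_on (\<phi> ` (U \<inter> V)) (\<psi> \<circ> inv_into U \<phi>))"

definition conformal_from_disc :: "'a chart set \<Rightarrow> (complex \<Rightarrow> 'a) \<Rightarrow> bool"
  where "conformal_from_disc A h \<longleftrightarrow> (\<forall>(U, \<phi>)\<in>A. conformal_map_on (\<D> \<inter> h -` U) (\<phi> \<circ> h))"

text \<open>Since the disc is simply connected, every conformal covering by it is universal.\<close>

definition universal_conformal_covering ::
    "'a::{t2_space,second_countable_topology} set \<Rightarrow> 'a chart set \<Rightarrow> (complex \<Rightarrow> 'a) \<Rightarrow> bool"
  where "universal_conformal_covering M A h \<longleftrightarrow> covering_space \<D> h M \<and> conformal_from_disc A h"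

definition hyperbolic_surface ::
    "'a::{t2_space,second_countable_topology} set \<Rightarrow> 'a chart set \<Rightarrow> bool"
  where "hyperbolic_surface M A \<longleftrightarrow> (\<exists>h. universal_conformal_covering M A h)"

definition conformally_equivalent_disc ::
    "'a::{t2_space,second_countable_topology} set \<Rightarrow> 'a chart set \<Rightarrow> bool"
  where "conformally_equivalent_disc M A \<longleftrightarrow>
    (\<exists>h k. homeomorphism \<D> M h k \<and> conformal_from_disc A h)"


section \<open>Tangent vectors and differentials\<close>

text \<open>
  A tangent vector at \<open>p\<close> is the family of its coordinate representations in the charts around
  \<open>p\<close>, which are related by the differentials of the transition maps.  The entry at
  a chart that does not contain \<open>p\<close> is \<open>0\<close> by convention.
\<close>

type_synonym 'a tangent_vector = "'a chart \<Rightarrow> complex"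

definition charts_at :: "'a chart set \<Rightarrow> 'a \<Rightarrow> 'a chart set"
  where "charts_at A p = {c \<in> A. p \<in> fst c}"

definition tangent_space :: "'a chart set \<Rightarrow> 'a \<Rightarrow> 'a tangent_vector set"
  where "tangent_space A p = {\<xi>.
    (\<forall>c. c \<notin> charts_at A p \<longrightarrow> \<xi> c = 0) \<and>
    (\<forall>(U, \<phi>)\<in>charts_at A p. \<forall>(V, \<psi>)\<in>charts_at A p.
        \<xi> (V, \<psi>) = frechet_derivative (\<psi> \<circ> inv_into U \<phi>) (at (\<phi> p)) (\<xi> (U, \<phi>)))}"

abbreviation zero_tangent :: "'a tangent_vector"
  where "zero_tangent \<equiv> (\<lambda>_. 0)"

definition local_rep :: "'a chart \<Rightarrow> ('a \<Rightarrow> 'b) \<Rightarrow> complex \<Rightarrow> 'b"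
  where "local_rep c f = f \<circ> inv_into (fst c) (snd c)"

text \<open>By the chain rule the next value does not depend on the chart that is chosen.\<close>

definition surface_differential ::
    "'a chart set \<Rightarrow> ('a \<Rightarrow> 'b::real_normed_vector) \<Rightarrow> 'a \<Rightarrow> 'a tangent_vector \<Rightarrow> 'b"
  where "surface_differential A f p \<xi> =
    (let c = (SOME c. c \<in> charts_at A p)
     in frechet_derivative (local_rep c f) (at (snd c p)) (\<xi> c))"

definition disc_differential ::
    "'a chart set \<Rightarrow> (complex \<Rightarrow> 'a) \<Rightarrow> complex \<Rightarrow> complex \<Rightarrow> 'a tangent_vector"
  where "disc_differential A h z \<zeta> =
    (\<lambda>c. if c \<in> charts_at A (h z) then frechet_derivative (snd c \<circ> h) (at z) \<zeta> else 0)"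

definition surface_velocity :: "'a chart set \<Rightarrow> (real \<Rightarrow> 'a) \<Rightarrow> real \<Rightarrow> 'a tangent_vector"
  where "surface_velocity A \<gamma> t =
    (\<lambda>c. if c \<in> charts_at A (\<gamma> t) then vector_derivative (snd c \<circ> \<gamma>) (at t) else 0)"


section \<open>The Poincare and Cayley-Klein metrics\<close>

definition poincare_disc :: "complex \<Rightarrow> complex \<Rightarrow> real"
  where "poincare_disc z \<zeta> = norm \<zeta> / (1 - (norm z)\<^sup>2)"

text \<open>
  A conformal covering \<open>h\<close> is onto and its differentials are linear isomorphisms, so the
  condition that \<open>h\<close> is a local isometry determines \<open>g p\<close> on the tangent space at each point
  \<open>p\<close>, makes \<open>g\<close> Riemannian, and does not depend on the choice of \<open>h\<close>.  The choice
  operator only affects values off the tangent bundle.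
\<close>

definition is_poincare_metric ::
    "'a::{t2_space,second_countable_topology} set \<Rightarrow> 'a chart set \<Rightarrow>
     ('a \<Rightarrow> 'a tangent_vector \<Rightarrow> real) \<Rightarrow> bool"
  where "is_poincare_metric M A g \<longleftrightarrow>
    (\<exists>h. universal_conformal_covering M A h \<and>
         (\<forall>z\<in>\<D>. \<forall>\<zeta>. g (h z) (disc_differential A h z \<zeta>) = poincare_disc z \<zeta>))"

definition poincare_metric ::
    "'a::{t2_space,second_countable_topology} set \<Rightarrow> 'a chart set \<Rightarrow> 'a \<Rightarrow> 'a tangent_vector \<Rightarrow> real"
  where "poincare_metric M A = (SOME g. is_poincare_metric M A g)"

definition cayley_klein :: "'b::real_inner \<Rightarrow> 'b \<Rightarrow> real"
  where "cayley_klein x v =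
    sqrt ((norm v)\<^sup>2 / (1 - (norm x)\<^sup>2) + (x \<bullet> v)\<^sup>2 / (1 - (norm x)\<^sup>2)\<^sup>2)"


section \<open>Path lengths and distances\<close>

text \<open>
  Paths are parametrised by \<open>{0..1}\<close> and piecewise \<open>C\<^sup>1\<close>, with one-sided derivatives
  that are continuous up to the end points of each piece.  Hence the speed is bounded
  and integrable; the finitely many break points do not matter for the length.
\<close>

definition C1_arc :: "real \<Rightarrow> real \<Rightarrow> (real \<Rightarrow> 'b::real_normed_vector) \<Rightarrow> bool"
  where "C1_arc a b g \<longleftrightarrow>
    (\<exists>g'. continuous_on {a..b} g' \<and>
          (\<forall>t\<in>{a..b}. (g has_vector_derivative g' t) (at t within {a..b})))"

definition piecewise :: "(real \<Rightarrow> real \<Rightarrow> bool) \<Rightarrow> bool"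
  where "piecewise Q \<longleftrightarrow>
    (\<exists>S. finite S \<and> (\<forall>a b. 0 \<le> a \<and> a < b \<and> b \<le> 1 \<and> {a<..<b} \<inter> S = {} \<longrightarrow> Q a b))"

definition surface_path ::
    "'a::{t2_space,second_countable_topology} set \<Rightarrow> 'a chart set \<Rightarrow> (real \<Rightarrow> 'a) \<Rightarrow> bool"
  where "surface_path M A \<gamma> \<longleftrightarrow> path \<gamma> \<and> path_image \<gamma> \<subseteq> M \<and>
    piecewise (\<lambda>a b. \<forall>(U, \<phi>)\<in>A. \<forall>c d.
      a \<le> c \<and> c < d \<and> d \<le> b \<and> \<gamma> ` {c..d} \<subseteq> U \<longrightarrow> C1_arc c d (\<phi> \<circ> \<gamma>))"

definition ball_path :: "(real \<Rightarrow> 'b::real_normed_vector) \<Rightarrow> bool"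
  where "ball_path \<gamma> \<longleftrightarrow> path \<gamma> \<and> path_image \<gamma> \<subseteq> ball 0 1 \<and> piecewise (\<lambda>a b. C1_arc a b \<gamma>)"

definition poincare_length ::
    "'a::{t2_space,second_countable_topology} set \<Rightarrow> 'a chart set \<Rightarrow> (real \<Rightarrow> 'a) \<Rightarrow> real"
  where "poincare_length M A \<gamma> =
    integral {0..1} (\<lambda>t. poincare_metric M A (\<gamma> t) (surface_velocity A \<gamma> t))"

definition cayley_klein_length :: "(real \<Rightarrow> 'b::real_inner) \<Rightarrow> real"
  where "cayley_klein_length \<gamma> =
    integral {0..1} (\<lambda>t. cayley_klein (\<gamma> t) (vector_derivative \<gamma> (at t)))"

definition poincare_dist ::
    "'a::{t2_space,second_countable_topology} set \<Rightarrow> 'a chart set \<Rightarrow> 'a \<Rightarrow> 'a \<Rightarrow> real"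
  where "poincare_dist M A p q =
    Inf {poincare_length M A \<gamma> | \<gamma>. surface_path M A \<gamma> \<and> pathstart \<gamma> = p \<and> pathfinish \<gamma> = q}"

definition cayley_klein_dist :: "'b::real_inner \<Rightarrow> 'b \<Rightarrow> real"
  where "cayley_klein_dist x y =
    Inf {cayley_klein_length \<gamma> | \<gamma>. ball_path \<gamma> \<and> pathstart \<gamma> = x \<and> pathfinish \<gamma> = y}"


section \<open>Conformal harmonic maps and affine discs\<close>

definition conformal_harmonic :: "'a chart set \<Rightarrow> ('a \<Rightarrow> real ^ 'n) \<Rightarrow> bool"
  where "conformal_harmonic A f \<longleftrightarrow>
    (\<forall>(U, \<phi>)\<in>A. let F = local_rep (U, \<phi>) f in
       (\<forall>i. harmonic_on (\<phi> ` U) (\<lambda>z. F z $ i)) \<and>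
       (\<forall>z\<in>\<phi> ` U. norm (dx F z) = norm (dy F z) \<and> dx F z \<bullet> dy F z = 0))"

definition affine_disc :: "'b::euclidean_space set \<Rightarrow> bool"
  where "affine_disc \<Delta> \<longleftrightarrow> (\<exists>P. affine P \<and> aff_dim P = 2 \<and> \<Delta> = P \<inter> ball 0 1) \<and> \<Delta> \<noteq> {}"

text \<open>
  The conformal structure on an affine disc is the one induced by the Euclidean metric.
  A \<open>C\<^sup>1\<close> map with these properties into an affine plane is smooth, being
  holomorphic or antiholomorphic in local coordinates, and by the inverse function theorem
  so is its inverse.
\<close>

definition conformal_diffeo_onto ::
    "'a::{t2_space,second_countable_topology} set \<Rightarrow> 'a chart set \<Rightarrow>
     ('a \<Rightarrow> 'b::euclidean_space) \<Rightarrow> 'b set \<Rightarrow> bool"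
  where "conformal_diffeo_onto M A f \<Delta> \<longleftrightarrow>
    (\<exists>k. homeomorphism M \<Delta> f k) \<and>
    (\<forall>(U, \<phi>)\<in>A. let F = local_rep (U, \<phi>) f in
       C1_on (\<phi> ` U) F \<and>
       (\<forall>z\<in>\<phi> ` U. norm (dx F z) = norm (dy F z) \<and> dx F z \<bullet> dy F z = 0 \<and> dx F z \<noteq> 0))"

end

theory Submission
  imports Defs "HOL-Complex_Analysis.Complex_Analysis"
begin

text \<open>
  Let \<open>h\<close> be a conformal covering of \<open>M\<close> by the disc.  Each component of \<open>F = f \<circ> h\<close> is the real
  part of a holomorphic function, and a disc automorphism moves a given point to the centre, so
  the inequality between the two metrics becomes a statement about the value and the differential at \<open>0\<close> of a
  harmonic map \<open>F\<close> of the disc into the ball that is conformal at \<open>0\<close>.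

  The proof of this statement compares \<open>F\<close> with the conformal parametrisation \<open>g\<close> of the affine disc
  through \<open>F 0\<close> that is tangent there to the image of the differential.  The map \<open>g\<close> is a Moebius map followed by an
  affine similarity, and \<open>|g| = 1\<close> on the unit circle.  Hence \<open>1 - F \<bullet> g \<ge> 0\<close> on the
  circle (where \<open>F\<close> is taken on slightly smaller circles), and this remains true
  after multiplication with the positive weight \<open>|1 + cnj a * z|\<^sup>2\<close>.  This weight clears the
  denominator of \<open>g\<close>: the weighted map is a trigonometric polynomial of degree one.  The mean of its
  inner product with \<open>F\<close> therefore depends only on \<open>F 0\<close> and the differential of \<open>F\<close> at \<open>0\<close>, and the
  nonnegativity of the mean says that the differential of \<open>F\<close> at \<open>0\<close> is not longer than that of \<open>g\<close>
  (\<open>derivative_bound_at_center\<close>).  In the radial direction, where the Cayley--Klein length is largest for a given Euclidean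
  length, \<open>g\<close> preserves the metrics, and this gives the inequality in all directions.  If equality holds, the
  mean of the nonnegative gap tends to \<open>0\<close>, so \<open>F - g\<close> tends to \<open>0\<close> in mean square at the boundary, all its
  Fourier coefficients vanish, and \<open>F = g\<close> (\<open>schwarz_pick\<close>).  In particular \<open>F\<close> is then
  injective, so \<open>h\<close> is a homeomorphism and \<open>M\<close> is the disc.

  The Poincare metric of \<open>M\<close> is well defined because two preimages of a point are related
  by a locally conformal lift of \<open>h\<close> through itself, to which the same Schwarz--Pick lemma
  applies (\<open>poincare_disc_le_of_same_image\<close>).  Piecewise smooth paths of \<open>M\<close> lift to the disc with the same length, so integrating
  the inequality along lifts shows that \<open>f\<close> does not increase distances.

  Suppose that the inequality is strict for all nonzero vectors.  By compactness, the Cayley--Klein metric is then at most \<open>m < 1\<close>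
  times the Poincare metric over each compact disc.  Paths from a fixed point of bounded
  Poincare length stay in such a disc, so the distance of any two distinct points, which is positive,
  strictly decreases (\<open>dist_eq_imp_extremal\<close>).  Thus equality of distances also leads to equality of the
  two metrics at some nonzero tangent vector; minimal geodesics are not involved.
\<close>

section \<open>Fourier coefficients on circles\<close>

text \<open>
  Cauchy's formula for the \<open>n\<close>-th derivative at the centre.  The circle is parametrised by
  \<open>{0..1}\<close>, so that integrals over the circle are means.
\<close>

lemma circle_mean_holomorphic:
  assumes H: "H holomorphic_on ball 0 1" and r: "0 < r" "r < 1"
  shows "((\<lambda>t. H (of_real r * cis (2 * pi * t)) * cnj (cis (2 * pi * t)) ^ n)
            has_integral of_real r ^ n * ((deriv ^^ n) H 0 / fact n)) {0..1}"
proof -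
  have "((\<lambda>u. H u / (u - 0) ^ Suc n) has_contour_integral
          ((2 * pi * \<i>) / (fact n) * (deriv ^^ n) H 0)) (circlepath 0 r)"
    by (rule Cauchy_has_contour_integral_higher_derivative_circlepath)
      (use r in \<open>auto intro!: holomorphic_on_imp_continuous_on holomorphic_on_subset[OF H]\<close>)
  then have "((\<lambda>t. H (circlepath 0 r t) / (circlepath 0 r t) ^ Suc n *
          vector_derivative (circlepath 0 r) (at t within {0..1}))
        has_integral (2 * pi * \<i>) / (fact n) * (deriv ^^ n) H 0) {0..1}"
    by (simp add: has_contour_integral_def)
  then have "((\<lambda>t. (of_real r ^ n / (2 * pi * \<i>)) * (H (circlepath 0 r t) / (circlepath 0 r t) ^ Suc n *
          vector_derivative (circlepath 0 r) (at t within {0..1})))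
        has_integral (of_real r ^ n / (2 * pi * \<i>)) * ((2 * pi * \<i>) / (fact n) * (deriv ^^ n) H 0)) {0..1}"
    by (rule has_integral_mult_right)
  moreover have "(of_real r ^ n / (2 * pi * \<i>)) * ((2 * pi * \<i>) / (fact n) * (deriv ^^ n) H 0)
      = of_real r ^ n * ((deriv ^^ n) H 0 / fact n)"
    by (simp add: field_simps)
  moreover have "(of_real r ^ n / (2 * pi * \<i>)) * (H (circlepath 0 r t) / (circlepath 0 r t) ^ Suc n *
          vector_derivative (circlepath 0 r) (at t within {0..1}))
      = H (of_real r * cis (2 * pi * t)) * cnj (cis (2 * pi * t)) ^ n" if "t \<in> {0..1}" for t
  proof -
    have c: "circlepath 0 r t = of_real r * cis (2 * pi * t)"
      by (simp add: circlepath cis_conv_exp mult_ac)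
    have v: "vector_derivative (circlepath 0 r) (at t within {0..1}) = 2 * pi * \<i> * of_real r * cis (2 * pi * t)"
      using that by (simp add: vector_derivative_circlepath01 cis_conv_exp mult_ac)
    have "cis (2 * pi * t) * cnj (cis (2 * pi * t)) = 1"
      by (simp add: cis_cnj cis_mult)
    then have "cis (2 * pi * t) ^ n * cnj (cis (2 * pi * t)) ^ n = 1"
      by (simp flip: power_mult_distrib)
    then have inv: "cnj (cis (2 * pi * t)) ^ n = 1 / cis (2 * pi * t) ^ n"
      by (simp add: divide_simps mult.commute)
    have "(R ^ n / d) * (h / (R * e) ^ Suc n * (d * R * e)) = h * (1 / e ^ n)"
      if "R \<noteq> 0" "d \<noteq> 0" "e \<noteq> 0" for R d h e :: complex
      using that by (simp add: divide_simps power_mult_distrib)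
    from this[of "of_real r" "2 * pi * \<i>" "cis (2 * pi * t)"] show ?thesis
      unfolding c v inv using r by simp
  qed
  ultimately show ?thesis
    by (metis (no_types, lifting) has_integral_cong)
qed

text \<open>
  The Taylor series has no negative powers: this is the mean value property of
  \<open>H u * u ^ n\<close>, which vanishes at the centre.
\<close>

lemma circle_mean_holomorphic_pos:
  assumes H: "H holomorphic_on ball 0 1" and r: "0 < r" "r < 1" and n: "0 < n"
  shows "((\<lambda>t. H (of_real r * cis (2 * pi * t)) * cis (2 * pi * t) ^ n) has_integral 0) {0..1}"
proof -
  have "((\<lambda>t. (1 / of_real r ^ n) * (H (of_real r * cis (2 * pi * t)) * (of_real r * cis (2 * pi * t)) ^ n * cnj (cis (2 * pi * t)) ^ 0)) has_integral
     (1 / of_real r ^ n) * (of_real r ^ 0 * ((deriv ^^ 0) (\<lambda>u. H u * u ^ n) 0 / fact 0))) {0..1}"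
    by (intro has_integral_mult_right circle_mean_holomorphic[of "\<lambda>u. H u * u ^ n"] holomorphic_intros H r)
  then show ?thesis using n r
    by (simp add: power_mult_distrib field_simps power_0_left)
qed

text \<open>
  In \<open>Re H = (H + cnj H) / 2\<close> the frequency \<open>n > 0\<close> only occurs in the holomorphic half.
\<close>

lemma circle_mean_Re_holomorphic:
  assumes H: "H holomorphic_on ball 0 1" and r: "0 < r" "r < 1" and n: "0 < n"
  shows "((\<lambda>t. of_real (Re (H (of_real r * cis (2 * pi * t)))) * cnj (cis (2 * pi * t)) ^ n)
            has_integral of_real r ^ n * ((deriv ^^ n) H 0 / fact n) / 2) {0..1}"
proof -
  have 1: "((\<lambda>t. cnj (H (of_real r * cis (2 * pi * t)) * cis (2 * pi * t) ^ n)) has_integral cnj 0) {0..1}"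
    using circle_mean_holomorphic_pos[OF H r n]
    by (subst (asm) has_integral_cnj[symmetric]) (simp only: o_def)
  have "((\<lambda>t. (1/2) * (H (of_real r * cis (2 * pi * t)) * cnj (cis (2 * pi * t)) ^ n
       + cnj (H (of_real r * cis (2 * pi * t)) * cis (2 * pi * t) ^ n)))
     has_integral (1/2) * (of_real r ^ n * ((deriv ^^ n) H 0 / fact n) + cnj 0)) {0..1}"
    by (intro has_integral_mult_right has_integral_add circle_mean_holomorphic H r 1)
  moreover have star: "(1/2) * (H z * cnj e ^ n + cnj (H z * e ^ n)) = of_real (Re (H z)) * cnj e ^ n" for z e
    using complex_add_cnj[of "H z"] by (simp add: field_simps flip: distrib_right)
  ultimately show ?thesis unfolding star by (simp add: mult.commute)
qed

lemma circle_mean_Re_holomorphic_low: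
  assumes H: "H holomorphic_on ball 0 1" and r: "0 < r" "r < 1"
  shows "((\<lambda>t. Re (H (of_real r * cis (2 * pi * t)))) has_integral Re (H 0)) {0..1}"
    and "((\<lambda>t. Re (H (of_real r * cis (2 * pi * t))) * cos (2 * pi * t)) has_integral r * Re (deriv H 0) / 2) {0..1}"
    and "((\<lambda>t. Re (H (of_real r * cis (2 * pi * t))) * sin (2 * pi * t)) has_integral - r * Im (deriv H 0) / 2) {0..1}"
proof -
  show "((\<lambda>t. Re (H (of_real r * cis (2 * pi * t)))) has_integral Re (H 0)) {0..1}"
    using has_integral_Re[OF circle_mean_holomorphic[OF H r, of 0]] by simp
  have *: "((\<lambda>t. of_real (Re (H (of_real r * cis (2 * pi * t)))) * cnj (cis (2 * pi * t)) ^ 1)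
            has_integral of_real r ^ 1 * ((deriv ^^ 1) H 0 / fact 1) / 2) {0..1}"
    by (rule circle_mean_Re_holomorphic[OF H r]) simp
  show "((\<lambda>t. Re (H (of_real r * cis (2 * pi * t))) * cos (2 * pi * t)) has_integral r * Re (deriv H 0) / 2) {0..1}"
    using has_integral_Re[OF *] by simp
  show "((\<lambda>t. Re (H (of_real r * cis (2 * pi * t))) * sin (2 * pi * t)) has_integral - r * Im (deriv H 0) / 2) {0..1}"
    using has_integral_neg[OF has_integral_Im[OF *]] by simp
qed

section \<open>Harmonic maps of the disc\<close>

text \<open>
  Harmonicity on the disc is expressed by holomorphic functions whose real parts are the
  components, because these make the Fourier coefficients on circles computable.
\<close>

definition disc_harmonic :: "(complex \<Rightarrow> 'b::euclidean_space) \<Rightarrow> bool"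
  where "disc_harmonic F \<longleftrightarrow>
    (\<forall>b\<in>Basis. \<exists>H. H holomorphic_on ball 0 1 \<and> (\<forall>w\<in>ball 0 1. F w \<bullet> b = Re (H w)))"

lemma disc_harmonic_inner:
  assumes "disc_harmonic F"
  obtains H where "H holomorphic_on ball 0 1" "\<And>w. w \<in> ball 0 1 \<Longrightarrow> F w \<bullet> v = Re (H w)"
proof -
  obtain H where H: "\<And>b. b \<in> Basis \<Longrightarrow> H b holomorphic_on ball 0 1"
     "\<And>b w. b \<in> Basis \<Longrightarrow> w \<in> ball 0 1 \<Longrightarrow> F w \<bullet> b = Re (H b w)"
    using assms unfolding disc_harmonic_def by metis
  show thesis
  proof
    show "(\<lambda>w. \<Sum>b\<in>Basis. of_real (v \<bullet> b) * H b w) holomorphic_on ball 0 1"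
      by (intro holomorphic_intros H)
    show "F w \<bullet> v = Re (\<Sum>b\<in>Basis. of_real (v \<bullet> b) * H b w)" if "w \<in> ball 0 1" for w
      using H(2)[OF _ that] by (subst euclidean_inner) (simp add: mult.commute)
  qed
qed

lemma Re_holomorphic_has_derivative:
  assumes "H holomorphic_on S" "open S" "w \<in> S"
  shows "((\<lambda>z. Re (H z)) has_derivative (\<lambda>v. Re (deriv H w * v))) (at w)"
  using holomorphic_derivI[OF assms]
  by (auto simp: has_field_derivative_def intro!: derivative_eq_intros)

lemma disc_harmonic_differentiable:
  assumes "disc_harmonic F" "w \<in> ball 0 1"
  shows "F differentiable (at w)"
proof -
  have "(\<lambda>z. F z \<bullet> b) differentiable (at w)" if "b \<in> Basis" for b
  proof -
    obtain H where H: "H holomorphic_on ball 0 1" "\<And>w. w \<in> ball 0 1 \<Longrightarrow> F w \<bullet> b = Re (H w)"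
      using disc_harmonic_inner[OF assms(1)] by blast
    have "((\<lambda>z. F z \<bullet> b) has_derivative (\<lambda>v. Re (deriv H w * v))) (at w)"
      by (rule has_derivative_transform_within_open[OF Re_holomorphic_has_derivative[OF H(1) open_ball assms(2)] open_ball assms(2)])
        (use H(2) in auto)
    then show ?thesis by (auto simp: differentiable_def)
  qed
  then show ?thesis
    by (subst differentiable_componentwise_within) auto
qed

lemma disc_harmonic_derivative_inner:
  assumes "(F has_derivative L) (at w)" "w \<in> ball 0 1" "H holomorphic_on ball 0 1"
    "\<And>w. w \<in> ball 0 1 \<Longrightarrow> F w \<bullet> v = Re (H w)"
  shows "L \<zeta> \<bullet> v = Re (deriv H w * \<zeta>)"
proof -
  have 1: "((\<lambda>z. F z \<bullet> v) has_derivative (\<lambda>\<zeta>. L \<zeta> \<bullet> v)) (at w)"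
    by (rule bounded_linear.has_derivative[OF bounded_linear_inner_left assms(1)])
  have 2: "((\<lambda>z. F z \<bullet> v) has_derivative (\<lambda>\<zeta>. Re (deriv H w * \<zeta>))) (at w)"
    by (rule has_derivative_transform_within_open[OF Re_holomorphic_has_derivative[OF assms(3) open_ball assms(2)] open_ball assms(2)])
      (use assms in auto)
  show ?thesis
    using has_derivative_unique[OF 1 2] by metis
qed

text \<open>
  A trigonometric polynomial of degree one sees only the value and the differential of a harmonic
  map at the centre.  The comparison functions in the Schwarz lemma below are therefore
  chosen to have degree one.
\<close>

lemma circle_mean_pairing:
  assumes F: "disc_harmonic F" and L: "(F has_derivative L) (at 0)" and r: "0 < r" "r < 1"
  shows "((\<lambda>t. F (of_real r * cis (2 * pi * t)) \<bullet> (A + cos (2 * pi * t) *\<^sub>R B + sin (2 * pi * t) *\<^sub>R C))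
            has_integral F 0 \<bullet> A + r / 2 * (L 1 \<bullet> B + L \<i> \<bullet> C)) {0..1}"
proof -
  have in_disc: "of_real r * cis s \<in> ball 0 1" for s
    using r by (simp add: norm_mult)
  obtain HA where HA: "HA holomorphic_on ball 0 1" "\<And>w. w \<in> ball 0 1 \<Longrightarrow> F w \<bullet> A = Re (HA w)"
    using disc_harmonic_inner[OF F] by blast
  obtain HB where HB: "HB holomorphic_on ball 0 1" "\<And>w. w \<in> ball 0 1 \<Longrightarrow> F w \<bullet> B = Re (HB w)"
    using disc_harmonic_inner[OF F] by blast
  obtain HC where HC: "HC holomorphic_on ball 0 1" "\<And>w. w \<in> ball 0 1 \<Longrightarrow> F w \<bullet> C = Re (HC w)"
    using disc_harmonic_inner[OF F] by blast
  have B: "L 1 \<bullet> B = Re (deriv HB 0)"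
    using disc_harmonic_derivative_inner[OF L _ HB, of 1] by simp
  have C: "L \<i> \<bullet> C = - Im (deriv HC 0)"
    using disc_harmonic_derivative_inner[OF L _ HC, of \<i>] by simp
  have "((\<lambda>t. Re (HA (of_real r * cis (2 * pi * t))) + Re (HB (of_real r * cis (2 * pi * t))) * cos (2 * pi * t)
        + Re (HC (of_real r * cis (2 * pi * t))) * sin (2 * pi * t)) has_integral
        Re (HA 0) + r * Re (deriv HB 0) / 2 + - r * Im (deriv HC 0) / 2) {0..1}"
    by (intro has_integral_add circle_mean_Re_holomorphic_low HA HB HC r)
  moreover have "F (of_real r * cis s) \<bullet> (A + cos s *\<^sub>R B + sin s *\<^sub>R C)
      = Re (HA (of_real r * cis s)) + Re (HB (of_real r * cis s)) * cos s + Re (HC (of_real r * cis s)) * sin s" for s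
    by (simp add: inner_add_right HA(2)[OF in_disc] HB(2)[OF in_disc] HC(2)[OF in_disc]
        mult.commute[of "cos s"] mult.commute[of "sin s"])
  moreover have "F 0 \<bullet> A + r / 2 * (L 1 \<bullet> B + L \<i> \<bullet> C)
      = Re (HA 0) + r * Re (deriv HB 0) / 2 + - r * Im (deriv HC 0) / 2"
    using HA(2)[of 0] B C by (simp add: algebra_simps diff_divide_distrib)
  ultimately show ?thesis by (simp only:)
qed

section \<open>Disc automorphisms and affine discs\<close>

definition moeb :: "complex \<Rightarrow> complex \<Rightarrow> complex"
  where "moeb a z = (z + a) / (1 + cnj a * z)"

text \<open>
  On the unit circle this equals \<open>|1 + cnj a * z|\<^sup>2\<close>, the square of the denominator of
  \<open>moeb a z\<close>.  Multiplication by it turns \<open>moeb a\<close> into a trigonometric polynomial of degree one.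
\<close>

definition weight :: "complex \<Rightarrow> complex \<Rightarrow> real"
  where "weight a z = 1 + (norm a)\<^sup>2 + 2 * Re (cnj a * z)"

lemma weight_eq: 
  assumes "norm e = 1" shows "weight a e = (norm (1 + cnj a * e))\<^sup>2"
proof -
  have "(norm (1 + cnj a * e))\<^sup>2 = 1 + (norm (cnj a * e))\<^sup>2 + 2 * Re (cnj a * e)"
    unfolding cmod_power2 by (simp add: power2_eq_square algebra_simps)
  then show ?thesis using assms by (simp add: weight_def norm_mult)
qed

lemma norm_denominator_ge:
  assumes "norm (z::complex) \<le> 1" shows "1 - norm a \<le> norm (1 + cnj a * z)"
proof -
  have "norm (cnj a * z) \<le> norm a"
    using assms by (simp add: norm_mult mult_left_le)
  then show ?thesis
    using norm_diff_ineq[of 1 "cnj a * z"] by simp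
qed

lemma norm_moeb_boundary:
  assumes "norm e = 1" "norm a < 1" shows "norm (moeb a e) = 1"
proof -
  have ee: "e * cnj e = 1" using assms by (simp add: complex_norm_square[symmetric])
  then have "e * cnj (1 + cnj a * e) = e + a"
    by (simp add: algebra_simps)
  then have "norm (e + a) = norm (1 + cnj a * e)"
    using assms by (metis complex_mod_cnj mult_1 norm_mult)
  moreover have "1 + cnj a * e \<noteq> 0"
    using norm_denominator_ge[of e a] assms by auto
  ultimately show ?thesis by (simp add: moeb_def norm_divide)
qed

lemma weight_moeb:
  assumes "norm e = 1" "norm a < 1"
  shows "of_real (weight a e) * moeb a e = 2 * a + e + a\<^sup>2 * cnj e"
proof -
  have ee: "e * cnj e = 1" using assms by (simp add: complex_norm_square[symmetric])
  have nz: "1 + cnj a * e \<noteq> 0"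
    using norm_denominator_ge[of e a] assms by auto
  have "of_real (weight a e) = (1 + cnj a * e) * (1 + a * cnj e)"
    using weight_eq[OF assms(1)] complex_norm_square[of "1 + cnj a * e"] by simp
  then have "of_real (weight a e) * moeb a e = (e + a) * (1 + a * cnj e)"
    using nz by (simp add: moeb_def)
  also have "\<dots> = 2 * a + e + a\<^sup>2 * cnj e"
    using ee by (simp add: algebra_simps power2_eq_square)
  finally show ?thesis .
qed

text \<open>
  Quantitative continuity of \<open>moeb a\<close> at the boundary, used to compare the values of an affine
  disc parametrisation on the circle of radius \<open>r\<close> with its boundary values.
\<close>

lemma moeb_lipschitz_radial:
  assumes "norm e = 1" "norm a < 1" "0 < r" "r < 1"
  shows "norm (moeb a (of_real r * e) - moeb a e) \<le> (1 - r) / (1 - norm a)\<^sup>2"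
proof -
  have d: "1 - norm a \<le> norm (1 + cnj a * e)" "1 - norm a \<le> norm (1 + cnj a * (of_real r * e))"
    using assms by (auto intro!: norm_denominator_ge simp: norm_mult)
  then have nz: "1 + cnj a * e \<noteq> 0" "1 + cnj a * (of_real r * e) \<noteq> 0"
    using assms by auto
  have "moeb a (of_real r * e) - moeb a e
     = ((of_real r - 1) * e * (1 - a * cnj a)) / ((1 + cnj a * (of_real r * e)) * (1 + cnj a * e))"
    using nz unfolding moeb_def by (simp add: diff_frac_eq) (simp add: algebra_simps)
  then have "norm (moeb a (of_real r * e) - moeb a e) = (1 - r) * (1 - (norm a)\<^sup>2)
      / (norm (1 + cnj a * (of_real r * e)) * norm (1 + cnj a * e))"
  proof -
    have 1: "norm (1 - a * cnj a) = 1 - (norm a)\<^sup>2"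
    proof -
      have "1 - a * cnj a = of_real (1 - (norm a)\<^sup>2)" using complex_norm_square[of a] by simp
      moreover have "(norm a)\<^sup>2 < 1" using assms by (simp add: power_less_one_iff)
      ultimately show ?thesis by (metis abs_of_nonneg diff_ge_0_iff_ge less_eq_real_def norm_of_real)
    qed
    have 2: "norm (complex_of_real r - 1) = 1 - r"
      using assms by (metis abs_minus_commute abs_of_pos diff_gt_0_iff_gt norm_of_real of_real_1 of_real_diff)
    assume "moeb a (of_real r * e) - moeb a e
     = ((of_real r - 1) * e * (1 - a * cnj a)) / ((1 + cnj a * (of_real r * e)) * (1 + cnj a * e))"
    then show ?thesis by (simp add: norm_divide norm_mult 1 2 assms(1))
  qed
  also have "\<dots> \<le> (1 - r) * 1 / ((1 - norm a) * (1 - norm a))"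
    using assms d by (intro frac_le mult_left_mono mult_mono mult_pos_pos) auto
  finally show ?thesis by (simp add: power2_eq_square)
qed

lemma moeb_holomorphic: "norm a < 1 \<Longrightarrow> moeb a holomorphic_on ball 0 1"
  unfolding moeb_def
proof (intro holomorphic_intros)
  fix z :: complex assume "norm a < 1" "z \<in> ball 0 1"
  then show "1 + cnj a * z \<noteq> 0"
    using norm_denominator_ge[of z a] by auto
qed

text \<open>
  An affine plane that meets the unit ball: \<open>c\<close> is its point closest to the origin,
  \<open>e1, e2\<close> is an orthonormal basis of its directions, and \<open>R\<close> is the radius of the disc
  that it cuts out of the ball.
\<close>

locale plane_frame =
  fixes c e1 e2 :: "'b::euclidean_space" and R :: real
  assumes norm_e1: "norm e1 = 1" and norm_e2: "norm e2 = 1" and e1_e2: "e1 \<bullet> e2 = 0"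
    and c_e1: "c \<bullet> e1 = 0" and c_e2: "c \<bullet> e2 = 0"
    and R_pos: "0 < R" and radius: "(norm c)\<^sup>2 + R\<^sup>2 = 1"
begin

text \<open>
  The isometry of the complex plane onto the linear span of \<open>e1\<close> and \<open>e2\<close>.
\<close>

definition J :: "complex \<Rightarrow> 'b"
  where "J \<zeta> = Re \<zeta> *\<^sub>R e1 + Im \<zeta> *\<^sub>R e2"

lemma inner_frame [simp]: "e1 \<bullet> e1 = 1" "e2 \<bullet> e2 = 1" "e1 \<bullet> e2 = 0" "e2 \<bullet> e1 = 0"
    "c \<bullet> e1 = 0" "c \<bullet> e2 = 0" "e1 \<bullet> c = 0" "e2 \<bullet> c = 0"
  using norm_e1 norm_e2 e1_e2 c_e1 c_e2 by (auto simp: norm_eq_1 inner_commute)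

lemma linear_J: "linear J"
  by (auto simp: linear_iff J_def algebra_simps)

lemma inner_J: "J \<zeta> \<bullet> J \<eta> = Re (\<zeta> * cnj \<eta>)"
  by (simp add: J_def inner_add_left inner_add_right)

lemma inner_c_J [simp]: "c \<bullet> J \<zeta> = 0" "J \<zeta> \<bullet> c = 0"
  by (simp_all add: J_def inner_add_left inner_add_right)

lemma norm_J [simp]: "norm (J \<zeta>) = norm \<zeta>"
  by (simp add: norm_eq_sqrt_inner inner_J inner_complex_def)

definition plane_map :: "complex \<Rightarrow> 'b"
  where "plane_map \<zeta> = c + R *\<^sub>R J \<zeta>"

lemma norm_plane_map: "(norm (plane_map \<zeta>))\<^sup>2 = (norm c)\<^sup>2 + R\<^sup>2 * (norm \<zeta>)\<^sup>2"
  unfolding plane_map_def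
  by (simp add: power2_norm_eq_inner inner_add_left inner_add_right inner_J)
    (simp add: power2_eq_square cmod_def complex_mult_cnj flip: power2_norm_eq_inner)

lemma disc_harmonic_plane_map:
  assumes "m holomorphic_on ball 0 1"
  shows "disc_harmonic (\<lambda>z. plane_map (m z))"
  unfolding disc_harmonic_def
proof (intro ballI exI conjI)
  fix b :: 'b
  show "(\<lambda>z. of_real (c \<bullet> b) + of_real R * (of_real (e1 \<bullet> b) * m z - of_real (e2 \<bullet> b) * \<i> * m z)) holomorphic_on ball 0 1"
    by (intro holomorphic_intros assms)
  show "plane_map (m z) \<bullet> b = Re (of_real (c \<bullet> b) + of_real R * (of_real (e1 \<bullet> b) * m z - of_real (e2 \<bullet> b) * \<i> * m z))" for z
    by (simp add: plane_map_def J_def inner_add_left algebra_simps)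
qed

section \<open>The Schwarz lemma at the centre of the disc\<close>

text \<open>
  Let \<open>g = plane_map \<circ> moeb a\<close> be the conformal parametrisation of the affine disc that passes
  through \<open>F 0\<close> in the directions of the differential of \<open>F\<close>.  Its boundary values are unit vectors
  and the weighted map is a trigonometric polynomial \<open>A + cos B + sin C\<close>, so the weighted mean
  of \<open>1 - F \<bullet> g\<close> is an explicit function of \<open>F 0\<close> and of the length \<open>\<mu>\<close> of the
  differential.
\<close>

lemma weighted_boundary_gap_mean:
  assumes F: "disc_harmonic F" and F0: "F 0 = plane_map a" and a: "norm a < 1"
    and L: "(F has_derivative L) (at 0)" and L1: "L 1 = \<mu> *\<^sub>R e1" and Li: "L \<i> = \<mu> *\<^sub>R e2"
    and r: "0 < r" "r < 1"
  shows "((\<lambda>t. weight a (cis (2 * pi * t)) * (1 - F (of_real r * cis (2 * pi * t)) \<bullet> plane_map (moeb a (cis (2 * pi * t)))))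
      has_integral R * (R * (1 - (norm a)\<^sup>2) - r * \<mu>)) {0..1}"
proof -
  define A where "A = (1 + (norm a)\<^sup>2) *\<^sub>R c + R *\<^sub>R J (2 * a)"
  define B where "B = (2 * Re a) *\<^sub>R c + R *\<^sub>R J (1 + a\<^sup>2)"
  define C where "C = (2 * Im a) *\<^sub>R c + R *\<^sub>R J (\<i> * (1 - a\<^sup>2))"
  have T: "weight a (cis s) *\<^sub>R plane_map (moeb a (cis s)) = A + cos s *\<^sub>R B + sin s *\<^sub>R C" for s
  proof -
    have "weight a (cis s) *\<^sub>R J (moeb a (cis s)) = J (of_real (weight a (cis s)) * moeb a (cis s))"
      using linear_J by (simp add: J_def algebra_simps)
    also have "\<dots> = J (2 * a + cis s + a\<^sup>2 * cnj (cis s))"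
      using a by (simp add: weight_moeb)
    also have "\<dots> = J (2 * a) + cos s *\<^sub>R J (1 + a\<^sup>2) + sin s *\<^sub>R J (\<i> * (1 - a\<^sup>2))"
      by (simp add: J_def algebra_simps)
    finally have 1: "weight a (cis s) *\<^sub>R J (moeb a (cis s))
        = J (2 * a) + cos s *\<^sub>R J (1 + a\<^sup>2) + sin s *\<^sub>R J (\<i> * (1 - a\<^sup>2))" .
    have "weight a (cis s) *\<^sub>R plane_map (moeb a (cis s))
       = weight a (cis s) *\<^sub>R c + R *\<^sub>R (weight a (cis s) *\<^sub>R J (moeb a (cis s)))"
      by (simp add: plane_map_def algebra_simps)
    also have "\<dots> = A + cos s *\<^sub>R B + sin s *\<^sub>R C"
      unfolding 1 by (simp add: A_def B_def C_def weight_def algebra_simps)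
    finally show ?thesis .
  qed
  have c2: "c \<bullet> c = 1 - R\<^sup>2"
    using radius by (simp add: power2_norm_eq_inner)
  have na: "norm a * norm a = Re a * Re a + Im a * Im a"
    using cmod_power2[of a] by (simp add: power2_eq_square)
  have v: "F 0 \<bullet> A + r / 2 * (L 1 \<bullet> B + L \<i> \<bullet> C) = (1 + (norm a)\<^sup>2) - R * (R * (1 - (norm a)\<^sup>2) - r * \<mu>)"
    by (simp add: F0 L1 Li A_def B_def C_def plane_map_def inner_add_left inner_add_right c2 inner_J)
      (simp add: J_def inner_add_left inner_add_right power2_eq_square na, simp add: algebra_simps)
  have w: "((\<lambda>t. weight a (cis (2 * pi * t))) has_integral 1 + (norm a)\<^sup>2) {0..1}"
  proof -
    have "disc_harmonic (\<lambda>z::complex. 1::real)"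
      unfolding disc_harmonic_def
      by (intro ballI exI[of _ "\<lambda>_. 1"]) auto
    moreover have "((\<lambda>z::complex. 1::real) has_derivative (\<lambda>_. 0)) (at 0)"
      by simp
    ultimately have "((\<lambda>t. 1 \<bullet> ((1 + (norm a)\<^sup>2) + cos (2 * pi * t) *\<^sub>R (2 * Re a) + sin (2 * pi * t) *\<^sub>R (2 * Im a)))
       has_integral 1 \<bullet> (1 + (norm a)\<^sup>2) + r / 2 * (0 \<bullet> (2 * Re a) + 0 \<bullet> (2 * Im a))) {0..1}"
      using circle_mean_pairing[of "\<lambda>_. 1::real"] r by blast
    then show ?thesis
      by (simp add: weight_def algebra_simps)
  qed
  have "((\<lambda>t. weight a (cis (2 * pi * t)) - F (of_real r * cis (2 * pi * t)) \<bullet> (A + cos (2 * pi * t) *\<^sub>R B + sin (2 * pi * t) *\<^sub>R C))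
     has_integral (1 + (norm a)\<^sup>2) - (F 0 \<bullet> A + r / 2 * (L 1 \<bullet> B + L \<i> \<bullet> C))) {0..1}"
    by (intro has_integral_diff w circle_mean_pairing F L r)
  then show ?thesis
    unfolding v T[symmetric] by (simp add: algebra_simps)
qed

lemma norm_plane_map_moeb_boundary:
  assumes "norm e = 1" "norm a < 1" shows "norm (plane_map (moeb a e)) = 1"
proof -
  have "(norm (plane_map (moeb a e)))\<^sup>2 = 1"
    using norm_plane_map radius norm_moeb_boundary[OF assms] by simp
  then show ?thesis by (simp add: power2_eq_1_iff) (smt (verit) norm_ge_zero)
qed

lemma weight_ge:
  assumes "norm e = 1" "norm a < 1" shows "(1 - norm a)\<^sup>2 \<le> weight a e"
  using norm_denominator_ge[of e a] weight_eq[of e a] assms by (simp add: power_mono)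

text \<open>
  Since \<open>F\<close> takes values in the ball and \<open>g = plane_map \<circ> moeb a\<close> has unit boundary values, the
  weighted gap \<open>1 - F \<bullet> g\<close> is nonnegative, and so is its mean; letting \<open>r\<close> tend to \<open>1\<close> gives the
  bound.  If the bound is attained, the mean of the gap is of order \<open>1 - r\<close>.  Up to a
  constant the gap dominates the square of the distance between \<open>F\<close> and \<open>g\<close>, so the Fourier
  coefficients of positive index of their difference vanish; at the centre they agree by assumption.
\<close>

lemma derivative_bound_at_center:
  assumes F: "disc_harmonic F" and bound: "\<And>z. z \<in> ball 0 1 \<Longrightarrow> norm (F z) \<le> 1"
    and F0: "F 0 = plane_map a" and a: "norm a < 1"
    and L: "(F has_derivative L) (at 0)" and L1: "L 1 = \<mu> *\<^sub>R e1" and Li: "L \<i> = \<mu> *\<^sub>R e2"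
  shows "\<mu> \<le> R * (1 - (norm a)\<^sup>2)"
    and "\<mu> = R * (1 - (norm a)\<^sup>2) \<Longrightarrow> z \<in> ball 0 1 \<Longrightarrow> F z = plane_map (moeb a z)"
proof -
  note gap_mean = weighted_boundary_gap_mean[OF F F0 a L L1 Li]
  define gap where "gap r t = weight a (cis (2 * pi * t)) *
     (1 - F (of_real r * cis (2 * pi * t)) \<bullet> plane_map (moeb a (cis (2 * pi * t))))" for r t
  have mean: "(gap r has_integral R * (R * (1 - (norm a)\<^sup>2) - r * \<mu>)) {0..1}" if "0 < r" "r < 1" for r
    unfolding gap_def by (rule gap_mean) (use that in auto)
  have w0: "0 < (1 - norm a)\<^sup>2" using a by simp
  have dist2: "(1 - norm a)\<^sup>2 * (norm (F (of_real r * cis (2 * pi * t)) - plane_map (moeb a (cis (2 * pi * t)))))\<^sup>2 \<le> 2 * gap r t"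
    if r: "0 < r" "r < 1" for r t
  proof -
    let ?x = "F (of_real r * cis (2 * pi * t))" and ?y = "plane_map (moeb a (cis (2 * pi * t)))"
    have y: "?y \<bullet> ?y = 1"
      using norm_plane_map_moeb_boundary[of "cis (2 * pi * t)" a] a by (simp add: norm_eq_1)
    have x: "?x \<bullet> ?x \<le> 1"
    proof -
      have "norm ?x \<le> 1" using bound[of "of_real r * cis (2 * pi * t)"] r by (simp add: norm_mult)
      then show ?thesis by (simp add: norm_eq_sqrt_inner)
    qed
    have "(norm (?x - ?y))\<^sup>2 = ?x \<bullet> ?x + ?y \<bullet> ?y - 2 * (?x \<bullet> ?y)"
      by (simp add: power2_norm_eq_inner inner_diff_left inner_diff_right inner_commute)
    then have 1: "(norm (?x - ?y))\<^sup>2 \<le> 2 * (1 - ?x \<bullet> ?y)"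
      using x y by simp
    have "(1 - norm a)\<^sup>2 * (norm (?x - ?y))\<^sup>2 \<le> weight a (cis (2 * pi * t)) * (norm (?x - ?y))\<^sup>2"
      using weight_ge[of "cis (2 * pi * t)" a] a by (intro mult_right_mono) auto
    also have "\<dots> \<le> weight a (cis (2 * pi * t)) * (2 * (1 - ?x \<bullet> ?y))"
      using 1 order_trans[OF less_imp_le[OF w0] weight_ge[of "cis (2 * pi * t)" a]] a by (intro mult_left_mono) auto
    finally show ?thesis by (simp add: gap_def algebra_simps)
  qed
  then have gap_nonneg: "0 \<le> gap r t" if "0 < r" "r < 1" for r t
    using that w0 by (smt (verit) mult_nonneg_nonneg zero_le_power2)
  have *: "r * \<mu> \<le> R * (1 - (norm a)\<^sup>2)" if "0 < r" "r < 1" for r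
  proof -
    have "0 \<le> R * (R * (1 - (norm a)\<^sup>2) - r * \<mu>)"
      using has_integral_nonneg[OF mean[OF that]] gap_nonneg[OF that] by blast
    then show ?thesis using R_pos by (simp add: zero_le_mult_iff)
  qed
  have "((\<lambda>r. r * \<mu>) \<longlongrightarrow> 1 * \<mu>) (at_left 1)"
    by (intro tendsto_intros)
  moreover have "\<forall>\<^sub>F r in at_left 1. r * \<mu> \<le> R * (1 - (norm a)\<^sup>2)"
    using eventually_at_left_real[of 0 1] by (rule eventually_mono) (use * in auto)
  ultimately show "\<mu> \<le> R * (1 - (norm a)\<^sup>2)"
    using tendsto_upperbound[of "\<lambda>r. r * \<mu>" "1 * \<mu>" "at_left 1"] by simp
  assume eq: "\<mu> = R * (1 - (norm a)\<^sup>2)" and z: "z \<in> ball 0 1"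
  define G where "G z = plane_map (moeb a z)" for z
  have G: "disc_harmonic G"
    unfolding G_def by (intro disc_harmonic_plane_map moeb_holomorphic a)
  have "F z \<bullet> b = G z \<bullet> b" if b: "b \<in> Basis" for b
  proof -
    obtain H1 where H1: "H1 holomorphic_on ball 0 1" "\<And>w. w \<in> ball 0 1 \<Longrightarrow> F w \<bullet> b = Re (H1 w)"
      using disc_harmonic_inner[OF F] by blast
    obtain H2 where H2: "H2 holomorphic_on ball 0 1" "\<And>w. w \<in> ball 0 1 \<Longrightarrow> G w \<bullet> b = Re (H2 w)"
      using disc_harmonic_inner[OF G] by blast
    define Q where "Q w = H1 w - H2 w" for w
    have Q: "Q holomorphic_on ball 0 1"
      unfolding Q_def by (intro holomorphic_intros H1 H2)
    have ReQ: "Re (Q w) = (F w - G w) \<bullet> b" if "w \<in> ball 0 1" for w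
      using H1 H2 that by (simp add: Q_def inner_diff_left)
    have "(deriv ^^ n) Q 0 = 0" if n: "0 < n" for n
    proof -
      define q where "q = norm ((deriv ^^ n) Q 0 / fact n)"
      define \<beta> where "\<beta> s = s / 2 + R * \<mu> * s / (1 - norm a)\<^sup>2 + R * s\<^sup>2 / (1 - norm a)\<^sup>2" for s
      have bnd: "r ^ n * q / 2 \<le> \<beta> (sqrt (1 - r))" if r: "0 < r" "r < 1" for r
      proof -
        \<comment> \<open>The mean of the squared distance is of order \<open>1 - r\<close>.  In the estimate \<open>d \<le> s/2 + d\<^sup>2/(2 s)\<close> of
          the distance itself this choice of \<open>s\<close> balances the two terms.\<close>
        define s where "s = sqrt (1 - r)"
        have s: "0 < s" "s\<^sup>2 = 1 - r" using r by (auto simp: s_def)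
        define g where "g t = s / 2 + gap r t / ((1 - norm a)\<^sup>2 * s) + R * s\<^sup>2 / (1 - norm a)\<^sup>2" for t
        have "(g has_integral s / 2 + (R * (R * (1 - (norm a)\<^sup>2) - r * \<mu>)) / ((1 - norm a)\<^sup>2 * s) + R * s\<^sup>2 / (1 - norm a)\<^sup>2) {0..1}"
          unfolding g_def
          using has_integral_const_real[of "s/2" 0 1] has_integral_const_real[of "R * s\<^sup>2 / (1 - norm a)\<^sup>2" 0 1]
          by (intro has_integral_add[OF has_integral_add[OF _ has_integral_divide[OF mean[OF r]]]]) auto
        moreover have "s / 2 + (R * (R * (1 - (norm a)\<^sup>2) - r * \<mu>)) / ((1 - norm a)\<^sup>2 * s) + R * s\<^sup>2 / (1 - norm a)\<^sup>2 = \<beta> s"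
        proof -
          have "R * (1 - (norm a)\<^sup>2) - r * \<mu> = \<mu> * s\<^sup>2"
            by (simp add: eq s(2) algebra_simps)
          then show ?thesis using s(1) w0 by (simp add: \<beta>_def power2_eq_square)
        qed
        ultimately have g: "(g has_integral \<beta> s) {0..1}" by simp
        let ?u = "\<lambda>t. of_real (Re (Q (of_real r * cis (2 * pi * t)))) * cnj (cis (2 * pi * t)) ^ n"
        have u: "(?u has_integral of_real r ^ n * ((deriv ^^ n) Q 0 / fact n) / 2) {0..1}"
          by (rule circle_mean_Re_holomorphic[OF Q r n])
        have "norm (?u t) \<le> g t" for t
        proof -
          let ?e = "cis (2 * pi * t)"
          have "norm (?u t) = \<bar>(F (of_real r * ?e) - G (of_real r * ?e)) \<bullet> b\<bar>"
            using r ReQ[of "of_real r * ?e"] by (simp add: norm_mult norm_power)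
          also have "\<dots> \<le> norm (F (of_real r * ?e) - G (of_real r * ?e))"
            using b by (rule Basis_le_norm)
          also have "\<dots> \<le> norm (F (of_real r * ?e) - G ?e) + norm (G (of_real r * ?e) - G ?e)"
            by (rule norm_triangle_le_diff[THEN order_trans[rotated]]) (auto simp: norm_minus_commute intro: norm_triangle_sub)
          also have "norm (G (of_real r * ?e) - G ?e) \<le> R * s\<^sup>2 / (1 - norm a)\<^sup>2"
          proof -
            have "G (of_real r * ?e) - G ?e = R *\<^sub>R J (moeb a (of_real r * ?e) - moeb a ?e)"
              by (simp add: G_def plane_map_def linear_diff[OF linear_J] scaleR_diff_right)
            then have "norm (G (of_real r * ?e) - G ?e) = R * norm (moeb a (of_real r * ?e) - moeb a ?e)"
              using R_pos by simp
            also have "\<dots> \<le> R * ((1 - r) / (1 - norm a)\<^sup>2)"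
              using R_pos a r by (intro mult_left_mono moeb_lipschitz_radial) auto
            finally show ?thesis by (simp add: s(2))
          qed
          also have "norm (F (of_real r * ?e) - G ?e) \<le> s / 2 + gap r t / ((1 - norm a)\<^sup>2 * s)"
          proof -
            let ?d = "norm (F (of_real r * ?e) - G ?e)"
            have "0 \<le> (?d - s)\<^sup>2" by simp
            then have "2 * s * ?d \<le> s\<^sup>2 + ?d\<^sup>2" by (simp add: power2_eq_square algebra_simps)
            moreover have "?d\<^sup>2 \<le> 2 * gap r t / (1 - norm a)\<^sup>2"
              using dist2[OF r, of t] w0 by (simp add: G_def field_simps)
            ultimately have "2 * s * ?d \<le> s\<^sup>2 + 2 * gap r t / (1 - norm a)\<^sup>2" by linarith
            then have "?d \<le> (s\<^sup>2 + 2 * gap r t / (1 - norm a)\<^sup>2) / (2 * s)"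
              using s(1) by (simp add: pos_le_divide_eq mult.commute)
            also have "\<dots> = s / 2 + gap r t / ((1 - norm a)\<^sup>2 * s)"
              using s(1) w0 by (simp add: add_divide_distrib power2_eq_square)
            finally show ?thesis .
          qed
          finally show ?thesis by (simp add: g_def)
        qed
        then have "norm (integral {0..1} ?u) \<le> integral {0..1} g"
          using u g by (intro integral_norm_bound_integral) (auto simp: has_integral_integrable)
        then show ?thesis
          using integral_unique[OF u] integral_unique[OF g] r
          by (simp add: q_def norm_mult norm_divide norm_power s_def)
      qed
      have "((\<lambda>r. r ^ n * q / 2) \<longlongrightarrow> 1 ^ n * q / 2) (at_left 1)"
        by (intro tendsto_intros) auto
      moreover have "((\<lambda>r. \<beta> (sqrt (1 - r))) \<longlongrightarrow> \<beta> (sqrt (1 - 1))) (at_left 1)"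
        unfolding \<beta>_def by (intro tendsto_intros) (use a in auto)
      moreover have "\<forall>\<^sub>F r in at_left 1. r ^ n * q / 2 \<le> \<beta> (sqrt (1 - r))"
        using eventually_at_left_real[of 0 1] by (rule eventually_mono) (use bnd in auto)
      ultimately have "1 ^ n * q / 2 \<le> \<beta> (sqrt (1 - 1))"
        by (intro tendsto_le[of "at_left 1" _ _ "\<lambda>r. r ^ n * q / 2"]) auto
      then have "q \<le> 0" by (simp add: \<beta>_def)
      then show ?thesis by (simp add: q_def)
    qed
    then have "Q z = Q 0"
      using holomorphic_fun_eq_const_on_connected[OF Q, of 0 z] z by auto
    moreover have "Re (Q 0) = 0"
      using ReQ[of 0] F0 by (simp add: G_def moeb_def)
    ultimately show ?thesis
      using ReQ[OF z] by (simp add: inner_diff_left)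
  qed
  then show "F z = plane_map (moeb a z)"
    unfolding G_def by (rule euclidean_eqI)
qed

end

section \<open>The Schwarz--Pick lemma for conformal harmonic discs\<close>

lemma moeb_eq_Moebius_function: "moeb a = Moebius_function 0 (- a)"
  by (simp add: fun_eq_iff moeb_def Moebius_function_simple)

lemma moeb_in_disc: "a \<in> ball 0 1 \<Longrightarrow> z \<in> ball 0 1 \<Longrightarrow> moeb a z \<in> ball 0 1"
  by (simp add: moeb_eq_Moebius_function Moebius_function_norm_lt_1)

lemma moeb_moeb_minus: "a \<in> ball 0 1 \<Longrightarrow> z \<in> ball 0 1 \<Longrightarrow> moeb a (moeb (- a) z) = z"
  by (simp add: moeb_eq_Moebius_function Moebius_function_compose)

lemma moeb_has_derivative_0: "((moeb a) has_field_derivative of_real (1 - (norm a)\<^sup>2)) (at 0)"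
proof -
  have "a * cnj a = of_real ((norm a)\<^sup>2)" using complex_norm_square[of a] by simp
  then show ?thesis
    unfolding moeb_def by (auto intro!: derivative_eq_intros simp: mult.commute)
qed

lemma disc_harmonic_compose:
  assumes "disc_harmonic F" "m holomorphic_on ball 0 1" "m ` ball 0 1 \<subseteq> ball 0 1"
  shows "disc_harmonic (F \<circ> m)"
  unfolding disc_harmonic_def
proof
  fix b :: 'a
  obtain H where H: "H holomorphic_on ball 0 1" "\<And>w. w \<in> ball 0 1 \<Longrightarrow> F w \<bullet> b = Re (H w)"
    using disc_harmonic_inner[OF assms(1)] by blast
  have "(H \<circ> m) holomorphic_on ball 0 1"
    by (rule holomorphic_on_compose_gen[OF assms(2) H(1)]) (use assms in auto)
  then show "\<exists>H. H holomorphic_on ball 0 1 \<and> (\<forall>w\<in>ball 0 1. (F \<circ> m) w \<bullet> b = Re (H w))"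
    using H assms(3) by (intro exI[of _ "H \<circ> m"]) auto
qed

text \<open>
  Polarisation: compare the lengths of the images of \<open>1\<close>, \<open>\<i>\<close> and \<open>1 + \<i>\<close>.
\<close>

lemma inner_zero_of_conformal:
  fixes L :: "complex \<Rightarrow> 'b::real_inner"
  assumes "linear L" "\<And>v. norm (L v) = k * norm v"
  shows "L 1 \<bullet> L \<i> = 0"
proof -
  have "(norm (L (1 + \<i>)))\<^sup>2 = (norm (L 1))\<^sup>2 + (norm (L \<i>))\<^sup>2 + 2 * (L 1 \<bullet> L \<i>)"
    by (simp add: linear_add[OF assms(1)] power2_norm_eq_inner inner_add_left inner_add_right inner_commute)
  moreover have "(norm (1 + \<i>))\<^sup>2 = 2"
    by (simp add: cmod_power2)
  ultimately show ?thesis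
    by (simp add: assms(2) power_mult_distrib)
qed

context plane_frame begin

text \<open>
  In the plane of the frame the Cayley--Klein length of a vector of given Euclidean length is largest
  in the radial direction, and there \<open>d + |a|\<^sup>2 = 1\<close> with \<open>d = 1 - |a|\<^sup>2\<close> makes the formula collapse.
  The denominator is the length of the differential of \<open>plane_map \<circ> moeb a\<close> at the centre.
\<close>

lemma cayley_klein_plane_map:
  assumes a: "norm a < 1" and \<mu>: "0 \<le> \<mu>"
  shows "cayley_klein (plane_map a) (\<mu> *\<^sub>R J \<zeta>) \<le> \<mu> * norm \<zeta> / (R * (1 - (norm a)\<^sup>2))"
proof -
  define d where "d = 1 - (norm a)\<^sup>2"
  have d: "0 < d" using a by (simp add: d_def power_less_one_iff)
  have n: "1 - (norm (plane_map a))\<^sup>2 = R\<^sup>2 * d"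
    using norm_plane_map[of a] radius by (simp add: d_def algebra_simps)
  have "plane_map a \<bullet> (\<mu> *\<^sub>R J \<zeta>) = \<mu> * R * Re (a * cnj \<zeta>)"
    by (simp add: plane_map_def inner_add_left inner_J)
  moreover have "\<bar>Re (a * cnj \<zeta>)\<bar> \<le> norm a * norm \<zeta>"
    using abs_Re_le_cmod[of "a * cnj \<zeta>"] by (simp add: norm_mult)
  moreover have "\<bar>\<mu> * R * x\<bar> = \<mu> * R * \<bar>x\<bar>" for x
    using \<mu> R_pos by (simp add: abs_mult)
  ultimately have "\<bar>plane_map a \<bullet> (\<mu> *\<^sub>R J \<zeta>)\<bar> \<le> \<mu> * R * (norm a * norm \<zeta>)"
    using \<mu> R_pos by (simp only:) (intro mult_left_mono, auto)
  then have i: "(plane_map a \<bullet> (\<mu> *\<^sub>R J \<zeta>))\<^sup>2 \<le> (\<mu> * R * (norm a * norm \<zeta>))\<^sup>2"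
    by (metis abs_ge_zero power2_abs power_mono)
  have "(norm (\<mu> *\<^sub>R J \<zeta>))\<^sup>2 / (R\<^sup>2 * d) + (plane_map a \<bullet> (\<mu> *\<^sub>R J \<zeta>))\<^sup>2 / (R\<^sup>2 * d)\<^sup>2
      \<le> (\<mu> * norm \<zeta>)\<^sup>2 / (R\<^sup>2 * d) + (\<mu> * R * (norm a * norm \<zeta>))\<^sup>2 / (R\<^sup>2 * d)\<^sup>2"
    using i \<mu> d R_pos by (intro add_mono divide_right_mono) auto
  also have "\<dots> = (\<mu> * norm \<zeta>)\<^sup>2 * (d + (norm a)\<^sup>2) / (R * d)\<^sup>2"
    using d R_pos by (simp add: field_simps power2_eq_square)
  also have "d + (norm a)\<^sup>2 = 1" by (simp add: d_def)
  finally have "(norm (\<mu> *\<^sub>R J \<zeta>))\<^sup>2 / (R\<^sup>2 * d) + (plane_map a \<bullet> (\<mu> *\<^sub>R J \<zeta>))\<^sup>2 / (R\<^sup>2 * d)\<^sup>2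
       \<le> (\<mu> * norm \<zeta> / (R * d))\<^sup>2" by (simp add: power_divide)
  then show ?thesis
    unfolding cayley_klein_def n d_def[symmetric]
    using \<mu> d R_pos by (intro real_le_lsqrt) auto
qed

definition plane_coord :: "'b \<Rightarrow> complex"
  where "plane_coord x = Complex (x \<bullet> e1) (x \<bullet> e2) / of_real R"

lemma plane_coord_plane_map [simp]: "plane_coord (plane_map \<zeta>) = \<zeta>"
  using R_pos by (simp add: plane_coord_def plane_map_def J_def inner_add_left complex_eq_iff)

lemma affine_disc_plane_map: "affine_disc (plane_map ` ball 0 1)"
proof -
  let ?P = "range plane_map"
  have mapeq: "plane_map = (\<lambda>x. c + x) \<circ> (\<lambda>\<zeta>. R *\<^sub>R J \<zeta>)"
    by (auto simp: plane_map_def)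
  have lin: "linear (\<lambda>\<zeta>. R *\<^sub>R J \<zeta>)"
    using linear_J by (simp add: linear_compose_scale_right)
  have inj: "inj (\<lambda>\<zeta>. R *\<^sub>R J \<zeta>)"
  proof (rule injI)
    fix x y assume "R *\<^sub>R J x = R *\<^sub>R J y"
    then have "plane_map x = plane_map y" by (simp add: plane_map_def)
    then show "x = y" by (metis plane_coord_plane_map)
  qed
  have aff: "affine ?P"
    unfolding mapeq image_comp[symmetric]
    by (simp add: affine_translation[symmetric] subspace_imp_affine linear_subspace_image[OF lin])
  have dim: "aff_dim ?P = 2"
  proof -
    have "aff_dim ?P = aff_dim (range (\<lambda>\<zeta>. R *\<^sub>R J \<zeta>))"
      unfolding mapeq image_comp[symmetric] by (rule aff_dim_translation_eq)
    also have "\<dots> = aff_dim (UNIV :: complex set)"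
      by (rule aff_dim_injective_linear_image[OF lin inj])
    finally show ?thesis by simp
  qed
  have "plane_map ` ball 0 1 = ?P \<inter> ball 0 1"
  proof -
    have "norm (plane_map \<zeta>) < 1 \<longleftrightarrow> norm \<zeta> < 1" for \<zeta>
    proof -
      have "norm (plane_map \<zeta>) < 1 \<longleftrightarrow> (norm (plane_map \<zeta>))\<^sup>2 < 1"
        by (simp add: power_less_one_iff)
      also have "\<dots> \<longleftrightarrow> R\<^sup>2 * (norm \<zeta>)\<^sup>2 < R\<^sup>2"
        unfolding norm_plane_map using radius by auto
      also have "\<dots> \<longleftrightarrow> norm \<zeta> < 1"
        using R_pos by (simp add: power_less_one_iff)
      finally show ?thesis .
    qed
    then show ?thesis by auto
  qed
  then show ?thesis
    unfolding affine_disc_def using aff dim by auto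
qed

lemma bounded_linear_plane_coord: "bounded_linear plane_coord"
proof -
  have "linear plane_coord"
    by (auto simp: linear_iff plane_coord_def inner_add_left complex_eq_iff add_divide_distrib)
  then show ?thesis by (simp add: linear_conv_bounded_linear)
qed

end

text \<open>
  The differential of \<open>F\<close> at the centre, if it does not vanish, provides the orthonormal frame: \<open>e1\<close>
  and \<open>e2\<close> are its normalised values, \<open>c\<close> is the component of \<open>F 0\<close> orthogonal to them,
  and \<open>a\<close> is the remaining part of \<open>F 0\<close> measured in units of the radius \<open>R\<close>.
\<close>

lemma schwarz_center:
  fixes F :: "complex \<Rightarrow> 'b::euclidean_space"
  assumes F: "disc_harmonic F" and im: "F ` ball 0 1 \<subseteq> ball 0 1"
    and L: "(F has_derivative L) (at 0)" and conf: "\<And>v. norm (L v) = k * norm v"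
  shows "cayley_klein (F 0) (L \<zeta>) \<le> norm \<zeta>"
    and "cayley_klein (F 0) (L \<zeta>) = norm \<zeta> \<Longrightarrow> \<zeta> \<noteq> 0 \<Longrightarrow>
      \<exists>c e1 e2 R a. plane_frame c e1 e2 R \<and> a \<in> ball 0 1 \<and>
          (\<forall>w\<in>ball 0 1. F w = plane_frame.plane_map c e1 e2 R (moeb a w))"
proof -
  have lin: "linear L" using L by (rule has_derivative_linear)
  have "cayley_klein (F 0) (L \<zeta>) \<le> norm \<zeta> \<and> (cayley_klein (F 0) (L \<zeta>) = norm \<zeta> \<longrightarrow> \<zeta> \<noteq> 0 \<longrightarrow>
      (\<exists>c e1 e2 R a. plane_frame c e1 e2 R \<and> a \<in> ball 0 1 \<and>
          (\<forall>w\<in>ball 0 1. F w = plane_frame.plane_map c e1 e2 R (moeb a w))))"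
  proof (cases "k = 0")
    case True
    then have "L \<zeta> = 0" using conf[of \<zeta>] by simp
    then show ?thesis by (simp add: cayley_klein_def)
  next
    case False
    have "0 \<le> k" using conf[of 1] norm_ge_zero[of "L 1"] by simp
    with False have k: "0 < k" by simp
    define e1 where "e1 = L 1 /\<^sub>R k"
    define e2 where "e2 = L \<i> /\<^sub>R k"
    define p where "p = F 0"
    define c where "c = p - (p \<bullet> e1) *\<^sub>R e1 - (p \<bullet> e2) *\<^sub>R e2"
    define R where "R = sqrt (1 - (norm c)\<^sup>2)"
    define a where "a = Complex (p \<bullet> e1) (p \<bullet> e2) / of_real R"
    have e: "norm e1 = 1" "norm e2 = 1" "e1 \<bullet> e2 = 0"
      using k conf[of 1] conf[of \<i>] inner_zero_of_conformal[OF lin conf] by (simp_all add: e1_def e2_def)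
    then have ee: "e1 \<bullet> e1 = 1" "e2 \<bullet> e2 = 1" "e1 \<bullet> e2 = 0" "e2 \<bullet> e1 = 0"
      by (simp_all add: norm_eq_1 inner_commute)
    have ce: "c \<bullet> e1 = 0" "c \<bullet> e2 = 0"
      by (simp_all add: c_def inner_diff_left ee)
    have pc: "p = c + ((p \<bullet> e1) *\<^sub>R e1 + (p \<bullet> e2) *\<^sub>R e2)"
      by (simp add: c_def)
    have N: "(norm (c + (x *\<^sub>R e1 + y *\<^sub>R e2)))\<^sup>2 = (norm c)\<^sup>2 + (x\<^sup>2 + y\<^sup>2)" for x y
      unfolding power2_norm_eq_inner
      by (simp add: inner_add_left inner_add_right ee ce ce[THEN trans[OF inner_commute]] power2_eq_square)
    have "(norm p)\<^sup>2 = (norm c)\<^sup>2 + ((p \<bullet> e1)\<^sup>2 + (p \<bullet> e2)\<^sup>2)"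
      by (rule trans[OF arg_cong[OF pc, where f="\<lambda>x. (norm x)\<^sup>2"] N])
    moreover have "(norm p)\<^sup>2 < 1"
    proof -
      have "F 0 \<in> ball 0 1" using im by force
      then show ?thesis by (simp add: p_def power_less_one_iff)
    qed
    ultimately have lt: "(norm c)\<^sup>2 + ((p \<bullet> e1)\<^sup>2 + (p \<bullet> e2)\<^sup>2) < 1" by simp
    have R2: "R\<^sup>2 = 1 - (norm c)\<^sup>2" and R: "0 < R"
    proof -
      have "(norm c)\<^sup>2 < 1" using lt sum_power2_ge_zero[of "p \<bullet> e1" "p \<bullet> e2"] by linarith
      then show "R\<^sup>2 = 1 - (norm c)\<^sup>2" "0 < R" by (simp_all add: R_def)
    qed
    interpret plane_frame c e1 e2 R
      by unfold_locales (use e ce R R2 in auto)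
    have a: "norm a < 1"
    proof -
      have "(p \<bullet> e1)\<^sup>2 + (p \<bullet> e2)\<^sup>2 < R\<^sup>2" using lt R2 by simp
      then have "sqrt ((p \<bullet> e1)\<^sup>2 + (p \<bullet> e2)\<^sup>2) < R"
        using R by (simp add: real_less_lsqrt)
      moreover have "norm a = norm (Complex (p \<bullet> e1) (p \<bullet> e2)) / norm (complex_of_real R)"
        unfolding a_def by (rule norm_divide)
      ultimately show ?thesis using R by (simp only: complex_norm norm_of_real abs_of_pos pos_divide_less_eq mult_1)
    qed
    have F0: "F 0 = plane_map a"
    proof -
      have RJ: "R *\<^sub>R J a = (p \<bullet> e1) *\<^sub>R e1 + (p \<bullet> e2) *\<^sub>R e2"
        using R by (simp add: J_def a_def scaleR_add_right)
      show ?thesis unfolding p_def[symmetric] plane_map_def RJ by (rule pc)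
    qed
    have L1: "L 1 = k *\<^sub>R e1" and Li: "L \<i> = k *\<^sub>R e2"
      using k by (simp_all add: e1_def e2_def)
    have LJ: "L v = k *\<^sub>R J v" for v
    proof -
      have "v = Re v *\<^sub>R 1 + Im v *\<^sub>R \<i>" by (simp add: complex_eq_iff)
      then have "L v = Re v *\<^sub>R L 1 + Im v *\<^sub>R L \<i>"
        by (metis linear_add linear_scale lin)
      then show ?thesis by (simp add: J_def L1 Li algebra_simps)
    qed
    have bound: "norm (F z) \<le> 1" if "z \<in> ball 0 1" for z
      using im that by (force simp: less_imp_le)
    note S = derivative_bound_at_center[OF F bound F0 a L L1 Li]
    define s where "s = R * (1 - (norm a)\<^sup>2)"
    have s: "0 < s" using R a by (simp add: s_def power_less_one_iff)
    have ck: "cayley_klein (F 0) (L \<zeta>) \<le> k * norm \<zeta> / s"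
      unfolding F0 LJ s_def using cayley_klein_plane_map[OF a, of k \<zeta>] k by simp
    have ks: "k \<le> s" using S(1) by (simp add: s_def)
    have "k * norm \<zeta> / s \<le> norm \<zeta>"
      using ks s by (simp add: divide_le_eq mult.commute[of "norm \<zeta>"] mult_right_mono)
    moreover have "k = s" if "cayley_klein (F 0) (L \<zeta>) = norm \<zeta>" "\<zeta> \<noteq> 0"
    proof -
      have "norm \<zeta> * s \<le> norm \<zeta> * k"
        using that ck s by (simp add: le_divide_eq mult.commute)
      then show ?thesis using ks that(2) by simp
    qed
    ultimately show ?thesis
      using ck S(2) plane_frame_axioms a by (auto simp: s_def) blast+
  qed
  then show "cayley_klein (F 0) (L \<zeta>) \<le> norm \<zeta>"
    and "cayley_klein (F 0) (L \<zeta>) = norm \<zeta> \<Longrightarrow> \<zeta> \<noteq> 0 \<Longrightarrow>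
      \<exists>c e1 e2 R a. plane_frame c e1 e2 R \<and> a \<in> ball 0 1 \<and>
          (\<forall>w\<in>ball 0 1. F w = plane_frame.plane_map c e1 e2 R (moeb a w))"
    by blast+
qed

text \<open>
  A disc automorphism moves \<open>z\<close> to the centre.  In the case of equality \<open>F\<close> is an affine isometry
  onto a plane, up to the scale \<open>R\<close>, composed with disc automorphisms; this gives the inverse \<open>h\<close>
  explicitly.  The differential of a map with a differentiable left inverse is injective.
\<close>

theorem schwarz_pick:
  fixes F :: "complex \<Rightarrow> 'b::euclidean_space"
  assumes F: "disc_harmonic F" and im: "F ` ball 0 1 \<subseteq> ball 0 1" and z: "z \<in> ball 0 1"
    and L: "(F has_derivative L) (at z)" and conf: "\<And>v. norm (L v) = k * norm v"
  shows "cayley_klein (F z) (L \<zeta>) \<le> poincare_disc z \<zeta>"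
    and "cayley_klein (F z) (L \<zeta>) = poincare_disc z \<zeta> \<Longrightarrow> \<zeta> \<noteq> 0 \<Longrightarrow>
      \<exists>\<Delta> h. affine_disc \<Delta> \<and> homeomorphism (ball 0 1) \<Delta> F h \<and>
        (\<forall>w\<in>ball 0 1. \<forall>L. (F has_derivative L) (at w) \<longrightarrow> inj L)"
proof -
  define d where "d = 1 - (norm z)\<^sup>2"
  have d: "0 < d" using z by (simp add: d_def power_less_one_iff)
  have Fm: "disc_harmonic (F \<circ> moeb z)"
    using z by (intro disc_harmonic_compose F moeb_holomorphic) (auto intro: moeb_in_disc simp del: mem_ball_0) 
  have imm: "(F \<circ> moeb z) ` ball 0 1 \<subseteq> ball 0 1"
    using im moeb_in_disc[OF z] by (auto simp del: mem_ball_0)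
  have m0: "moeb z 0 = z" by (simp add: moeb_def)
  have Lm: "((F \<circ> moeb z) has_derivative (\<lambda>v. L (d *\<^sub>R v))) (at 0)"
  proof -
    have "(moeb z has_derivative (\<lambda>v. d *\<^sub>R v)) (at 0)"
      using moeb_has_derivative_0[of z] by (simp add: has_field_derivative_def d_def scaleR_conv_of_real mult_commute_abs)
    then have "((F \<circ> moeb z) has_derivative (L \<circ> (\<lambda>v. d *\<^sub>R v))) (at 0)"
      by (rule diff_chain_at) (simp add: m0 L)
    then show ?thesis by (simp add: o_def)
  qed
  have confm: "norm (L (d *\<^sub>R v)) = (k * d) * norm v" for v
    using d by (simp add: conf)
  note S = schwarz_center[OF Fm imm Lm confm, of "\<zeta> /\<^sub>R d"]
  have pd: "norm (\<zeta> /\<^sub>R d) = poincare_disc z \<zeta>"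
    using d by (simp add: poincare_disc_def d_def divide_inverse_commute)
  show "cayley_klein (F z) (L \<zeta>) \<le> poincare_disc z \<zeta>"
    using S(1) d unfolding pd by (simp add: m0)
  assume "cayley_klein (F z) (L \<zeta>) = poincare_disc z \<zeta>" "\<zeta> \<noteq> 0"
  then obtain c e1 e2 R a where fr: "plane_frame c e1 e2 R" and a: "a \<in> ball 0 1"
    and Feq: "\<And>w. w \<in> ball 0 1 \<Longrightarrow> F (moeb z w) = plane_frame.plane_map c e1 e2 R (moeb a w)"
    using S(2) d unfolding pd by (auto simp: m0)
  interpret plane_frame c e1 e2 R by (rule fr)
  define m where "m = moeb a \<circ> moeb (- z)"
  define m' where "m' = moeb z \<circ> moeb (- a)"
  have z': "- z \<in> ball 0 1" and a': "- a \<in> ball 0 1" using z a by auto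
  have mD: "m w \<in> ball 0 1" "m' w \<in> ball 0 1" if "w \<in> ball 0 1" for w
    unfolding m_def m'_def o_apply by (intro moeb_in_disc that z a z' a')+
  have mm: "m (m' w) = w" "m' (m w) = w" if "w \<in> ball 0 1" for w
  proof -
    have "moeb (- z) (moeb z (moeb (- a) w)) = moeb (- a) w"
      using moeb_moeb_minus[OF z' moeb_in_disc[OF a' that]] by simp
    then show "m (m' w) = w"
      using moeb_moeb_minus[OF a that] by (simp add: m_def m'_def)
    have "moeb (- a) (moeb a (moeb (- z) w)) = moeb (- z) w"
      using moeb_moeb_minus[OF a' moeb_in_disc[OF z' that]] by simp
    then show "m' (m w) = w"
      using moeb_moeb_minus[OF z that] by (simp add: m_def m'_def)
  qed
  have holm: "m holomorphic_on ball 0 1" "m' holomorphic_on ball 0 1"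
    unfolding m_def m'_def using z a z' a'
    by (auto simp del: mem_ball_0 intro!: holomorphic_on_compose_gen[where t="ball 0 1"] moeb_holomorphic moeb_in_disc)
  have Fm: "F w = plane_map (m w)" if "w \<in> ball 0 1" for w
    using Feq[OF moeb_in_disc[OF z' that]] moeb_moeb_minus[OF z that] by (simp add: m_def)
  let ?\<Delta> = "plane_map ` ball 0 1" and ?h = "m' \<circ> plane_coord"
  have cF: "continuous_on (ball 0 1) F"
    by (intro continuous_at_imp_continuous_on ballI differentiable_imp_continuous_within disc_harmonic_differentiable F)
  have "homeomorphism (ball 0 1) ?\<Delta> F ?h"
  proof (rule homeomorphismI)
    show "continuous_on (ball 0 1) F" by (rule cF)
    show "continuous_on ?\<Delta> ?h"
      by (intro continuous_on_compose linear_continuous_on bounded_linear_plane_coord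
          holomorphic_on_imp_continuous_on holomorphic_on_subset[OF holm(2)]) auto
    show "F ` ball 0 1 \<subseteq> ?\<Delta>" using Fm mD by (auto simp del: mem_ball_0)
    show "?h ` ?\<Delta> \<subseteq> ball 0 1" using mD by (auto simp del: mem_ball_0)
    show "?h (F x) = x" if "x \<in> ball 0 1" for x
      using that Fm mm by simp
    show "F (?h y) = y" if "y \<in> ?\<Delta>" for y
      using that Fm mm mD by (auto simp del: mem_ball_0)
  qed
  moreover have "inj L" if w: "w \<in> ball 0 1" and L: "(F has_derivative L) (at w)" for w L
  proof -
    have Fw: "plane_coord (F w) \<in> ball 0 1" using Fm[OF w] mD[OF w] by simp
    have "(m' has_derivative (*) (deriv m' (plane_coord (F w)))) (at (plane_coord (F w)))"
      using holomorphic_derivI[OF holm(2) open_ball Fw] by (simp add: has_field_derivative_def)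
    moreover have "(plane_coord has_derivative plane_coord) (at (F w))"
      by (rule bounded_linear_imp_has_derivative[OF bounded_linear_plane_coord])
    ultimately have "((m' \<circ> plane_coord \<circ> F) has_derivative ((*) (deriv m' (plane_coord (F w))) \<circ> plane_coord \<circ> L)) (at w)"
      by (intro diff_chain_at L) auto
    moreover have "((m' \<circ> plane_coord \<circ> F) has_derivative id) (at w)"
      by (rule has_derivative_transform_within_open[OF has_derivative_id open_ball w])
        (use Fm mm in \<open>auto simp: id_def\<close>)
    ultimately have "(*) (deriv m' (plane_coord (F w))) \<circ> plane_coord \<circ> L = id"
      by (rule has_derivative_unique)
    then show "inj L" by (metis inj_on_id inj_on_imageI2)
  qed
  ultimately show "\<exists>\<Delta> h. affine_disc \<Delta> \<and> homeomorphism (ball 0 1) \<Delta> F h \<and>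
        (\<forall>w\<in>ball 0 1. \<forall>L. (F has_derivative L) (at w) \<longrightarrow> inj L)"
    using affine_disc_plane_map by blast
qed

section \<open>Harmonic functions are locally real parts of holomorphic functions\<close>

text \<open>
  The second difference of \<open>u\<close> along \<open>v\<close> and \<open>w\<close> is, by the mean value theorem, \<open>h\<close> times a
  difference of directional derivatives along \<open>v\<close>, which is controlled by the derivative \<open>A\<close>.
\<close>

lemma second_difference_estimate:
  fixes u :: "'c::real_normed_vector \<Rightarrow> real"
  assumes S: "open S" "z \<in> S" and u: "\<forall>w\<in>S. u differentiable (at w)"
    and A: "((\<lambda>w. frechet_derivative u (at w) v) has_derivative A) (at z)" and e: "0 < e"
  shows "\<forall>\<^sub>F h in at_right 0. \<bar>u (z + h *\<^sub>R v + h *\<^sub>R w) - u (z + h *\<^sub>R v) - u (z + h *\<^sub>R w) + u z - h\<^sup>2 * A w\<bar>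
            \<le> e * h\<^sup>2"
proof -
  define D where "D y = frechet_derivative u (at y) v" for y
  define K where "K = 2 * norm v + norm w + 1"
  have K: "0 < K" by (simp add: K_def add_nonneg_pos)
  have linA: "linear A" using A by (rule has_derivative_linear)
  obtain d where d: "0 < d" "\<And>y. norm (y - z) < d \<Longrightarrow> \<bar>D y - D z - A (y - z)\<bar> \<le> e / K * norm (y - z)"
    using A e K unfolding has_derivative_at_alt D_def[symmetric] real_norm_def
    by (metis divide_pos_pos)
  obtain d' where d': "0 < d'" "ball z d' \<subseteq> S"
    using S by (auto simp: open_contains_ball)
  define h0 where "h0 = min d d' / K"
  have h0: "0 < h0" using d d' K by (simp add: h0_def)
  have "\<bar>u (z + h *\<^sub>R v + h *\<^sub>R w) - u (z + h *\<^sub>R v) - u (z + h *\<^sub>R w) + u z - h\<^sup>2 * A w\<bar> \<le> e * h\<^sup>2"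
    if h: "0 < h" "h < h0" for h
  proof -
    have hK: "h * K < min d d'" using h K by (simp add: h0_def pos_less_divide_eq)
    have nb: "norm (t *\<^sub>R v + h *\<^sub>R w) \<le> h * (norm v + norm w)" "norm (t *\<^sub>R v) \<le> h * norm v" if "0 \<le> t" "t \<le> h" for t
    proof -
      show 1: "norm (t *\<^sub>R v) \<le> h * norm v" using that by (simp add: mult_right_mono)
      then show "norm (t *\<^sub>R v + h *\<^sub>R w) \<le> h * (norm v + norm w)"
        using h norm_triangle_ineq[of "t *\<^sub>R v" "h *\<^sub>R w"] by (simp add: algebra_simps)
    qed
    have le: "h * (norm v + norm w) \<le> h * K" "h * norm v \<le> h * K"
      using h by (auto simp: K_def)
    have near: "norm (t *\<^sub>R v + h *\<^sub>R w) < d" "norm (t *\<^sub>R v) < d" 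
       "z + t *\<^sub>R v + h *\<^sub>R w \<in> S" "z + t *\<^sub>R v \<in> S" if "0 \<le> t" "t \<le> h" for t
    proof -
      have *: "norm (t *\<^sub>R v + h *\<^sub>R w) < min d d'" "norm (t *\<^sub>R v) < min d d'"
        using nb[OF that] le hK by linarith+
      then show "norm (t *\<^sub>R v + h *\<^sub>R w) < d" "norm (t *\<^sub>R v) < d" by auto
      show "z + t *\<^sub>R v + h *\<^sub>R w \<in> S" "z + t *\<^sub>R v \<in> S"
        using * by (auto intro!: subsetD[OF d'(2)] simp: dist_norm norm_minus_commute add.assoc simp flip: minus_add_distrib)
    qed
    define f where "f t = u (z + t *\<^sub>R v + h *\<^sub>R w) - u (z + t *\<^sub>R v)" for t
    have f: "(f has_real_derivative D (z + t *\<^sub>R v + h *\<^sub>R w) - D (z + t *\<^sub>R v)) (at t)" if "0 \<le> t" "t \<le> h" for t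
    proof -
      have "((\<lambda>t. u (z + t *\<^sub>R v + h *\<^sub>R w)) has_derivative
         (\<lambda>s. frechet_derivative u (at (z + t *\<^sub>R v + h *\<^sub>R w)) (s *\<^sub>R v))) (at t)"
        by (rule has_derivative_compose[of "\<lambda>t. z + t *\<^sub>R v + h *\<^sub>R w" "\<lambda>s. s *\<^sub>R v"])
          (use near[OF that] u frechet_derivative_works in \<open>auto intro!: derivative_eq_intros\<close>)
      moreover have "((\<lambda>t. u (z + t *\<^sub>R v)) has_derivative
         (\<lambda>s. frechet_derivative u (at (z + t *\<^sub>R v)) (s *\<^sub>R v))) (at t)"
        by (rule has_derivative_compose[of "\<lambda>t. z + t *\<^sub>R v" "\<lambda>s. s *\<^sub>R v"])
          (use near[OF that] u frechet_derivative_works in \<open>auto intro!: derivative_eq_intros\<close>)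
      ultimately have "(f has_derivative (\<lambda>s. frechet_derivative u (at (z + t *\<^sub>R v + h *\<^sub>R w)) (s *\<^sub>R v)
          - frechet_derivative u (at (z + t *\<^sub>R v)) (s *\<^sub>R v))) (at t)"
        unfolding f_def by (rule has_derivative_diff)
      moreover have "frechet_derivative u (at y) (s *\<^sub>R v) = s * D y" if "y \<in> S" for y s
        using linear_scale[OF linear_frechet_derivative[OF u[rule_format, OF that]]] by (simp add: D_def)
      ultimately show ?thesis
        using near[OF that] unfolding has_field_derivative_def
        by (elim has_derivative_eq_rhs) (auto simp: fun_eq_iff algebra_simps)
    qed
    obtain t where t: "0 < t" "t < h" "f h - f 0 = (h - 0) * (D (z + t *\<^sub>R v + h *\<^sub>R w) - D (z + t *\<^sub>R v))"
      using MVT2[OF h(1), of f "\<lambda>t. D (z + t *\<^sub>R v + h *\<^sub>R w) - D (z + t *\<^sub>R v)"] f by auto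
    have th: "0 \<le> t" "t \<le> h" using t by auto
    define r1 where "r1 = D (z + t *\<^sub>R v + h *\<^sub>R w) - D z - A (t *\<^sub>R v + h *\<^sub>R w)"
    define r2 where "r2 = D (z + t *\<^sub>R v) - D z - A (t *\<^sub>R v)"
    have r1: "\<bar>r1\<bar> \<le> e / K * norm (t *\<^sub>R v + h *\<^sub>R w)"
      using d(2)[of "z + t *\<^sub>R v + h *\<^sub>R w"] near(1)[OF th] by (simp add: r1_def algebra_simps)
    have r2: "\<bar>r2\<bar> \<le> e / K * norm (t *\<^sub>R v)"
      using d(2)[of "z + t *\<^sub>R v"] near(2)[OF th] by (simp add: r2_def)
    have "\<bar>r1 - r2\<bar> \<le> e / K * norm (t *\<^sub>R v + h *\<^sub>R w) + e / K * norm (t *\<^sub>R v)"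
      using r1 r2 by linarith
    also have "\<dots> = e / K * (norm (t *\<^sub>R v + h *\<^sub>R w) + norm (t *\<^sub>R v))" by (simp add: algebra_simps)
    also have "\<dots> \<le> e / K * (h * K)"
    proof (rule mult_left_mono)
      have "norm (t *\<^sub>R v + h *\<^sub>R w) + norm (t *\<^sub>R v) \<le> h * (2 * norm v + norm w)"
        using nb[OF th] by (simp add: algebra_simps)
      also have "\<dots> \<le> h * K" using h by (simp add: K_def)
      finally show "norm (t *\<^sub>R v + h *\<^sub>R w) + norm (t *\<^sub>R v) \<le> h * K" .
    qed (use e K in simp)
    also have "\<dots> = e * h" using K by simp
    finally have r: "\<bar>r1 - r2\<bar> \<le> e * h" .
    have "u (z + h *\<^sub>R v + h *\<^sub>R w) - u (z + h *\<^sub>R v) - u (z + h *\<^sub>R w) + u z = f h - f 0"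
      by (simp add: f_def)
    also have "\<dots> = h * (A (h *\<^sub>R w) + (r1 - r2))"
      unfolding t(3) by (simp add: r1_def r2_def linear_add[OF linA])
    finally have "u (z + h *\<^sub>R v + h *\<^sub>R w) - u (z + h *\<^sub>R v) - u (z + h *\<^sub>R w) + u z - h\<^sup>2 * A w = h * (r1 - r2)"
      by (simp add: linear_scale[OF linA] power2_eq_square algebra_simps)
    then have "\<bar>u (z + h *\<^sub>R v + h *\<^sub>R w) - u (z + h *\<^sub>R v) - u (z + h *\<^sub>R w) + u z - h\<^sup>2 * A w\<bar> = h * \<bar>r1 - r2\<bar>"
      using h by (simp add: abs_mult)
    also have "\<dots> \<le> h * (e * h)" using r h by (simp add: mult_left_mono)
    finally show ?thesis by (simp add: power2_eq_square mult_ac)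
  qed
  then show ?thesis
    using h0 by (auto simp: eventually_at_right_field)
qed

text \<open>
  The second difference is symmetric in the two directions, so the limits of both estimates agree.
\<close>

lemma second_derivative_symmetric:
  fixes u :: "'c::real_normed_vector \<Rightarrow> real"
  assumes S: "open S" "z \<in> S" and u: "\<forall>w\<in>S. u differentiable (at w)"
    and A: "((\<lambda>w. frechet_derivative u (at w) v) has_derivative A) (at z)"
    and B: "((\<lambda>w. frechet_derivative u (at w) w') has_derivative B) (at z)"
  shows "A w' = B v"
proof (rule ccontr)
  assume "A w' \<noteq> B v"
  then have e: "0 < \<bar>A w' - B v\<bar> / 3" by simp
  let ?e = "\<bar>A w' - B v\<bar> / 3"
  have "\<forall>\<^sub>F h in at_right (0::real). False"
    using second_difference_estimate[OF S u A e, of w'] second_difference_estimate[OF S u B e, of v] 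
      eventually_at_right_less[of 0]
  proof eventually_elim
    case (elim h)
    let ?Q = "u (z + h *\<^sub>R v + h *\<^sub>R w') - u (z + h *\<^sub>R v) - u (z + h *\<^sub>R w') + u z"
    have "\<bar>?Q - h\<^sup>2 * A w'\<bar> \<le> ?e * h\<^sup>2" using elim(1) by simp
    moreover have "\<bar>?Q - h\<^sup>2 * B v\<bar> \<le> ?e * h\<^sup>2"
    proof -
      have "?Q = u (z + h *\<^sub>R w' + h *\<^sub>R v) - u (z + h *\<^sub>R w') - u (z + h *\<^sub>R v) + u z"
        by (simp add: add.commute add.left_commute)
      then show ?thesis using elim(2) by (simp only:)
    qed
    ultimately have "\<bar>h\<^sup>2 * A w' - h\<^sup>2 * B v\<bar> \<le> 2 * (?e * h\<^sup>2)" by linarith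
    moreover have "\<bar>h\<^sup>2 * A w' - h\<^sup>2 * B v\<bar> = 3 * (?e * h\<^sup>2)"
      by (simp add: abs_mult flip: right_diff_distrib)
    moreover have "0 < ?e * h\<^sup>2" using e elim(3) by simp
    ultimately show False by linarith
  qed
  then show False by simp
qed

text \<open>
  This notion, unlike the one by partial derivatives, is visibly stable under composition with
  holomorphic and antiholomorphic maps.
\<close>

definition locally_Re :: "(complex \<Rightarrow> real) \<Rightarrow> complex \<Rightarrow> bool"
  where "locally_Re u z \<longleftrightarrow> (\<exists>\<epsilon>>0. \<exists>H. H holomorphic_on ball z \<epsilon> \<and> (\<forall>w\<in>ball z \<epsilon>. u w = Re (H w)))"

lemma differentiable_dx_dy:
  assumes "u differentiable (at z)"
  shows "(u has_derivative (\<lambda>v. Re v *\<^sub>R dx u z + Im v *\<^sub>R dy u z)) (at z)"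
proof -
  have lin: "linear (frechet_derivative u (at z))" by (rule linear_frechet_derivative[OF assms])
  have "frechet_derivative u (at z) v = Re v *\<^sub>R dx u z + Im v *\<^sub>R dy u z" for v
  proof -
    have "v = Re v *\<^sub>R 1 + Im v *\<^sub>R \<i>" by (simp add: complex_eq_iff)
    then have "frechet_derivative u (at z) v = frechet_derivative u (at z) (Re v *\<^sub>R 1 + Im v *\<^sub>R \<i>)"
      by (rule arg_cong)
    then show ?thesis
      by (simp only: linear_add[OF lin] linear_scale[OF lin] dir_deriv_def)
  qed
  then have "frechet_derivative u (at z) = (\<lambda>v. Re v *\<^sub>R dx u z + Im v *\<^sub>R dy u z)" by blast
  then show ?thesis
    using frechet_derivative_works[of u "at z"] assms by simp
qed

text \<open>
  A primitive of the complex gradient has real part \<open>u\<close> up to a constant, because the differentials agree.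
\<close>

lemma Re_of_holomorphic_gradient:
  assumes S: "convex S" "open S" and u: "\<And>z. z \<in> S \<Longrightarrow> u differentiable (at z)"
    and q: "(\<lambda>z. of_real (dx u z) - \<i> * of_real (dy u z)) holomorphic_on S"
  shows "\<exists>H. H holomorphic_on S \<and> (\<forall>z\<in>S. u z = Re (H z))"
proof (cases "S = {}")
  case False
  then obtain z0 where z0: "z0 \<in> S" by blast
  obtain P where P: "\<And>x. x \<in> S \<Longrightarrow> (P has_field_derivative (of_real (dx u x) - \<i> * of_real (dy u x))) (at x within S)"
    using holomorphic_convex_primitive'[OF S q] by blast
  have "((\<lambda>z. u z - Re (P z)) has_derivative (\<lambda>_. 0)) (at x within S)" if "x \<in> S" for x
  proof -
    have 1: "((\<lambda>z. Re (P z)) has_derivative (\<lambda>v. Re ((of_real (dx u x) - \<i> * of_real (dy u x)) * v))) (at x within S)"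
      using P[OF that] by (auto simp: has_field_derivative_def intro!: derivative_eq_intros)
    have 2: "(u has_derivative (\<lambda>v. Re v *\<^sub>R dx u x + Im v *\<^sub>R dy u x)) (at x within S)"
      using differentiable_dx_dy[OF u[OF that]] by (rule has_derivative_at_withinI)
    show ?thesis
      by (rule has_derivative_eq_rhs[OF has_derivative_diff[OF 2 1]]) (auto simp: fun_eq_iff algebra_simps)
  qed
  then have "\<exists>k. \<forall>x\<in>S. u x - Re (P x) = k"
    by (intro has_derivative_zero_constant S(1)) auto
  then obtain k where k: "\<And>x. x \<in> S \<Longrightarrow> u x - Re (P x) = k" by blast
  show ?thesis
  proof (intro exI conjI ballI)
    have "P holomorphic_on S"
      using P by (auto simp: holomorphic_on_def field_differentiable_def)
    then show "(\<lambda>z. P z + of_real k) holomorphic_on S" by (intro holomorphic_intros)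
    show "u z = Re (P z + of_real k)" if "z \<in> S" for z
      using k[OF that] by simp
  qed
next
  case True
  then show ?thesis by (intro exI[of _ "\<lambda>_. 0"]) auto
qed

text \<open>
  The Laplace equation and the symmetry of the second derivative are the Cauchy--Riemann equations of
  the complex gradient.
\<close>

lemma harmonic_on_gradient_holomorphic:
  assumes S: "open S" and u: "harmonic_on S u"
  shows "(\<lambda>z. of_real (dx u z) - \<i> * of_real (dy u z)) holomorphic_on S"
proof -
  have "((\<lambda>z. of_real (dx u z) - \<i> * of_real (dy u z)) has_field_derivative
      (of_real (dx (dx u) z) - \<i> * of_real (dx (dy u) z))) (at z)" if z: "z \<in> S" for z
  proof -
    have c: "\<forall>w\<in>S. u differentiable (at w)" "dx u differentiable (at z)" "dy u differentiable (at z)"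
      and lap: "dy (dy u) z = - dx (dx u) z"
      using u z by (auto simp: harmonic_on_def C2_on_def C1_on_def add_eq_0_iff)
    note A = differentiable_dx_dy[OF c(2)] and B = differentiable_dx_dy[OF c(3)]
    have mixed: "dy (dx u) z = dx (dy u) z"
      using second_derivative_symmetric[of S z u 1 _ \<i>, OF S z c(1) A[unfolded dir_deriv_def[of 1 u]] B[unfolded dir_deriv_def[of \<i> u]]]
      by (simp add: dir_deriv_def[of \<i> "dx u"] dir_deriv_def[of 1 "dy u"] dir_deriv_def[of 1 u, abs_def] dir_deriv_def[of \<i> u, abs_def])
    have "((\<lambda>z. of_real (dx u z) - \<i> * of_real (dy u z)) has_derivative
      (\<lambda>v. of_real (Re v *\<^sub>R dx (dx u) z + Im v *\<^sub>R dy (dx u) z)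
          - \<i> * of_real (Re v *\<^sub>R dx (dy u) z + Im v *\<^sub>R dy (dy u) z))) (at z)"
      by (intro has_derivative_diff has_derivative_mult_right has_derivative_of_real A B)
    moreover have "of_real (Re v *\<^sub>R dx (dx u) z + Im v *\<^sub>R dy (dx u) z)
          - \<i> * of_real (Re v *\<^sub>R dx (dy u) z + Im v *\<^sub>R dy (dy u) z)
        = (of_real (dx (dx u) z) - \<i> * of_real (dx (dy u) z)) * v" for v
      unfolding mixed lap by (simp add: complex_eq_iff algebra_simps)
    ultimately show ?thesis
      by (simp add: has_field_derivative_def)
  qed
  then show ?thesis
    using S by (auto simp: holomorphic_on_open)
qed

lemma harmonic_on_locally_Re:
  assumes S: "open S" and u: "harmonic_on S u" and z: "z \<in> S"
  shows "locally_Re u z"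
proof -
  obtain e where e: "0 < e" "ball z e \<subseteq> S" using S z by (auto simp: open_contains_ball)
  have "\<exists>H. H holomorphic_on ball z e \<and> (\<forall>w\<in>ball z e. u w = Re (H w))"
    by (intro Re_of_holomorphic_gradient holomorphic_on_subset[OF harmonic_on_gradient_holomorphic[OF S u]] e)
      (use u e in \<open>auto simp: harmonic_on_def C2_on_def C1_on_def\<close>)
  then show ?thesis using e by (auto simp: locally_Re_def)
qed

text \<open>
  The local holomorphic functions differ by imaginary constants, so their derivatives fit together to
  the complex gradient, which has a primitive on a convex set.
\<close>

lemma locally_Re_imp_Re:
  assumes S: "convex S" "open S" and u: "\<And>z. z \<in> S \<Longrightarrow> locally_Re u z"
  shows "\<exists>H. H holomorphic_on S \<and> (\<forall>z\<in>S. u z = Re (H z))"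
proof (rule Re_of_holomorphic_gradient[OF S])
  have *: "u differentiable (at z) \<and> (\<lambda>z. of_real (dx u z) - \<i> * of_real (dy u z)) field_differentiable (at z)"
    if zS: "z \<in> S" for z
  proof -
    obtain e H where e: "0 < e" and H: "H holomorphic_on ball z e" "\<And>w. w \<in> ball z e \<Longrightarrow> u w = Re (H w)"
      using u[OF zS] unfolding locally_Re_def by blast
    have D: "(u has_derivative (\<lambda>v. Re (deriv H w * v))) (at w)" if "w \<in> ball z e" for w
      by (rule has_derivative_transform_within_open[OF Re_holomorphic_has_derivative[OF H(1) open_ball that] open_ball that])
        (use H in auto)
    have z: "z \<in> ball z e" using e by simp
    have "of_real (dx u w) - \<i> * of_real (dy u w) = deriv H w" if "w \<in> ball z e" for w
      using frechet_derivative_at[OF D[OF that], symmetric] by (simp add: dir_deriv_def complex_eq_iff)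
    moreover obtain d where d: "(deriv H has_field_derivative d) (at z)"
      using holomorphic_on_imp_differentiable_at[OF holomorphic_deriv[OF H(1) open_ball] open_ball z]
      by (auto simp: field_differentiable_def)
    ultimately have "((\<lambda>z. of_real (dx u z) - \<i> * of_real (dy u z)) has_field_derivative d) (at z)"
      by (intro has_field_derivative_transform_within_open[OF d open_ball z]) simp
    then have "(\<lambda>z. of_real (dx u z) - \<i> * of_real (dy u z)) field_differentiable (at z)"
      by (auto simp: field_differentiable_def)
    then show ?thesis using D[OF z] by (auto simp: differentiable_def)
  qed
  show "u differentiable (at z)" if "z \<in> S" for z using * that by blast
  show "(\<lambda>z. of_real (dx u z) - \<i> * of_real (dy u z)) holomorphic_on S"
    using * by (auto simp: holomorphic_on_def intro: field_differentiable_at_within)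
qed

lemma locally_Re_cong:
  assumes "locally_Re u z" "open N" "z \<in> N" "\<And>w. w \<in> N \<Longrightarrow> v w = u w"
  shows "locally_Re v z"
proof -
  obtain e H where e: "0 < e" and H: "H holomorphic_on ball z e" "\<And>w. w \<in> ball z e \<Longrightarrow> u w = Re (H w)"
    using assms(1) unfolding locally_Re_def by blast
  obtain d where d: "0 < d" "ball z d \<subseteq> N" using assms by (auto simp: open_contains_ball)
  show ?thesis unfolding locally_Re_def
  proof (intro exI conjI ballI)
    show "0 < min e d" using e d by simp
    show "H holomorphic_on ball z (min e d)" by (rule holomorphic_on_subset[OF H(1)]) auto
    show "v w = Re (H w)" if "w \<in> ball z (min e d)" for w
      using that assms(4)[of w] H(2)[of w] d(2) by auto
  qed
qed

section \<open>Locally conformal maps and piecewise smooth paths\<close>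

definition locally_conformal :: "(complex \<Rightarrow> complex) \<Rightarrow> complex \<Rightarrow> bool"
  where "locally_conformal g z \<longleftrightarrow> (\<exists>N k. open N \<and> z \<in> N \<and> k holomorphic_on N \<and> (\<forall>w\<in>N. deriv k w \<noteq> 0) \<and>
     ((\<forall>w\<in>N. g w = k w) \<or> (\<forall>w\<in>N. g w = cnj (k w))))"

lemma conformal_map_on_locally_conformal:
  assumes g: "conformal_map_on S g" and S: "open S" "z \<in> S"
  shows "locally_conformal g z"
proof -
  obtain C where C: "C \<in> components S" "z \<in> C"
    using S(2) Union_components[of S] by blast
  have oC: "open C" using C S open_components by blast
  from g C consider "g holomorphic_on C" "\<forall>z\<in>C. deriv g z \<noteq> 0"
    | "(cnj \<circ> g) holomorphic_on C" "\<forall>z\<in>C. deriv (cnj \<circ> g) z \<noteq> 0"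
    unfolding conformal_map_on_def by blast
  then show ?thesis
  proof cases
    case 1
    then show ?thesis unfolding locally_conformal_def using oC C by blast
  next
    case 2
    have "\<forall>w\<in>C. g w = cnj ((cnj \<circ> g) w)" by simp
    with 2 show ?thesis unfolding locally_conformal_def using oC C by blast
  qed
qed

lemma locally_conformal_has_derivative:
  assumes "locally_conformal g z"
  obtains L k where "(g has_derivative L) (at z)" "0 < k" "\<And>v. norm (L v) = k * norm v"
proof -
  obtain N k where N: "open N" "z \<in> N" "k holomorphic_on N" "\<forall>w\<in>N. deriv k w \<noteq> 0"
     and g: "(\<forall>w\<in>N. g w = k w) \<or> (\<forall>w\<in>N. g w = cnj (k w))"
    using assms unfolding locally_conformal_def by blast
  have k: "(k has_derivative (*) (deriv k z)) (at z)"
    using holomorphic_derivI[OF N(3,1,2)] by (simp add: has_field_derivative_def)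
  have nz: "0 < norm (deriv k z)" using N by simp
  from g show thesis
  proof
    assume g: "\<forall>w\<in>N. g w = k w"
    have "(g has_derivative (*) (deriv k z)) (at z)"
      by (rule has_derivative_transform_within_open[OF k N(1,2)]) (use g in auto)
    then show thesis using that nz by (metis norm_mult)
  next
    assume g: "\<forall>w\<in>N. g w = cnj (k w)"
    have "((\<lambda>w. cnj (k w)) has_derivative (\<lambda>v. cnj (deriv k z * v))) (at z)"
      using k by (rule has_derivative_cnj)
    then have "(g has_derivative (\<lambda>v. cnj (deriv k z * v))) (at z)"
      by (rule has_derivative_transform_within_open[OF _ N(1,2)]) (use g in auto)
    then show thesis using that nz by (metis norm_mult complex_mod_cnj)
  qed
qed

lemma C1_on_holomorphic:
  assumes "k holomorphic_on N" "open N"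
  shows "C1_on N k"
proof -
  have k: "(k has_derivative (*) (deriv k z)) (at z)" if "z \<in> N" for z
    using holomorphic_derivI[OF assms that] by (simp add: has_field_derivative_def)
  have "frechet_derivative k (at z) = (*) (deriv k z)" if "z \<in> N" for z
    using frechet_derivative_at[OF k[OF that]] by simp
  then have d: "dx k z = deriv k z" "dy k z = deriv k z * \<i>" if "z \<in> N" for z
    using that by (simp_all add: dir_deriv_def)
  have c: "continuous_on N (deriv k)"
    using assms by (intro holomorphic_on_imp_continuous_on holomorphic_deriv)
  have "continuous_on N (dx k) \<longleftrightarrow> continuous_on N (deriv k)"
       "continuous_on N (dy k) \<longleftrightarrow> continuous_on N (\<lambda>z. deriv k z * \<i>)"
    by (intro continuous_on_cong; simp add: d)+
  then show ?thesis
    unfolding C1_on_def using c k by (auto simp: differentiable_def intro!: continuous_intros)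
qed

lemma C1_arc_compose:
  assumes g: "C1_on S g" and \<beta>: "C1_arc c d \<beta>" and im: "\<beta> ` {c..d} \<subseteq> S"
  shows "C1_arc c d (g \<circ> \<beta>)"
proof -
  obtain \<beta>' where \<beta>': "continuous_on {c..d} \<beta>'" "\<And>t. t \<in> {c..d} \<Longrightarrow> (\<beta> has_vector_derivative \<beta>' t) (at t within {c..d})"
    using \<beta> unfolding C1_arc_def by blast
  have c\<beta>: "continuous_on {c..d} \<beta>"
    using \<beta>'(2) by (intro continuous_on_vector_derivative)
  show ?thesis unfolding C1_arc_def
  proof (intro exI conjI ballI)
    show "continuous_on {c..d} (\<lambda>t. Re (\<beta>' t) *\<^sub>R dx g (\<beta> t) + Im (\<beta>' t) *\<^sub>R dy g (\<beta> t))"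
      using g im unfolding C1_on_def
      by (intro continuous_intros \<beta>' continuous_on_compose2[OF _ c\<beta>, of S "dx g"] continuous_on_compose2[OF _ c\<beta>, of S "dy g"]) auto
    fix t assume t: "t \<in> {c..d}"
    then have "g differentiable (at (\<beta> t))" using g im by (auto simp: C1_on_def image_subset_iff)
    from differentiable_dx_dy[OF this]
    have "(g has_derivative (\<lambda>v. Re v *\<^sub>R dx g (\<beta> t) + Im v *\<^sub>R dy g (\<beta> t))) (at (\<beta> t) within \<beta> ` {c..d})"
      by (rule has_derivative_at_withinI)
    then show "(g \<circ> \<beta> has_vector_derivative Re (\<beta>' t) *\<^sub>R dx g (\<beta> t) + Im (\<beta>' t) *\<^sub>R dy g (\<beta> t)) (at t within {c..d})"
      using vector_derivative_diff_chain_within[OF \<beta>'(2)[OF t]] by fastforce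
  qed
qed

lemma C1_arc_subinterval:
  assumes "C1_arc a b g" "a \<le> c" "d \<le> b"
  shows "C1_arc c d g"
  using assms unfolding C1_arc_def
  by (meson atLeastatMost_subset_iff continuous_on_subset has_vector_derivative_within_subset subsetD)

lemma C1_arc_cong:
  assumes "C1_arc a b g" "\<And>t. t \<in> {a..b} \<Longrightarrow> f t = g t"
  shows "C1_arc a b f"
  using assms unfolding C1_arc_def
  by (metis has_vector_derivative_transform)

text \<open>
  The derivative at each parameter is determined by the arc, so the local derivatives agree with one
  global function, and continuity is a local property.
\<close>

lemma C1_arc_local:
  fixes g :: "real \<Rightarrow> 'b::real_normed_vector"
  assumes "a < b"
    and loc: "\<And>t. t \<in> {a..b} \<Longrightarrow> \<exists>e>0. C1_arc (max a (t - e)) (min b (t + e)) g"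
  shows "C1_arc a b g"
proof -
  define g' where "g' t = vector_derivative g (at t within {a..b})" for t
  have *: "(g has_vector_derivative g' t) (at t within {a..b}) \<and> continuous (at t within {a..b}) g'" if t: "t \<in> {a..b}" for t
  proof -
    obtain e where e: "0 < e" "C1_arc (max a (t - e)) (min b (t + e)) g" using loc[OF t] by blast
    let ?I = "{max a (t - e)..min b (t + e)}"
    obtain k where k: "continuous_on ?I k" "\<And>s. s \<in> ?I \<Longrightarrow> (g has_vector_derivative k s) (at s within ?I)"
      using e(2) unfolding C1_arc_def by blast
    have within: "at s within {a..b} = at s within ?I" if "\<bar>s - t\<bar> < e" for s
    proof (rule at_within_nhd[of s "{t - e<..<t + e}"])
      show "s \<in> {t - e<..<t + e}" using that by auto
      show "{a..b} \<inter> {t - e<..<t + e} - {s} = ?I \<inter> {t - e<..<t + e} - {s}" by auto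
    qed auto
    have der: "(g has_vector_derivative k s) (at s within {a..b})" if "s \<in> {a..b}" "\<bar>s - t\<bar> < e" for s
    proof -
      have "s \<in> ?I" using that by (auto simp: abs_less_iff)
      then show ?thesis using k(2) unfolding within[OF that(2)] by blast
    qed
    have eq: "g' s = k s" if "s \<in> {a..b}" "\<bar>s - t\<bar> < e" for s
      unfolding g'_def using vector_derivative_within_cbox[OF \<open>a < b\<close>, of s g "k s"] der that by simp
    have "continuous (at t within ?I) k"
      using k(1) t e by (auto simp: continuous_on_eq_continuous_within)
    then have "continuous (at t within {a..b}) k"
      using within[of t] e by simp
    moreover have "\<forall>\<^sub>F s in at t within {a..b}. g' s = k s"
      using e eq by (auto simp: eventually_at dist_real_def)
    ultimately have "continuous (at t within {a..b}) g'"
      using eq[of t] t e unfolding continuous_within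
      by (metis (mono_tags, lifting) abs_zero diff_self filterlim_cong)
    then show ?thesis using der[of t] eq[of t] t e by simp
  qed
  then show ?thesis
    unfolding C1_arc_def by (intro exI[of _ g']) (auto simp: continuous_on_eq_continuous_within)
qed

lemma C1_on_bounded_linear_compose:
  assumes k: "C1_on N k" and N: "open N" and T: "bounded_linear T" and g: "\<And>w. w \<in> N \<Longrightarrow> g w = T (k w)"
  shows "C1_on N g"
proof -
  have kd: "(k has_derivative (\<lambda>v. Re v *\<^sub>R dx k z + Im v *\<^sub>R dy k z)) (at z)" if "z \<in> N" for z
    using k that by (intro differentiable_dx_dy) (auto simp: C1_on_def)
  have gd: "(g has_derivative (\<lambda>v. T (Re v *\<^sub>R dx k z + Im v *\<^sub>R dy k z))) (at z)" if "z \<in> N" for z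
    by (rule has_derivative_transform_within_open[OF bounded_linear.has_derivative[OF T kd[OF that]] N that])
      (use g in auto)
  then have d: "dx g z = T (dx k z)" "dy g z = T (dy k z)" if "z \<in> N" for z
    using frechet_derivative_at[OF gd[OF that], symmetric] by (auto simp: dir_deriv_def[of _ g])
  have "continuous_on N (dx g) \<longleftrightarrow> continuous_on N (\<lambda>z. T (dx k z))"
       "continuous_on N (dy g) \<longleftrightarrow> continuous_on N (\<lambda>z. T (dy k z))"
    by (intro continuous_on_cong; simp add: d)+
  then show ?thesis
    using k gd by (auto simp: C1_on_def differentiable_def intro!: bounded_linear.continuous_on[OF T])
qed

lemma locally_conformal_C1_on:
  assumes "locally_conformal g z"
  obtains N where "open N" "z \<in> N" "C1_on N g"
proof -
  obtain N k where N: "open N" "z \<in> N" "k holomorphic_on N"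
     and g: "(\<forall>w\<in>N. g w = k w) \<or> (\<forall>w\<in>N. g w = cnj (k w))"
    using assms unfolding locally_conformal_def by blast
  note C1 = C1_on_bounded_linear_compose[OF C1_on_holomorphic[OF N(3,1)] N(1)]
  from g have "C1_on N g"
    using C1[OF bounded_linear_ident] C1[OF bounded_linear_cnj] by blast
  then show thesis by (rule that[OF N(1,2)])
qed

text \<open>
  If \<open>g\<close> is the conjugate of a holomorphic map, the conjugations are absorbed into the holomorphic
  function \<open>cnj \<circ> H \<circ> cnj\<close>, whose real part is \<open>Re \<circ> H \<circ> cnj\<close>.
\<close>

lemma locally_Re_compose:
  assumes u: "locally_Re u (g z)" and g: "locally_conformal g z"
  shows "locally_Re (u \<circ> g) z"
proof -
  obtain e H where e: "0 < e" and H: "H holomorphic_on ball (g z) e" "\<And>w. w \<in> ball (g z) e \<Longrightarrow> u w = Re (H w)"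
    using u unfolding locally_Re_def by blast
  obtain N k where N: "open N" "z \<in> N" "k holomorphic_on N"
     and gk: "(\<forall>w\<in>N. g w = k w) \<or> (\<forall>w\<in>N. g w = cnj (k w))"
    using g unfolding locally_conformal_def by blast
  have ck: "continuous_on N k" using N by (intro holomorphic_on_imp_continuous_on)
  define V where "V = N \<inter> k -` ball (k z) e"
  have V: "open V" "z \<in> V" using N ck e by (auto simp: V_def intro!: continuous_open_preimage)
  obtain d where d: "0 < d" "ball z d \<subseteq> V" using V by (auto simp: open_contains_ball)
  have kV: "k holomorphic_on ball z d" "k ` ball z d \<subseteq> ball (k z) e"
    using d N by (auto simp: V_def intro!: holomorphic_on_subset[OF N(3)])
  from gk show ?thesis
  proof
    assume gk: "\<forall>w\<in>N. g w = k w"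
    have "(H \<circ> k) holomorphic_on ball z d"
      using H(1) kV gk N by (intro holomorphic_on_compose_gen[of _ _ _ "ball (k z) e"]) auto
    moreover have "(u \<circ> g) w = Re ((H \<circ> k) w)" if "w \<in> ball z d" for w
    proof -
      have "w \<in> N" "k w \<in> ball (k z) e" using that d(2) by (auto simp: V_def)
      then show ?thesis using gk N(2) H(2)[of "k w"] by simp
    qed
    ultimately show ?thesis unfolding locally_Re_def using d by blast
  next
    assume gk: "\<forall>w\<in>N. g w = cnj (k w)"
    define H' where "H' = cnj \<circ> H \<circ> cnj"
    have img: "cnj ` ball (k z) e = ball (g z) e"
    proof -
      have "dist (cnj x) (cnj y) = dist x y" for x y
        by (metis complex_cnj_diff complex_mod_cnj dist_norm)
      from this[of "cnj (k z)"] have "dist (k z) (cnj x) = dist (g z) x" for x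
        using gk N(2) by simp
      then show ?thesis
        unfolding image_cnj_conv_vimage_cnj by auto
    qed
    have "H' holomorphic_on ball (k z) e"
      unfolding H'_def using H(1) by (intro holomorphic_on_compose_cnj_cnj) (simp_all add: img)
    then have "(H' \<circ> k) holomorphic_on ball z d"
      using kV by (intro holomorphic_on_compose_gen[of _ _ _ "ball (k z) e"])
    moreover have "(u \<circ> g) w = Re ((H' \<circ> k) w)" if "w \<in> ball z d" for w
    proof -
      have "w \<in> N" "k w \<in> ball (k z) e" using that d(2) by (auto simp: V_def)
      then have "g w \<in> ball (g z) e" using img gk by auto
      then show ?thesis using gk \<open>w \<in> N\<close> by (simp add: H'_def H(2))
    qed
    ultimately show ?thesis unfolding locally_Re_def using d by blast
  qed
qed

lemma locally_conformal_inverse: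
  assumes g: "locally_conformal g z"
  obtains N k where "open N" "z \<in> N" "open (g ` N)" "\<And>w. w \<in> N \<Longrightarrow> k (g w) = w"
    "\<And>y. y \<in> g ` N \<Longrightarrow> locally_conformal k y"
proof -
  obtain M h where M: "open M" "z \<in> M" "h holomorphic_on M" "\<forall>w\<in>M. deriv h w \<noteq> 0"
     and gh: "(\<forall>w\<in>M. g w = h w) \<or> (\<forall>w\<in>M. g w = cnj (h w))"
    using g unfolding locally_conformal_def by blast
  obtain r where r: "0 < r" "ball z r \<subseteq> M" "inj_on h (ball z r)"
    using has_complex_derivative_locally_injective[OF M(3,2,1)] M(2,4) by blast
  let ?N = "ball z r"
  have hN: "h holomorphic_on ?N" using M(3) r(2) by (rule holomorphic_on_subset)
  obtain l where l: "l holomorphic_on (h ` ?N)" "\<And>w. w \<in> ?N \<Longrightarrow> deriv h w * deriv l (h w) = 1" "\<And>w. w \<in> ?N \<Longrightarrow> l (h w) = w"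
    using holomorphic_has_inverse[OF hN open_ball r(3)] by blast
  have o: "open (h ` ?N)" by (rule open_mapping_thm3[OF hN open_ball r(3)])
  have dl: "\<forall>y\<in>h ` ?N. deriv l y \<noteq> 0" using l(2) by (metis imageE mult_zero_right zero_neq_one)
  from gh show thesis
  proof
    assume gh: "\<forall>w\<in>M. g w = h w"
    then have im: "g ` ?N = h ` ?N" using r(2) by (auto intro!: image_cong)
    show thesis
    proof (rule that[of ?N l])
      show "locally_conformal l y" if "y \<in> g ` ?N" for y
        unfolding locally_conformal_def using that o l(1) dl im by blast
      show "l (g w) = w" if "w \<in> ?N" for w using that l(3) gh r(2) by auto
    qed (use r o im in auto)
  next
    assume gh: "\<forall>w\<in>M. g w = cnj (h w)"
    then have im: "g ` ?N = cnj ` (h ` ?N)" using r(2) by (auto simp: image_image intro!: image_cong)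
    have imv: "g ` ?N = cnj -` (h ` ?N)"
      unfolding im by (rule image_cnj_conv_vimage_cnj)
    have og: "open (g ` ?N)"
      unfolding imv by (intro open_vimage o continuous_intros)
    define l' where "l' = cnj \<circ> l \<circ> cnj"
    have holl': "l' holomorphic_on g ` ?N"
      unfolding l'_def using og l(1) by (intro holomorphic_on_compose_cnj_cnj) (simp_all add: im image_image)
    show thesis
    proof (rule that[of ?N "l \<circ> cnj"])
      show "locally_conformal (l \<circ> cnj) y" if y: "y \<in> g ` ?N" for y
        unfolding locally_conformal_def
      proof (intro exI conjI)
        show "\<forall>w\<in>g ` ?N. deriv l' w \<noteq> 0"
        proof
          fix w assume "w \<in> g ` ?N"
          then have w: "cnj w \<in> h ` ?N" unfolding imv by simp
          then have "l field_differentiable (at (cnj w))"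
            using l(1) o holomorphic_on_imp_differentiable_at by blast
          then have "deriv l' w = cnj (deriv l (cnj w))"
            unfolding l'_def
            by (intro DERIV_imp_deriv has_field_derivative_cnj_cnj field_differentiable_derivI)
          then show "deriv l' w \<noteq> 0" using dl w by auto
        qed
        show "(\<forall>w\<in>g ` ?N. (l \<circ> cnj) w = l' w) \<or> (\<forall>w\<in>g ` ?N. (l \<circ> cnj) w = cnj (l' w))"
          by (simp add: l'_def)
      qed (use holl' og y in auto)
      show "(l \<circ> cnj) (g w) = w" if "w \<in> ?N" for w using that l(3) gh r(2) by auto
    qed (use r og in auto)
  qed
qed

section \<open>Lifting through coverings of topological spaces\<close>

lemma covering_space_sheets:
  assumes "covering_space C p S" "y \<in> S"
  obtains T where "y \<in> T" "openin (top_of_set S) T"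
    "\<And>x. x \<in> C \<Longrightarrow> p x \<in> T \<Longrightarrow> \<exists>u q. x \<in> u \<and> openin (top_of_set C) u \<and> homeomorphism u T p q"
proof -
  obtain T V where T: "y \<in> T" "openin (top_of_set S) T" and V: "\<Union>V = C \<inter> p -` T"
    "\<forall>u\<in>V. openin (top_of_set C) u" "\<forall>u\<in>V. \<exists>q. homeomorphism u T p q"
    using assms unfolding covering_space_def by meson
  show thesis
  proof (rule that[OF T])
    fix x assume "x \<in> C" "p x \<in> T"
    then obtain u where "u \<in> V" "x \<in> u" using V(1) by blast
    then show "\<exists>u q. x \<in> u \<and> openin (top_of_set C) u \<and> homeomorphism u T p q"
      using V by blast
  qed
qed

text \<open>
  Whether a lift exists over \<open>{0..s}\<close> is locally constant in \<open>s\<close>: near a parameter \<open>s0\<close> the path runs in an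
  evenly covered set, over which any lift continues in the sheet it has reached.
\<close>

lemma covering_space_path_lift:
  fixes p :: "'a::real_normed_vector \<Rightarrow> 'b::topological_space" and g :: "real \<Rightarrow> 'b"
  assumes cov: "covering_space C p S" and a: "a \<in> C"
    and g: "continuous_on {0..1} g" "g ` {0..1} \<subseteq> S" "g 0 = p a"
  obtains k where "continuous_on {0..1} k" "k ` {0..1} \<subseteq> C" "k 0 = a" "\<And>t. t \<in> {0..1} \<Longrightarrow> p (k t) = g t"
proof -
  define P where "P s \<longleftrightarrow> (\<exists>k. continuous_on {0..s} k \<and> k ` {0..s} \<subseteq> C \<and> k 0 = a \<and> (\<forall>t\<in>{0..s}. p (k t) = g t))" for s :: real
  have "P 1"
  proof (rule connected_induction_simple[of "{0..1::real}" 0 1 P])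
    show "P 0"
      unfolding P_def using a g(3) by (intro exI[of _ "\<lambda>_. a"]) auto
    fix s0 :: real assume s0: "s0 \<in> {0..1}"
    obtain T where T: "g s0 \<in> T" "openin (top_of_set S) T"
      "\<And>x. x \<in> C \<Longrightarrow> p x \<in> T \<Longrightarrow> \<exists>u q. x \<in> u \<and> openin (top_of_set C) u \<and> homeomorphism u T p q"
      using covering_space_sheets[OF cov, of "g s0"] g(2) s0 by blast
    have "openin (top_of_set {0..1}) ({0..1} \<inter> g -` T)"
      by (rule continuous_openin_preimage[OF g(1) _ T(2)]) (use g(2) in auto)
    then obtain e where e: "0 < e" "{0..1} \<inter> ball s0 e \<subseteq> {0..1} \<inter> g -` T"
      using s0 T(1) unfolding openin_contains_ball by blast
    show "\<exists>V. openin (top_of_set {0..1}) V \<and> s0 \<in> V \<and> (\<forall>x\<in>V. \<forall>y\<in>V. P x \<longrightarrow> P y)"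
    proof (intro exI[of _ "{0..1} \<inter> ball s0 e"] conjI ballI impI)
      show "openin (top_of_set {0..1}) ({0..1} \<inter> ball s0 e)" by (simp add: openin_open_Int)
      show "s0 \<in> {0..1} \<inter> ball s0 e" using s0 e by simp
      fix x y assume x: "x \<in> {0..1} \<inter> ball s0 e" and y: "y \<in> {0..1} \<inter> ball s0 e" and "P x"
      then obtain k where k: "continuous_on {0..x} k" "k ` {0..x} \<subseteq> C" "k 0 = a" "\<forall>t\<in>{0..x}. p (k t) = g t"
        unfolding P_def by blast
      show "P y"
      proof (cases "y \<le> x")
        case True
        then show ?thesis unfolding P_def
          using k by (intro exI[of _ k]) (auto intro: continuous_on_subset)
      next
        case False
        have kx: "k x \<in> C" "p (k x) = g x" "g x \<in> T" using k x e(2) by auto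
        then obtain u q where u: "k x \<in> u" "openin (top_of_set C) u" "homeomorphism u T p q"
          using T(3)[of "k x"] by metis
        have uC: "u \<subseteq> C" using u(2) by (rule openin_imp_subset)
        have gT: "g ` {x..y} \<subseteq> T"
        proof -
          have "{x..y} \<subseteq> {0..1} \<inter> ball s0 e"
            using x y by (auto simp: dist_real_def abs_less_iff)
          then show ?thesis using e(2) by blast
        qed
        have xy: "{0..y} = {0..x} \<union> {x..y}" using x False by auto
        define k' where "k' t = (if t \<le> x then k t else q (g t))" for t
        have qkx: "q (g x) = k x" using u kx by (metis homeomorphism_apply1)
        show ?thesis unfolding P_def
        proof (intro exI[of _ k'] conjI ballI)
          have "continuous_on {x..y} (\<lambda>t. q (g t))"
            using x y gT by (intro continuous_on_compose2[OF homeomorphism_cont2[OF u(3)]] continuous_on_subset[OF g(1)]) auto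
          then show "continuous_on {0..y} k'"
            unfolding k'_def xy
            by (intro continuous_on_If) (use k qkx in \<open>auto simp: order_antisym\<close>)
          have "q ` T \<subseteq> u" using u(3) by (simp add: homeomorphism_def)
          then show "k' ` {0..y} \<subseteq> C"
            using k(2) gT uC by (force simp: k'_def)
          show "k' 0 = a" using x k by (simp add: k'_def)
          show "p (k' t) = g t" if "t \<in> {0..y}" for t
          proof (cases "t \<le> x")
            case True
            then show ?thesis using that k(4) by (simp add: k'_def)
          next
            case F: False
            then have "g t \<in> T" using that gT by auto
            then show ?thesis using F homeomorphism_apply2[OF u(3)] by (simp add: k'_def)
          qed
        qed
      qed
    qed
  qed auto
  then show thesis using that unfolding P_def by blast
qed

text \<open>
  The lift \<open>\<sigma> w\<close> is the end point of the lifted path along the segment from \<open>z0\<close> to \<open>w\<close>.  Only its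
  continuity needs an argument.  Along a fixed segment, continuity of \<open>\<sigma>\<close> near a point is locally constant:
  inside a ball \<open>B\<close> with evenly covered image, uniqueness of lifts on the part of a ray inside \<open>B\<close>
  transports the equation \<open>\<sigma> = q \<circ> f\<close>, with \<open>q\<close> the inverse of \<open>p\<close> on a sheet, from a
  neighbourhood of one point to a neighbourhood of another one on the same segment.
\<close>

lemma covering_space_lift_convex:
  fixes p :: "'a::real_normed_vector \<Rightarrow> 'b::topological_space" and f :: "'c::real_normed_vector \<Rightarrow> 'b"
  assumes cov: "covering_space C p S" and a: "a \<in> C"
    and U: "convex U" "open U" "z0 \<in> U"
    and f: "continuous_on U f" "f ` U \<subseteq> S" "f z0 = p a"
  obtains g where "continuous_on U g" "g ` U \<subseteq> C" "g z0 = a" "\<And>w. w \<in> U \<Longrightarrow> p (g w) = f w"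
proof -
  define c where "c w s = z0 + s *\<^sub>R (w - z0)" for w :: 'c and s :: real
  have cU: "c w s \<in> U" if "w \<in> U" "s \<in> {0..1}" for w s
  proof -
    have "c w s = (1 - s) *\<^sub>R z0 + s *\<^sub>R w" by (simp add: c_def algebra_simps)
    then show ?thesis using that U by (simp add: convex_alt)
  qed
  have c01[simp]: "c w 0 = z0" "c w 1 = w" for w by (simp_all add: c_def)
  have cc: "c (c w s) t = c w (t * s)" for w s t by (simp add: c_def)
  have contc: "continuous_on X (c w)" for X w unfolding c_def by (intro continuous_intros)
  have fc: "continuous_on {0..1} (\<lambda>s. f (c w s))" if "w \<in> U" for w
    using cU[OF that] by (intro continuous_on_compose2[OF f(1) contc]) auto
  have "\<exists>k. continuous_on {0..1} k \<and> k ` {0..1} \<subseteq> C \<and> k 0 = a \<and> (\<forall>t\<in>{0..1}. p (k t) = f (c w t))" if w: "w \<in> U" for w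
  proof -
    have "(\<lambda>s. f (c w s)) ` {0..1} \<subseteq> S" using cU[OF w] f(2) by blast
    then show ?thesis
      using covering_space_path_lift[OF cov a fc[OF w]] f(3) by (metis c01(1))
  qed
  then obtain k where k: "\<And>w. w \<in> U \<Longrightarrow> continuous_on {0..1} (k w)" "\<And>w. w \<in> U \<Longrightarrow> k w ` {0..1} \<subseteq> C"
    "\<And>w. w \<in> U \<Longrightarrow> k w 0 = a" "\<And>w t. w \<in> U \<Longrightarrow> t \<in> {0..1} \<Longrightarrow> p (k w t) = f (c w t)"
    by metis
  define \<sigma> where "\<sigma> w = k w 1" for w
  have radial: "\<sigma> (c w s) = k w s" if w: "w \<in> U" and s: "s \<in> {0..1}" for w s
  proof -
    have "k (c w s) 1 = k w (1 * s)"
    proof (rule covering_space_lift_unique[OF cov, of "k (c w s)" 0 "\<lambda>t. k w (t * s)" "{0..1}" "\<lambda>t. f (c (c w s) t)" 1])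
      have ts: "t * s \<in> {0..1}" if "t \<in> {0..1}" for t using that s by (auto intro: mult_le_one)
      show "k (c w s) 0 = k w (0 * s)" using k(3) cU w s by simp
      show "continuous_on {0..1} (\<lambda>t. f (c (c w s) t))" using fc cU w s by blast
      show "(\<lambda>t. f (c (c w s) t)) \<in> {0..1} \<rightarrow> S" using f(2) cU w s by blast
      show "continuous_on {0..1} (k (c w s))" "k (c w s) \<in> {0..1} \<rightarrow> C" using k cU w s by blast+
      show "f (c (c w s) x) = p (k (c w s) x)" if "x \<in> {0..1}" for x using k(4) cU w s that by simp
      show "continuous_on {0..1} (\<lambda>t. k w (t * s))"
        using ts by (intro continuous_on_compose2[OF k(1)[OF w]] continuous_intros) auto
      show "(\<lambda>t. k w (t * s)) \<in> {0..1} \<rightarrow> C" using k(2)[OF w] ts by blast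
      show "f (c (c w s) x) = p (k w (x * s))" if "x \<in> {0..1}" for x
        using k(4)[OF w ts[of x]] that by (simp add: cc)
    qed auto
    then show ?thesis by (simp add: \<sigma>_def)
  qed
  have \<sigma>C: "\<sigma> w \<in> C" if "w \<in> U" for w using k(2)[OF that] by (auto simp: \<sigma>_def)
  have p\<sigma>: "p (\<sigma> w) = f w" if "w \<in> U" for w using k(4)[OF that, of 1] by (simp add: \<sigma>_def)
  have \<sigma>0: "\<sigma> z0 = a" using radial[OF U(3), of 0] k(3)[OF U(3)] by simp
  have ray: "\<sigma> (c v t2) = q (f (c v t2))"
    if B: "convex B" "B \<subseteq> U" "f ` B \<subseteq> T" and u: "openin (top_of_set C) u" "homeomorphism u T p q"
      and v: "v \<in> U" "t1 \<in> {0..1}" "t2 \<in> {0..1}" "c v t1 \<in> B" "c v t2 \<in> B" "\<sigma> (c v t1) = q (f (c v t1))"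
    for B T u q v t1 t2
  proof -
    let ?J = "{t\<in>{0..1}. c v t \<in> B}"
    have uC: "u \<subseteq> C" using u(1) by (rule openin_imp_subset)
    have qT: "q y \<in> u" if "y \<in> T" for y using u(2) that by (auto simp: homeomorphism_def)
    have J: "convex ?J"
    proof -
      have "?J = {0..1} \<inter> c v -` B" by auto
      moreover have "convex (c v -` B)"
      proof -
        have "c v ((1 - l) * x + l * y) = (1 - l) *\<^sub>R c v x + l *\<^sub>R c v y" for l x y
          by (simp add: c_def algebra_simps)
        then show ?thesis using B(1) by (simp add: convex_alt)
      qed
      ultimately show ?thesis by (simp add: convex_Int)
    qed
    have "\<sigma> (c v t2) = (q \<circ> f \<circ> c v) t2"
    proof (rule covering_space_lift_unique[OF cov, of "\<lambda>t. \<sigma> (c v t)" t1 "q \<circ> f \<circ> c v" ?J "\<lambda>t. f (c v t)"])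
      show "\<sigma> (c v t1) = (q \<circ> f \<circ> c v) t1" using v by simp
      show "continuous_on ?J (\<lambda>t. f (c v t))" by (rule continuous_on_subset[OF fc[OF v(1)]]) auto
      show "(\<lambda>t. f (c v t)) \<in> ?J \<rightarrow> S" using B f(2) by auto
      have "continuous_on ?J (\<lambda>t. \<sigma> (c v t)) \<longleftrightarrow> continuous_on ?J (k v)"
        by (intro continuous_on_cong) (auto simp: radial v(1))
      then show "continuous_on ?J (\<lambda>t. \<sigma> (c v t))"
        using k(1)[OF v(1)] by (auto intro: continuous_on_subset)
      show "(\<lambda>t. \<sigma> (c v t)) \<in> ?J \<rightarrow> C" using \<sigma>C B by auto
      show "f (c v x) = p (\<sigma> (c v x))" if "x \<in> ?J" for x using p\<sigma> B that by auto
      have "continuous_on ?J (\<lambda>t. q (f (c v t)))"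
        using B by (intro continuous_on_compose2[OF homeomorphism_cont2[OF u(2)]] continuous_on_subset[OF fc[OF v(1)]]) auto
      then show "continuous_on ?J (q \<circ> f \<circ> c v)" by (simp add: o_def)
      show "q \<circ> f \<circ> c v \<in> ?J \<rightarrow> C"
        using qT uC B(3) by (auto simp: image_subset_iff intro!: subsetD[OF uC])
      show "f (c v x) = p ((q \<circ> f \<circ> c v) x)" if "x \<in> ?J" for x
        using that B homeomorphism_apply2[OF u(2)] by auto
      show "connected ?J" by (rule convex_connected[OF J])
    qed (use v in auto)
    then show ?thesis by simp
  qed
  have "continuous_on U \<sigma>"
  proof -
    have "isCont \<sigma> w" if w: "w \<in> U" for w
    proof -
      define P where "P s \<longleftrightarrow> (\<exists>N. open N \<and> c w s \<in> N \<and> continuous_on N \<sigma>)" for s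
      have step: "\<exists>V. openin (top_of_set {0..1}) V \<and> s0 \<in> V \<and> (\<forall>x\<in>V. \<forall>y\<in>V. (y = 0 \<or> P x) \<longrightarrow> P y)"
        if s0: "s0 \<in> {0..1}" for s0
      proof -
        have c0: "c w s0 \<in> U" by (rule cU[OF w s0])
        obtain T where T: "f (c w s0) \<in> T" "openin (top_of_set S) T"
          "\<And>x. x \<in> C \<Longrightarrow> p x \<in> T \<Longrightarrow> \<exists>u q. x \<in> u \<and> openin (top_of_set C) u \<and> homeomorphism u T p q"
          using covering_space_sheets[OF cov, of "f (c w s0)"] f(2) c0 by blast
        obtain u q where u: "\<sigma> (c w s0) \<in> u" "openin (top_of_set C) u" "homeomorphism u T p q"
          using T(3)[OF \<sigma>C[OF c0]] p\<sigma>[OF c0] T(1) by metis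
        have "openin (top_of_set U) (U \<inter> f -` T)"
          by (rule continuous_openin_preimage[OF f(1) _ T(2)]) (use f(2) in auto)
        then have "open (U \<inter> f -` T)" using U(2) openin_open_trans by blast
        then have "\<exists>r>0. ball (c w s0) r \<subseteq> U \<inter> f -` T"
          using c0 T(1) unfolding open_contains_ball by blast
        then obtain r where r: "0 < r" "ball (c w s0) r \<subseteq> U \<inter> f -` T" by blast
        define B where "B = ball (c w s0) r"
        have B: "convex B" "open B" "B \<subseteq> U" "f ` B \<subseteq> T" "c w s0 \<in> B"
          using r by (auto simp: B_def)
        note ray = ray[OF B(1,3,4) u(2,3)]
        have base: "\<sigma> (c w s0) = q (f (c w s0))"
          using u p\<sigma>[OF c0] by (metis homeomorphism_apply1)
        have contqf: "continuous_on X \<sigma>" if "X \<subseteq> B" "\<And>x. x \<in> X \<Longrightarrow> \<sigma> x = q (f x)" for X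
        proof -
          have "continuous_on X \<sigma> \<longleftrightarrow> continuous_on X (\<lambda>x. q (f x))"
            by (intro continuous_on_cong refl that(2))
          moreover have "continuous_on X (\<lambda>x. q (f x))"
            using that(1) B by (intro continuous_on_compose2[OF homeomorphism_cont2[OF u(3)]] continuous_on_subset[OF f(1)]) auto
          ultimately show ?thesis by simp
        qed
        show ?thesis
        proof (intro exI[of _ "{0..1} \<inter> c w -` B"] conjI ballI impI)
          show "openin (top_of_set {0..1}) ({0..1} \<inter> c w -` B)"
            by (intro continuous_openin_preimage_gen contc B(2))
          show "s0 \<in> {0..1} \<inter> c w -` B" using s0 B by simp
          fix s s' assume s: "s \<in> {0..1} \<inter> c w -` B" and s': "s' \<in> {0..1} \<inter> c w -` B" and Ps: "s' = 0 \<or> P s"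
          have on: "\<sigma> (c w x) = q (f (c w x))" if "x \<in> {0..1} \<inter> c w -` B" for x
            using ray[OF w s0 _ B(5) _ base] that by simp
          show "P s'"
          proof (cases "s' = 0")
            case True
            have "\<sigma> y = q (f y)" if "y \<in> B" for y
              using ray[of y 0 1] that B on[OF s'] s' True by auto
            then have "continuous_on B \<sigma>" by (intro contqf) auto
            then show ?thesis unfolding P_def using B s' by auto
          next
            case False
            with Ps obtain N where N: "open N" "c w s \<in> N" "continuous_on N \<sigma>" unfolding P_def by blast
            define N1 where "N1 = (N \<inter> B) \<inter> \<sigma> -` u"
            have "openin (top_of_set (N \<inter> B)) N1"
              unfolding N1_def
              by (rule continuous_openin_preimage[OF _ _ u(2)])
                 (use N B \<sigma>C in \<open>auto intro: continuous_on_subset\<close>)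
            then have N1: "open N1" using N(1) B(2) openin_open_trans by blast
            have csN1: "c w s \<in> N1"
              using N(2) s on[OF s] B(4) homeomorphism_image2[OF u(3)] by (auto simp: N1_def)
            have N1q: "\<sigma> x = q (f x)" if "x \<in> N1" for x
              using that p\<sigma>[of x] B(3) homeomorphism_apply1[OF u(3), of "\<sigma> x"] by (auto simp: N1_def)
            \<comment> \<open>The points whose central projection, with the ratio of the two parameters, lands in \<open>N1\<close>.\<close>
            define N2 where "N2 = B \<inter> (\<lambda>y. c y (s / s')) -` N1"
            have N2: "open N2"
              unfolding N2_def c_def by (intro open_Int B(2) open_vimage N1 continuous_intros)
            have "c (c w s') (s / s') = c w s" using False by (simp add: cc)
            then have in2: "c w s' \<in> N2" using s' csN1 by (simp add: N2_def)
            have "\<sigma> y = q (f y)" if y: "y \<in> N2" for y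
            proof -
              have yB: "y \<in> B" "c y (s / s') \<in> N1" using y by (auto simp: N2_def)
              then have xB: "c y (s / s') \<in> B" by (auto simp: N1_def)
              show ?thesis
              proof (cases "s \<le> s'")
                case True
                then have "s / s' \<in> {0..1}" using s s' False by auto
                then show ?thesis
                  using ray[of y "s / s'" 1] yB xB N1q[OF yB(2)] B(3) by auto
              next
                case F2: False
                then have t: "s' / s \<in> {0..1}" "s \<noteq> 0" using s s' by auto
                have yy: "c (c y (s / s')) (s' / s) = y" using t False by (simp add: cc)
                show ?thesis
                  using ray[of "c y (s / s')" 1 "s' / s"] t yB xB N1q[OF yB(2)] B(3) unfolding yy by auto
              qed
            qed
            then have "continuous_on N2 \<sigma>" by (intro contqf) (auto simp: N2_def)
            then show ?thesis unfolding P_def using N2 in2 by blast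
          qed
        qed
      qed
      have "P 0" using step[of 0] by auto
      then have "P 1"
        using connected_induction_simple[of "{0..1::real}" 0 1 P] step by fastforce
      then show ?thesis unfolding P_def
        by (metis c01(2) continuous_on_eq_continuous_at)
    qed
    then show ?thesis by (simp add: continuous_at_imp_continuous_on)
  qed
  then show thesis using that[of \<sigma>] \<sigma>C \<sigma>0 p\<sigma> by blast
qed

lemma injective_covering_homeomorphism:
  fixes p :: "'a::real_normed_vector \<Rightarrow> 'b::topological_space"
  assumes cov: "covering_space C p S" and inj: "inj_on p C"
  obtains k where "homeomorphism C S p k"
proof (rule homeomorphism_injective_open_map[OF _ _ inj])
  show "continuous_on C p" "p ` C = S"
    using cov by (auto simp: covering_space_def)
  fix W assume W: "openin (top_of_set C) W"
  show "openin (top_of_set S) (p ` W)"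
  proof (subst openin_subopen, intro ballI)
    fix y assume "y \<in> p ` W"
    then obtain x where x: "x \<in> W" "y = p x" by blast
    then have xC: "x \<in> C" using openin_imp_subset[OF W] by blast
    obtain T u q where T: "x \<in> T" "openin (top_of_set C) T" "p x \<in> u" "openin (top_of_set S) u" "homeomorphism T u p q"
      using covering_space_local_homeomorphism[OF cov xC] by blast
    have "openin (top_of_set T) (T \<inter> W)"
      using W T(2) by (metis openin_Int openin_subset_trans inf_le1 openin_imp_subset)
    then have "openin (top_of_set u) (p ` (T \<inter> W))"
      using T(5) homeomorphism_imp_open_map by blast
    then have "openin (top_of_set S) (p ` (T \<inter> W))"
      using T(4) openin_trans by blast
    then show "\<exists>V. openin (top_of_set S) V \<and> y \<in> V \<and> V \<subseteq> p ` W"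
      using x T(1) by (intro exI[of _ "p ` (T \<inter> W)"]) auto
  qed
qed (use that in auto)

section \<open>Surfaces covered by the disc\<close>

lemma locally_Re_inner: "locally_Re (\<lambda>w. w \<bullet> b) z"
  unfolding locally_Re_def
proof (intro exI conjI ballI)
  show "(\<lambda>w. cnj b * w) holomorphic_on ball z 1" by (intro holomorphic_intros)
  show "w \<bullet> b = Re (cnj b * w)" for w by (simp add: inner_complex_def)
qed simp

lemma conformal_linear_of_orthogonal:
  fixes L :: "complex \<Rightarrow> 'b::real_inner"
  assumes lin: "linear L" and "norm (L 1) = norm (L \<i>)" "L 1 \<bullet> L \<i> = 0"
  shows "norm (L v) = norm (L 1) * norm v"
proof -
  have "v = Re v *\<^sub>R 1 + Im v *\<^sub>R \<i>" by (simp add: complex_eq_iff)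
  then have "L v = L (Re v *\<^sub>R 1 + Im v *\<^sub>R \<i>)" by (rule arg_cong)
  then have Lv: "L v = Re v *\<^sub>R L 1 + Im v *\<^sub>R L \<i>"
    by (simp only: linear_add[OF lin] linear_scale[OF lin])
  have i: "L 1 \<bullet> L 1 = (norm (L 1))\<^sup>2" "L \<i> \<bullet> L \<i> = (norm (L 1))\<^sup>2" "L \<i> \<bullet> L 1 = 0"
    using assms by (simp_all add: inner_commute flip: power2_norm_eq_inner)
  have "(norm (L v))\<^sup>2 = (norm (L 1))\<^sup>2 * ((Re v)\<^sup>2 + (Im v)\<^sup>2)"
    unfolding Lv power2_norm_eq_inner
    by (simp add: inner_add_left inner_add_right i assms(3)) (simp add: power2_eq_square algebra_simps)
  also have "\<dots> = (norm (L 1) * norm v)\<^sup>2"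
    by (simp add: power_mult_distrib cmod_power2)
  finally show ?thesis by (simp add: power2_eq_iff_nonneg)
qed

locale surface_covered_by_disc =
  fixes M :: "'a::{t2_space,second_countable_topology} set" and A :: "'a chart set" and h :: "complex \<Rightarrow> 'a"
  assumes surface: "conformal_surface M A" and covering: "universal_conformal_covering M A h"
begin

lemma cover: "covering_space \<D> h M" and h_cont: "continuous_on \<D> h" and h_image: "h ` \<D> = M"
  using covering by (auto simp: universal_conformal_covering_def covering_space_def)

lemma chartD:
  assumes "(U, \<phi>) \<in> A"
  shows "openin (top_of_set M) U" "open (\<phi> ` U)" "inj_on \<phi> U" "continuous_on U \<phi>"
    "continuous_on (\<phi> ` U) (inv_into U \<phi>)"
proof -
  obtain \<psi> where \<psi>: "homeomorphism U (\<phi> ` U) \<phi> \<psi>" and *: "openin (top_of_set M) U" "open (\<phi> ` U)"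
    using surface assms unfolding conformal_surface_def surface_chart_def by blast
  show "openin (top_of_set M) U" "open (\<phi> ` U)" by fact+
  show inj: "inj_on \<phi> U" using \<psi> by (metis homeomorphism_apply1 inj_on_inverseI)
  show "continuous_on U \<phi>" using \<psi> by (rule homeomorphism_cont1)
  have "inv_into U \<phi> y = \<psi> y" if "y \<in> \<phi> ` U" for y
    using that \<psi> inj by (auto simp: homeomorphism_apply1)
  then have "continuous_on (\<phi> ` U) (inv_into U \<phi>) \<longleftrightarrow> continuous_on (\<phi> ` U) \<psi>"
    by (intro continuous_on_cong) auto
  then show "continuous_on (\<phi> ` U) (inv_into U \<phi>)" using homeomorphism_cont2[OF \<psi>] by simp
qed

lemma open_chart_preimage:
  assumes "(U, \<phi>) \<in> A" shows "open (\<D> \<inter> h -` U)"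
proof -
  have "openin (top_of_set \<D>) (\<D> \<inter> h -` U)"
    by (rule continuous_openin_preimage[OF h_cont _ chartD(1)[OF assms]]) (use h_image in auto)
  then show ?thesis using openin_open_trans open_ball by blast
qed

lemma conformal_in_chart:
  assumes "(U, \<phi>) \<in> A" shows "conformal_map_on (\<D> \<inter> h -` U) (\<phi> \<circ> h)"
  using covering assms unfolding universal_conformal_covering_def conformal_from_disc_def by blast

lemma locally_conformal_chart:
  assumes "(U, \<phi>) \<in> A" "z \<in> \<D>" "h z \<in> U" shows "locally_conformal (\<phi> \<circ> h) z"
  by (rule conformal_map_on_locally_conformal[OF conformal_in_chart open_chart_preimage])
    (use assms in auto)

lemma chart_exists:
  assumes "p \<in> M" obtains U \<phi> where "(U, \<phi>) \<in> A" "p \<in> U"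
proof -
  have "p \<in> (\<Union>c\<in>A. fst c)" using surface assms by (simp add: conformal_surface_def)
  then show thesis using that by fastforce
qed

lemma h_in_M: "z \<in> \<D> \<Longrightarrow> h z \<in> M"
  using h_image by blast

lemma disc_differential_chart:
  assumes "(U, \<phi>) \<in> A" "z \<in> \<D>" "h z \<in> U" "((\<phi> \<circ> h) has_derivative L) (at z)"
  shows "disc_differential A h z \<zeta> (U, \<phi>) = L \<zeta>"
  using assms frechet_derivative_at[OF assms(4)] by (simp add: disc_differential_def charts_at_def)

lemma disc_differential_zero: "z \<in> \<D> \<Longrightarrow> disc_differential A h z 0 = zero_tangent"
proof (rule ext)
  fix c assume z: "z \<in> \<D>"
  show "disc_differential A h z 0 c = 0"
  proof (cases "c \<in> charts_at A (h z)")
    case True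
    obtain U \<phi> where c: "c = (U, \<phi>)" by fastforce
    then have c': "(U, \<phi>) \<in> A" "h z \<in> U" using True by (auto simp: charts_at_def)
    obtain L k where L: "((\<phi> \<circ> h) has_derivative L) (at z)"
      using locally_conformal_has_derivative[OF locally_conformal_chart[OF c'(1) z c'(2)]] by blast
    show ?thesis
      using disc_differential_chart[OF c'(1) z c'(2) L, of 0] linear_0[OF has_derivative_linear[OF L]] c by simp
  qed (simp add: disc_differential_def)
qed

lemma transition_derivative:
  assumes c: "(U, \<phi>) \<in> A" "(V, \<psi>) \<in> A" and p: "p \<in> U" "p \<in> V"
  obtains L where "((\<psi> \<circ> inv_into U \<phi>) has_derivative L) (at (\<phi> p))"
proof -
  have o: "open (\<phi> ` (U \<inter> V))"
  proof -
    have "openin (top_of_set U) (U \<inter> V)"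
      using chartD(1)[OF c(1)] chartD(1)[OF c(2)] openin_imp_subset
      by (metis inf_le1 openin_Int openin_subset_trans)
    moreover have "homeomorphism U (\<phi> ` U) \<phi> (inv_into U \<phi>)"
      using chartD[OF c(1)] by (auto simp: homeomorphism_def)
    ultimately have "openin (top_of_set (\<phi> ` U)) (\<phi> ` (U \<inter> V))"
      by (metis homeomorphism_imp_open_map)
    then show ?thesis using chartD(2)[OF c(1)] openin_open_trans by blast
  qed
  have "conformal_map_on (\<phi> ` (U \<inter> V)) (\<psi> \<circ> inv_into U \<phi>)"
    using surface c unfolding conformal_surface_def by blast
  then have "locally_conformal (\<psi> \<circ> inv_into U \<phi>) (\<phi> p)"
    by (rule conformal_map_on_locally_conformal[OF _ o]) (use p in auto)
  then show thesis using locally_conformal_has_derivative that by blast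
qed

text \<open>
  One chart determines \<open>\<zeta>\<close>, because the differential of the covering in this chart is a similarity.  The
  transition rule for tangent vectors and the chain rule give the other charts.
\<close>

lemma tangent_vector_lift:
  assumes z: "z \<in> \<D>" and \<xi>: "\<xi> \<in> tangent_space A (h z)"
  obtains \<zeta> where "\<xi> = disc_differential A h z \<zeta>"
proof -
  obtain U \<phi> where c: "(U, \<phi>) \<in> A" "h z \<in> U" using chart_exists[OF h_in_M[OF z]] by blast
  obtain L k where L: "((\<phi> \<circ> h) has_derivative L) (at z)" "0 < k" "\<And>v. norm (L v) = k * norm v"
    using locally_conformal_has_derivative[OF locally_conformal_chart[OF c(1) z c(2)]] by blast
  have linL: "linear L" by (rule has_derivative_linear[OF L(1)])
  have "inj L" using L(2,3) by (auto simp: linear_injective_0[OF linL]) (metis mult_eq_0_iff norm_eq_zero less_irrefl)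
  then have "surj L" using linear_injective_imp_surjective[OF linL] by blast
  then obtain \<zeta> where \<zeta>: "L \<zeta> = \<xi> (U, \<phi>)" by (metis surjD)
  have "\<xi> d = disc_differential A h z \<zeta> d" for d
  proof (cases "d \<in> charts_at A (h z)")
    case False
    then have "\<xi> d = 0" using \<xi> unfolding tangent_space_def by blast
    then show ?thesis using False by (simp add: disc_differential_def)
  next
    case True
    obtain V \<psi> where d: "d = (V, \<psi>)" by fastforce
    have dV: "(V, \<psi>) \<in> A" "h z \<in> V" using True d by (auto simp: charts_at_def)
    obtain K where K: "((\<psi> \<circ> inv_into U \<phi>) has_derivative K) (at (\<phi> (h z)))"
      using transition_derivative[OF c(1) dV(1) c(2) dV(2)] by blast
    have "((\<psi> \<circ> inv_into U \<phi>) \<circ> (\<phi> \<circ> h) has_derivative K \<circ> L) (at z)"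
      using L(1) K by (intro diff_chain_at) auto
    then have "((\<psi> \<circ> h) has_derivative K \<circ> L) (at z)"
      by (rule has_derivative_transform_within_open[OF _ open_chart_preimage[OF c(1)]])
        (use z c chartD(3)[OF c(1)] in auto)
    then have "disc_differential A h z \<zeta> (V, \<psi>) = K (\<xi> (U, \<phi>))"
      using disc_differential_chart[OF dV(1) z dV(2)] \<zeta> by simp
    moreover have "\<xi> (V, \<psi>) = frechet_derivative (\<psi> \<circ> inv_into U \<phi>) (at (\<phi> (h z))) (\<xi> (U, \<phi>))"
    proof -
      have in_charts: "(U, \<phi>) \<in> charts_at A (h z)" "(V, \<psi>) \<in> charts_at A (h z)"
        using c dV by (simp_all add: charts_at_def)
      have "\<forall>(U, \<phi>)\<in>charts_at A (h z). \<forall>(V, \<psi>)\<in>charts_at A (h z).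
        \<xi> (V, \<psi>) = frechet_derivative (\<psi> \<circ> inv_into U \<phi>) (at (\<phi> (h z))) (\<xi> (U, \<phi>))"
        using \<xi> unfolding tangent_space_def mem_Collect_eq by (rule conjunct2)
      from bspec[OF bspec[OF this in_charts(1), unfolded prod.case] in_charts(2), unfolded prod.case]
      show ?thesis .
    qed
    ultimately show ?thesis using frechet_derivative_at[OF K] d by simp
  qed
  then show thesis using that by blast
qed

end

lemma local_rep_derivative:
  fixes f :: "'a \<Rightarrow> real ^ 'n"
  assumes f: "conformal_harmonic A f" and c: "(U, \<phi>) \<in> A" and p: "p \<in> \<phi> ` U"
  obtains L k where "(local_rep (U, \<phi>) f has_derivative L) (at p)" "\<And>v. norm (L v) = k * norm v"
proof -
  let ?F = "local_rep (U, \<phi>) f"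
  have F: "harmonic_on (\<phi> ` U) (\<lambda>z. ?F z $ i)" "norm (dx ?F p) = norm (dy ?F p)" "dx ?F p \<bullet> dy ?F p = 0" for i
    using f c p unfolding conformal_harmonic_def Let_def by blast+
  have "?F differentiable (at p)"
  proof (subst differentiable_componentwise_within, intro ballI)
    fix b :: "real ^ 'n" assume "b \<in> Basis"
    then obtain i where b: "b = axis i 1" by (auto simp: Basis_vec_def)
    show "(\<lambda>z. ?F z \<bullet> b) differentiable (at p)"
      using F(1)[of i] p unfolding harmonic_on_def C2_on_def C1_on_def by (simp only: b inner_axis) auto
  qed
  then have D: "(?F has_derivative frechet_derivative ?F (at p)) (at p)"
    by (simp add: frechet_derivative_works)
  show thesis
    by (rule that[OF D], rule conformal_linear_of_orthogonal[OF has_derivative_linear[OF D]])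
      (use F(2,3) in \<open>simp_all add: dir_deriv_def\<close>)
qed

context surface_covered_by_disc begin

lemma local_rep_compose:
  assumes c: "(U, \<phi>) \<in> A" and z: "z \<in> \<D> \<inter> h -` U"
  shows "(local_rep (U, \<phi>) f \<circ> (\<phi> \<circ> h)) z = (f \<circ> h) z"
  using z chartD(3)[OF c] by (simp add: local_rep_def)

lemma disc_harmonic_lift:
  fixes f :: "'a \<Rightarrow> real ^ 'n"
  assumes f: "conformal_harmonic A f"
  shows "disc_harmonic (f \<circ> h)"
  unfolding disc_harmonic_def
proof
  fix b :: "real ^ 'n" assume "b \<in> Basis"
  then obtain i where b: "b = axis i 1" by (auto simp: Basis_vec_def)
  have "locally_Re (\<lambda>w. (f \<circ> h) w $ i) z" if z: "z \<in> \<D>" for z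
  proof -
    obtain U \<phi> where c: "(U, \<phi>) \<in> A" "h z \<in> U" using chart_exists[OF h_in_M[OF z]] by blast
    let ?F = "local_rep (U, \<phi>) f"
    have "harmonic_on (\<phi> ` U) (\<lambda>z. ?F z $ i)"
      using f c unfolding conformal_harmonic_def Let_def by blast
    then have "locally_Re (\<lambda>z. ?F z $ i) ((\<phi> \<circ> h) z)"
      by (rule harmonic_on_locally_Re[OF chartD(2)[OF c(1)]]) (use c in auto)
    then have "locally_Re ((\<lambda>z. ?F z $ i) \<circ> (\<phi> \<circ> h)) z"
      by (rule locally_Re_compose[OF _ locally_conformal_chart[OF c(1) z c(2)]])
    then show ?thesis
      by (rule locally_Re_cong[OF _ open_chart_preimage[OF c(1)]])
         (use z c local_rep_compose[OF c(1), of _ f] in auto)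
  qed
  then obtain H where "H holomorphic_on \<D>" "\<forall>w\<in>\<D>. (f \<circ> h) w $ i = Re (H w)"
    using locally_Re_imp_Re[of \<D> "\<lambda>w. (f \<circ> h) w $ i"] by auto
  then show "\<exists>H. H holomorphic_on \<D> \<and> (\<forall>w\<in>\<D>. (f \<circ> h) w \<bullet> b = Re (H w))"
    by (auto simp: b inner_axis)
qed

lemma lift_derivative:
  fixes f :: "'a \<Rightarrow> real ^ 'n"
  assumes f: "conformal_harmonic A f" and z: "z \<in> \<D>"
  obtains L k where "((f \<circ> h) has_derivative L) (at z)" "\<And>v. norm (L v) = k * norm v"
    "\<And>\<zeta>. surface_differential A f (h z) (disc_differential A h z \<zeta>) = L \<zeta>"
proof -
  define c where "c = (SOME c. c \<in> charts_at A (h z))"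
  obtain U0 \<phi>0 where "(U0, \<phi>0) \<in> A" "h z \<in> U0" using chart_exists[OF h_in_M[OF z]] by blast
  then have "(U0, \<phi>0) \<in> charts_at A (h z)" by (simp add: charts_at_def)
  then have "c \<in> charts_at A (h z)" unfolding c_def by (metis someI)
  moreover obtain U \<phi> where cU: "c = (U, \<phi>)" by fastforce
  ultimately have c: "(U, \<phi>) \<in> A" "h z \<in> U" by (auto simp: charts_at_def)
  obtain L k where L: "((\<phi> \<circ> h) has_derivative L) (at z)" "0 < k" "\<And>v. norm (L v) = k * norm v"
    using locally_conformal_has_derivative[OF locally_conformal_chart[OF c(1) z c(2)]] by blast
  obtain K l where K: "(local_rep (U, \<phi>) f has_derivative K) (at (\<phi> (h z)))" "\<And>v. norm (K v) = l * norm v"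
    using local_rep_derivative[OF f c(1), of "\<phi> (h z)"] c by blast
  have "(local_rep (U, \<phi>) f \<circ> (\<phi> \<circ> h) has_derivative K \<circ> L) (at z)"
    using L(1) K(1) by (intro diff_chain_at) auto
  then have D: "((f \<circ> h) has_derivative K \<circ> L) (at z)"
    by (rule has_derivative_transform_within_open[OF _ open_chart_preimage[OF c(1)]])
      (use z c local_rep_compose[OF c(1), of _ f] in auto)
  show thesis
  proof (rule that[OF D])
    show "norm ((K \<circ> L) v) = (l * k) * norm v" for v by (simp add: K(2) L(3))
    show "surface_differential A f (h z) (disc_differential A h z \<zeta>) = (K \<circ> L) \<zeta>" for \<zeta>
      unfolding surface_differential_def Let_def c_def[symmetric] cU
      using disc_differential_chart[OF c(1) z c(2) L(1)] frechet_derivative_at[OF K(1)] by simp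
  qed
qed

section \<open>The Poincare metric is well defined\<close>

text \<open>
  Points with the same image are related by a lift \<open>\<tau>\<close> of the covering through itself.  It is locally
  conformal, hence a conformal harmonic map of the disc into the plane, and the Schwarz--Pick
  lemma applies to it.  In dimension two the Cayley--Klein and Poincare metrics agree in the
  radial direction, so the estimate in this direction bounds the scaling factor of the
  differential of \<open>\<tau>\<close>.
\<close>

lemma poincare_disc_le_of_same_image:
  assumes z: "z1 \<in> \<D>" "z2 \<in> \<D>" "h z1 = h z2"
    and eq: "disc_differential A h z1 \<zeta>1 = disc_differential A h z2 \<zeta>2"
  shows "poincare_disc z2 \<zeta>2 \<le> poincare_disc z1 \<zeta>1"
proof -
  obtain \<tau> where \<tau>: "continuous_on \<D> \<tau>" "\<tau> ` \<D> \<subseteq> \<D>" "\<tau> z1 = z2" "\<And>w. w \<in> \<D> \<Longrightarrow> h (\<tau> w) = h w"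
    using covering_space_lift_convex[OF cover z(2) convex_ball open_ball z(1) h_cont _ z(3)] h_image by blast
  have local: "\<exists>W l U \<phi>. (U, \<phi>) \<in> A \<and> open W \<and> w \<in> W \<and> h w \<in> U \<and> W \<subseteq> \<D> \<inter> h -` U \<and> locally_conformal l (\<phi> (h w)) \<and> (\<forall>v\<in>W. \<tau> v = l (\<phi> (h v)))" 
    if w: "w \<in> \<D>" for w
  proof -
    have \<tau>w: "\<tau> w \<in> \<D>" using \<tau>(2) w by blast
    obtain U \<phi> where c: "(U, \<phi>) \<in> A" "h w \<in> U" using chart_exists[OF h_in_M[OF w]] by blast
    then have "locally_conformal (\<phi> \<circ> h) (\<tau> w)"
      using locally_conformal_chart[OF c(1) \<tau>w] \<tau>(4)[OF w] by simp
    then obtain N l where N: "open N" "\<tau> w \<in> N" "\<And>v. v \<in> N \<Longrightarrow> l ((\<phi> \<circ> h) v) = v"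
       "\<And>y. y \<in> (\<phi> \<circ> h) ` N \<Longrightarrow> locally_conformal l y"
      using locally_conformal_inverse by metis
    define W where "W = (\<D> \<inter> h -` U) \<inter> \<tau> -` N"
    have "open W"
      unfolding W_def
      by (intro continuous_open_preimage open_chart_preimage[OF c(1)] N(1) continuous_on_subset[OF \<tau>(1)]) auto
    moreover have "w \<in> W" using w c N(2) by (simp add: W_def)
    moreover have "\<tau> v = l (\<phi> (h v))" if "v \<in> W" for v
      using that N(3)[of "\<tau> v"] \<tau>(4)[of v] by (auto simp: W_def)
    moreover have "locally_conformal l (\<phi> (h w))"
      using N(4)[OF imageI[OF N(2)]] \<tau>(4)[OF w] by simp
    ultimately show ?thesis using c by (intro exI[of _ W] exI[of _ l] exI[of _ U] exI[of _ \<phi>]) (auto simp: W_def)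
  qed
  have harm: "disc_harmonic \<tau>"
    unfolding disc_harmonic_def
  proof
    fix b :: complex
    have "locally_Re (\<lambda>w. \<tau> w \<bullet> b) w" if w: "w \<in> \<D>" for w
    proof -
      obtain W l U \<phi> where W: "(U, \<phi>) \<in> A" "open W" "w \<in> W" "h w \<in> U" "locally_conformal l (\<phi> (h w))"
        "\<And>v. v \<in> W \<Longrightarrow> \<tau> v = l (\<phi> (h v))"
        using local[OF w] by metis
      have "locally_Re ((\<lambda>w. w \<bullet> b) \<circ> l) ((\<phi> \<circ> h) w)"
        using locally_Re_compose[OF locally_Re_inner W(5)] by simp
      then have "locally_Re (((\<lambda>w. w \<bullet> b) \<circ> l) \<circ> (\<phi> \<circ> h)) w"
        by (rule locally_Re_compose[OF _ locally_conformal_chart[OF W(1) w W(4)]])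
      then show ?thesis
        by (rule locally_Re_cong[OF _ W(2,3)]) (use W(6) in auto)
    qed
    then show "\<exists>H. H holomorphic_on \<D> \<and> (\<forall>w\<in>\<D>. \<tau> w \<bullet> b = Re (H w))"
      using locally_Re_imp_Re[of \<D> "\<lambda>w. \<tau> w \<bullet> b"] by auto
  qed
  obtain W l U \<phi> where W: "(U, \<phi>) \<in> A" "open W" "z1 \<in> W" "h z1 \<in> U" "W \<subseteq> \<D> \<inter> h -` U" "locally_conformal l (\<phi> (h z1))"
    "\<And>v. v \<in> W \<Longrightarrow> \<tau> v = l (\<phi> (h v))"
    using local[OF z(1)] by metis
  have U2: "h z2 \<in> U" using W(4) z(3) by simp
  obtain L1 k1 where L1: "((\<phi> \<circ> h) has_derivative L1) (at z1)" "0 < k1" "\<And>v. norm (L1 v) = k1 * norm v"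
    using locally_conformal_has_derivative[OF locally_conformal_chart[OF W(1) z(1) W(4)]] by blast
  obtain L2 k2 where L2: "((\<phi> \<circ> h) has_derivative L2) (at z2)" "0 < k2" "\<And>v. norm (L2 v) = k2 * norm v"
    using locally_conformal_has_derivative[OF locally_conformal_chart[OF W(1) z(2) U2]] by blast
  obtain K k where K: "(l has_derivative K) (at (\<phi> (h z1)))" "0 < k" "\<And>v. norm (K v) = k * norm v"
    using locally_conformal_has_derivative[OF W(6)] by blast
  have "((l \<circ> (\<phi> \<circ> h)) has_derivative K \<circ> L1) (at z1)"
    using L1(1) K(1) by (intro diff_chain_at) auto
  then have D: "(\<tau> has_derivative K \<circ> L1) (at z1)"
    by (rule has_derivative_transform_within_open[OF _ W(2,3)]) (use W(7) in auto)
  have conf: "norm ((K \<circ> L1) v) = (k * k1) * norm v" for v by (simp add: K(3) L1(3))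
  have "(((\<phi> \<circ> h) \<circ> \<tau>) has_derivative L2 \<circ> (K \<circ> L1)) (at z1)"
    using D L2(1) \<tau>(3) by (intro diff_chain_at) auto
  moreover have "(((\<phi> \<circ> h) \<circ> \<tau>) has_derivative L1) (at z1)"
    by (rule has_derivative_transform_within_open[OF L1(1) W(2,3)]) (use W(5) \<tau>(4) in auto)
  ultimately have "L2 \<circ> (K \<circ> L1) = L1" by (rule has_derivative_unique)
  then have "L2 ((K \<circ> L1) \<zeta>1) = L1 \<zeta>1" by (metis comp_apply)
  also have "\<dots> = L2 \<zeta>2"
    using disc_differential_chart[OF W(1) z(1) W(4) L1(1), of \<zeta>1] disc_differential_chart[OF W(1) z(2) U2 L2(1), of \<zeta>2] eq
    by simp
  finally have "L2 ((K \<circ> L1) \<zeta>1 - \<zeta>2) = 0"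
    using linear_diff[OF has_derivative_linear[OF L2(1)]] by simp
  then have dt: "(K \<circ> L1) \<zeta>1 = \<zeta>2"
    using L2(2) L2(3)[of "(K \<circ> L1) \<zeta>1 - \<zeta>2"] by simp
  have lin: "linear (K \<circ> L1)" by (rule has_derivative_linear[OF D])
  define \<kappa> where "\<kappa> = k * k1"
  have \<kappa>: "0 < \<kappa>" using K(2) L1(2) by (simp add: \<kappa>_def)
  have "inj (K \<circ> L1)"
    using \<kappa> conf by (auto simp: linear_injective_0[OF lin] \<kappa>_def[symmetric] simp del: comp_apply)
      (metis mult_eq_0_iff norm_eq_zero less_irrefl)
  then have "surj (K \<circ> L1)" using linear_injective_imp_surjective[OF lin] by blast
  \<comment> \<open>A radial vector at \<open>z2\<close>; at the origin every direction is radial.\<close>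
  define e where "e = (if z2 = 0 then 1 else z2)"
  obtain v where v: "(K \<circ> L1) v = e" using \<open>surj (K \<circ> L1)\<close> by (metis surjD)
  have e: "e \<noteq> 0" by (simp add: e_def)
  define d where "d = 1 - (norm z2)\<^sup>2"
  have d: "0 < d" using z(2) by (simp add: d_def power_less_one_iff)
  have ck: "cayley_klein z2 e = norm e / d"
  proof -
    have "(z2 \<bullet> e)\<^sup>2 = (norm z2)\<^sup>2 * (norm e)\<^sup>2"
      by (simp add: e_def power2_norm_eq_inner[symmetric] power2_eq_square)
    then have "(norm e)\<^sup>2 / d + (z2 \<bullet> e)\<^sup>2 / d\<^sup>2 = (norm e)\<^sup>2 * (d + (norm z2)\<^sup>2) / d\<^sup>2"
      using d by (simp add: field_simps power2_eq_square)
    also have "\<dots> = (norm e / d)\<^sup>2" by (simp add: d_def power_divide)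
    finally show ?thesis
      using d unfolding cayley_klein_def d_def[symmetric] by (simp add: real_sqrt_unique)
  qed
  have "cayley_klein z2 e \<le> poincare_disc z1 v"
    using schwarz_pick(1)[OF harm \<tau>(2) z(1) D conf, of v] v \<tau>(3) by simp
  then have "norm e / d \<le> norm v / (1 - (norm z1)\<^sup>2)" by (simp add: ck poincare_disc_def)
  moreover have "norm e = \<kappa> * norm v" using conf[of v] v by (simp add: \<kappa>_def)
  ultimately have "\<kappa> / d * norm v \<le> 1 / (1 - (norm z1)\<^sup>2) * norm v" by simp
  moreover have "norm v > 0" using e v linear_0[OF lin] by auto
  ultimately have "\<kappa> / d \<le> 1 / (1 - (norm z1)\<^sup>2)"
    using mult_le_cancel_right_pos by blast
  then have "\<kappa> / d * norm \<zeta>1 \<le> 1 / (1 - (norm z1)\<^sup>2) * norm \<zeta>1" by (rule mult_right_mono) simp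
  moreover have "norm \<zeta>2 = \<kappa> * norm \<zeta>1" using conf[of \<zeta>1] dt by (simp add: \<kappa>_def)
  ultimately show ?thesis by (simp add: poincare_disc_def d_def)
qed

text \<open>
  The value at a tangent vector is read off at an arbitrary preimage; by the previous lemma, applied in
  both directions, the choice does not matter.
\<close>

lemma is_poincare_metric_exists: "\<exists>g. is_poincare_metric M A g"
proof -
  define g where "g p \<xi> = (let w = (SOME w. fst w \<in> \<D> \<and> h (fst w) = p \<and> disc_differential A h (fst w) (snd w) = \<xi>)
     in poincare_disc (fst w) (snd w))" for p \<xi>
  have "g (h z) (disc_differential A h z \<zeta>) = poincare_disc z \<zeta>" if z: "z \<in> \<D>" for z \<zeta>
  proof -
    define Q where "Q w \<longleftrightarrow> fst w \<in> \<D> \<and> h (fst w) = h z \<and> disc_differential A h (fst w) (snd w) = disc_differential A h z \<zeta>" for w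
    have "Q (z, \<zeta>)" using z by (simp add: Q_def)
    then have "Q (SOME w. Q w)" by (rule someI)
    then obtain w where w: "(SOME w. Q w) = w" "Q w" by blast
    have "g (h z) (disc_differential A h z \<zeta>) = poincare_disc (fst w) (snd w)"
      unfolding g_def Let_def Q_def[symmetric] w(1) by (rule refl)
    also have "\<dots> = poincare_disc z \<zeta>"
    proof (rule antisym)
      have w': "fst w \<in> \<D>" "h (fst w) = h z" "disc_differential A h (fst w) (snd w) = disc_differential A h z \<zeta>"
        using w(2) unfolding Q_def by blast+
      show "poincare_disc (fst w) (snd w) \<le> poincare_disc z \<zeta>"
        by (rule poincare_disc_le_of_same_image[OF z w'(1) w'(2)[symmetric] w'(3)[symmetric]])
      show "poincare_disc z \<zeta> \<le> poincare_disc (fst w) (snd w)"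
        by (rule poincare_disc_le_of_same_image[OF w'(1) z w'(2,3)])
    qed
    finally show ?thesis .
  qed
  then show ?thesis
    unfolding is_poincare_metric_def using covering by blast
qed

end

text \<open>
  The metric is chosen together with a covering for which the covering map is a local isometry; the rest of the
  argument works with this covering.
\<close>

lemma poincare_metric_covering:
  assumes "conformal_surface M A" "hyperbolic_surface M A"
  obtains h where "surface_covered_by_disc M A h"
    "\<And>z \<zeta>. z \<in> \<D> \<Longrightarrow> poincare_metric M A (h z) (disc_differential A h z \<zeta>) = poincare_disc z \<zeta>"
proof -
  obtain h0 where "universal_conformal_covering M A h0"
    using assms(2) unfolding hyperbolic_surface_def by blast
  then interpret surface_covered_by_disc M A h0 using assms(1) by unfold_locales
  have "is_poincare_metric M A (poincare_metric M A)"
    unfolding poincare_metric_def using is_poincare_metric_exists by (rule someI_ex)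
  then show thesis
    unfolding is_poincare_metric_def using that assms(1) surface_covered_by_disc.intro by blast
qed

section \<open>Lengths of paths\<close>

lemma disc_harmonic_C1_on:
  assumes F: "disc_harmonic F" shows "C1_on \<D> F"
proof -
  have D: "(F has_derivative frechet_derivative F (at z)) (at z)" if "z \<in> \<D>" for z
    using disc_harmonic_differentiable[OF F that] by (simp add: frechet_derivative_works)
  have "continuous_on \<D> (dir_deriv v F)" for v
  proof (subst continuous_on_componentwise, intro ballI)
    fix b :: 'a
    obtain H where H: "H holomorphic_on \<D>" "\<And>w. w \<in> \<D> \<Longrightarrow> F w \<bullet> b = Re (H w)"
      using disc_harmonic_inner[OF F] by blast
    have "continuous_on \<D> (\<lambda>z. Re (deriv H z * v))"
      using H(1) by (intro continuous_intros holomorphic_on_imp_continuous_on holomorphic_deriv) auto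
    moreover have "dir_deriv v F z \<bullet> b = Re (deriv H z * v)" if "z \<in> \<D>" for z
      unfolding dir_deriv_def by (rule disc_harmonic_derivative_inner[OF D[OF that] that H])
    then have "continuous_on \<D> (\<lambda>z. dir_deriv v F z \<bullet> b) \<longleftrightarrow> continuous_on \<D> (\<lambda>z. Re (deriv H z * v))"
      by (intro continuous_on_cong) auto
    ultimately show "continuous_on \<D> (\<lambda>z. dir_deriv v F z \<bullet> b)" by simp
  qed
  then show ?thesis
    unfolding C1_on_def using disc_harmonic_differentiable[OF F] by blast
qed

lemma C1_on_continuous: "C1_on S u \<Longrightarrow> continuous_on S u"
  by (auto simp: C1_on_def intro!: continuous_at_imp_continuous_on differentiable_imp_continuous_within)

lemma C1_arc_continuous: "C1_arc a b g \<Longrightarrow> continuous_on {a..b} g"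
  unfolding C1_arc_def by (blast intro: continuous_on_vector_derivative)

lemma continuous_on_interval_nhd:
  fixes \<beta> :: "real \<Rightarrow> 'b::topological_space"
  assumes "continuous_on {c..d} \<beta>" "t \<in> {c..d}" "open N" "\<beta> t \<in> N"
  obtains e where "0 < e" "\<beta> ` {max c (t - e)..min d (t + e)} \<subseteq> N"
proof -
  have "openin (top_of_set {c..d}) ({c..d} \<inter> \<beta> -` N)"
    by (rule continuous_openin_preimage_gen[OF assms(1,3)])
  then obtain e where e: "0 < e" "cball t e \<inter> {c..d} \<subseteq> {c..d} \<inter> \<beta> -` N"
    using assms unfolding openin_contains_cball by blast
  have "{max c (t - e)..min d (t + e)} \<subseteq> cball t e \<inter> {c..d}"
    by (auto simp: dist_real_def abs_le_iff)
  then show thesis using that[OF e(1)] e(2) by blast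
qed

lemma C1_arc_compose_locally_conformal:
  assumes \<beta>: "C1_arc c d \<beta>" and "c < d" and g: "\<And>t. t \<in> {c..d} \<Longrightarrow> locally_conformal g (\<beta> t)"
  shows "C1_arc c d (g \<circ> \<beta>)"
proof (rule C1_arc_local[OF \<open>c < d\<close>])
  fix t assume t: "t \<in> {c..d}"
  obtain N where N: "open N" "\<beta> t \<in> N" "C1_on N g"
    using locally_conformal_C1_on[OF g[OF t]] by blast
  obtain e where e: "0 < e" "\<beta> ` {max c (t - e)..min d (t + e)} \<subseteq> N"
    using continuous_on_interval_nhd[OF C1_arc_continuous[OF \<beta>] t N(1,2)] by blast
  have "C1_arc (max c (t - e)) (min d (t + e)) (g \<circ> \<beta>)"
    by (rule C1_arc_compose[OF N(3) C1_arc_subinterval[OF \<beta>] e(2)]) auto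
  then show "\<exists>e>0. C1_arc (max c (t - e)) (min d (t + e)) (g \<circ> \<beta>)" using e(1) by blast
qed

lemma ball_path_continuous: "ball_path \<delta> \<Longrightarrow> continuous_on {0..1} \<delta>"
  by (simp add: ball_path_def path_def)

lemma ball_path_in_ball: "ball_path \<delta> \<Longrightarrow> t \<in> {0..1} \<Longrightarrow> \<delta> t \<in> ball 0 1"
  unfolding ball_path_def path_image_def by blast

lemma has_vector_derivative_chain:
  assumes "(\<delta> has_vector_derivative D) (at t)" "(g has_derivative L) (at (\<delta> t))"
  shows "((g \<circ> \<delta>) has_vector_derivative L D) (at t)"
  by (rule vector_derivative_diff_chain_within[OF assms(1) has_derivative_at_withinI[OF assms(2)]])

text \<open>
  The exceptional set contains the end points \<open>0\<close> and \<open>1\<close>, where two-sided derivatives are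
  arbitrary.
\<close>

lemma ball_path_differentiable:
  fixes \<delta> :: "real \<Rightarrow> 'b::euclidean_space"
  assumes "ball_path \<delta>"
  obtains S where "finite S" "{0, 1} \<subseteq> S"
    "\<And>t. t \<in> {0..1} - S \<Longrightarrow> (\<delta> has_vector_derivative vector_derivative \<delta> (at t)) (at t)"
    "\<And>a b. 0 \<le> a \<Longrightarrow> a < b \<Longrightarrow> b \<le> 1 \<Longrightarrow> {a<..<b} \<inter> S = {} \<Longrightarrow> C1_arc a b \<delta>"
proof -
  obtain S where S: "finite S" "\<And>a b. 0 \<le> a \<Longrightarrow> a < b \<Longrightarrow> b \<le> 1 \<Longrightarrow> {a<..<b} \<inter> S = {} \<Longrightarrow> C1_arc a b \<delta>"
    using assms unfolding ball_path_def piecewise_def by blast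
  show thesis
  proof (rule that[of "S \<union> {0, 1}"])
    show "C1_arc a b \<delta>" if "0 \<le> a" "a < b" "b \<le> 1" "{a<..<b} \<inter> (S \<union> {0,1}) = {}" for a b
      using S(2)[of a b] that by blast
    fix t :: real assume t: "t \<in> {0..1} - (S \<union> {0, 1})"
    have "open ({0<..<1} - S)" using S(1) by (simp add: finite_imp_closed open_Diff)
    then obtain e where e: "0 < e" "cball t e \<subseteq> {0<..<1} - S"
      using t unfolding open_contains_cball by force
    then have sub: "{t - e..t + e} \<subseteq> {0<..<1} - S" by (simp add: cball_eq_atLeastAtMost)
    have in01: "t - e \<in> {0<..<1}" "t + e \<in> {0<..<1}"
      using subsetD[OF sub, of "t - e"] subsetD[OF sub, of "t + e"] e(1) by auto
    have "{t - e<..<t + e} \<inter> S = {}"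
      using sub greaterThanLessThan_subseteq_atLeastAtMost_iff[of "t - e" "t + e" "t - e" "t + e"] by blast
    then have "C1_arc (t - e) (t + e) \<delta>"
      using S(2)[of "t - e" "t + e"] in01 e(1) by auto
    then obtain D where "(\<delta> has_vector_derivative D) (at t within {t - e..t + e})"
      using e(1) unfolding C1_arc_def by fastforce
    moreover have "at t within {t - e..t + e} = at t"
      using e(1) by (intro at_within_interior) auto
    ultimately show "(\<delta> has_vector_derivative vector_derivative \<delta> (at t)) (at t)"
      using vector_derivative_at by metis
  qed (use S in auto)
qed

lemma integrable_piecewise:
  fixes f :: "real \<Rightarrow> 'b::banach"
  assumes "finite S" "a \<le> b"
    and "\<And>c d. a \<le> c \<Longrightarrow> c < d \<Longrightarrow> d \<le> b \<Longrightarrow> {c<..<d} \<inter> S = {} \<Longrightarrow> f integrable_on {c..d}"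
  shows "f integrable_on {a..b}"
  using assms
proof (induction S arbitrary: a b rule: finite_induct)
  case empty
  then show ?case
    using integrable_on_refl[of f a] by (cases "a < b") auto
next
  case (insert s S)
  show ?case
  proof (cases "s \<in> {a<..<b}")
    case True
    have "f integrable_on {a..s}"
    proof (rule insert.IH)
      fix c d assume "a \<le> c" "c < d" "d \<le> s" "{c<..<d} \<inter> S = {}"
      then show "f integrable_on {c..d}" using True by (intro insert.prems) auto
    qed (use True in auto)
    moreover have "f integrable_on {s..b}"
    proof (rule insert.IH)
      fix c d assume "s \<le> c" "c < d" "d \<le> b" "{c<..<d} \<inter> S = {}"
      then show "f integrable_on {c..d}" using True by (intro insert.prems) auto
    qed (use True in auto)
    ultimately show ?thesis
      using True by (intro Henstock_Kurzweil_Integration.integrable_combine[of a s b f]) auto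
  next
    case False
    show ?thesis
    proof (rule insert.IH[OF insert.prems(1)])
      fix c d assume "a \<le> c" "c < d" "d \<le> b" "{c<..<d} \<inter> S = {}"
      then show "f integrable_on {c..d}" using False by (intro insert.prems) auto
    qed
  qed
qed

text \<open>
  On each piece the integrand agrees, except at the end points, with a function that is continuous up to the
  end points.
\<close>

lemma ball_path_speed_integrable:
  fixes \<delta> :: "real \<Rightarrow> 'b::euclidean_space" and \<Phi> :: "'b \<Rightarrow> 'b \<Rightarrow> real"
  assumes \<delta>: "ball_path \<delta>" and \<Phi>: "continuous_on (ball 0 1 \<times> UNIV) (\<lambda>(x, v). \<Phi> x v)"
  shows "(\<lambda>t. \<Phi> (\<delta> t) (vector_derivative \<delta> (at t))) integrable_on {0..1}"
proof -
  obtain S where S: "finite S" "{0, 1} \<subseteq> S"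
    "\<And>t. t \<in> {0..1} - S \<Longrightarrow> (\<delta> has_vector_derivative vector_derivative \<delta> (at t)) (at t)"
    "\<And>a b. 0 \<le> a \<Longrightarrow> a < b \<Longrightarrow> b \<le> 1 \<Longrightarrow> {a<..<b} \<inter> S = {} \<Longrightarrow> C1_arc a b \<delta>"
    using ball_path_differentiable[OF \<delta>] by blast
  show ?thesis
  proof (rule integrable_piecewise[OF S(1)])
    fix c d :: real assume cd: "0 \<le> c" "c < d" "d \<le> 1" "{c<..<d} \<inter> S = {}"
    then obtain \<delta>' where \<delta>': "continuous_on {c..d} \<delta>'"
      "\<And>t. t \<in> {c..d} \<Longrightarrow> (\<delta> has_vector_derivative \<delta>' t) (at t within {c..d})"
      using S(4) unfolding C1_arc_def by blast
    have "continuous_on {c..d} (\<lambda>t. (\<lambda>(x, v). \<Phi> x v) (\<delta> t, \<delta>' t))"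
    proof (rule continuous_on_compose2[OF \<Phi>])
      show "continuous_on {c..d} (\<lambda>t. (\<delta> t, \<delta>' t))"
        using \<delta>' cd by (intro continuous_intros continuous_on_subset[OF ball_path_continuous[OF \<delta>]]) auto
      show "(\<lambda>t. (\<delta> t, \<delta>' t)) ` {c..d} \<subseteq> ball 0 1 \<times> UNIV"
        using ball_path_in_ball[OF \<delta>] cd by (auto simp del: mem_ball_0)
    qed
    then have "(\<lambda>t. \<Phi> (\<delta> t) (\<delta>' t)) integrable_on {c..d}"
      by (intro integrable_continuous_real) simp
    then show "(\<lambda>t. \<Phi> (\<delta> t) (vector_derivative \<delta> (at t))) integrable_on {c..d}"
    proof (rule integrable_spike_finite[of "{c, d}", rotated 2])
      fix t assume t: "t \<in> {c..d} - {c, d}"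
      then have "(\<delta> has_vector_derivative \<delta>' t) (at t)"
        using \<delta>'(2)[of t] at_within_Icc_at[of c t d] by auto
      then show "\<Phi> (\<delta> t) (vector_derivative \<delta> (at t)) = \<Phi> (\<delta> t) (\<delta>' t)"
        using vector_derivative_at by metis
    qed simp
  qed simp
qed

lemma cayley_klein_continuous: "continuous_on (ball 0 1 \<times> UNIV) (\<lambda>(x, v). cayley_klein x v)"
proof -
  have "1 - (norm (x::'a))\<^sup>2 \<noteq> 0" if "norm x < 1" for x
    using that by (simp add: power2_eq_1_iff) (smt (verit) norm_ge_zero)
  then show ?thesis
    unfolding cayley_klein_def case_prod_unfold by (intro continuous_intros) auto
qed

lemma poincare_disc_continuous: "continuous_on (\<D> \<times> UNIV) (\<lambda>(x, v). poincare_disc x v)"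
proof -
  have "1 - (norm (x::complex))\<^sup>2 \<noteq> 0" if "norm x < 1" for x
    using that by (simp add: power2_eq_1_iff) (smt (verit) norm_ge_zero)
  then show ?thesis
    unfolding poincare_disc_def case_prod_unfold by (intro continuous_intros) auto
qed

definition disc_length :: "(real \<Rightarrow> complex) \<Rightarrow> real"
  where "disc_length \<delta> = integral {0..1} (\<lambda>t. poincare_disc (\<delta> t) (vector_derivative \<delta> (at t)))"

lemma poincare_disc_nonneg: "z \<in> \<D> \<Longrightarrow> 0 \<le> poincare_disc z v"
  by (simp add: poincare_disc_def power_le_one)

lemma cayley_klein_nonneg: "norm x \<le> 1 \<Longrightarrow> 0 \<le> cayley_klein x v"
  by (simp add: cayley_klein_def power_le_one)

lemma cayley_klein_length_nonneg:
  fixes \<gamma> :: "real \<Rightarrow> 'b::euclidean_space"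
  assumes \<gamma>: "ball_path \<gamma>" shows "0 \<le> cayley_klein_length \<gamma>"
proof -
  have "norm (\<gamma> t) \<le> 1" if "t \<in> {0..1}" for t
    using ball_path_in_ball[OF \<gamma> that] by simp
  then show ?thesis
    unfolding cayley_klein_length_def by (auto intro!: integral_nonneg cayley_klein_nonneg ball_path_speed_integrable[OF \<gamma> cayley_klein_continuous])
qed

lemma disc_length_integrable:
  "ball_path \<delta> \<Longrightarrow> (\<lambda>t. poincare_disc (\<delta> t) (vector_derivative \<delta> (at t))) integrable_on {0..1}"
  by (rule ball_path_speed_integrable[OF _ poincare_disc_continuous])

text \<open>
  Integrating the derivative of \<open>\<psi> \<circ> \<delta>\<close>.  With \<open>\<psi>\<close> the identity this bounds Euclidean
  distances, and with the logarithm of \<open>1 - |z|\<^sup>2\<close> it keeps paths away from the unit circle.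
\<close>

lemma disc_length_lower_bound:
  fixes \<psi> :: "complex \<Rightarrow> 'c::euclidean_space"
  assumes \<delta>: "ball_path \<delta>" and s: "s \<in> {0..1}"
    and \<psi>: "\<And>z. z \<in> \<D> \<Longrightarrow> (\<psi> has_derivative \<psi>' z) (at z)"
    and bnd: "\<And>z v. z \<in> \<D> \<Longrightarrow> norm (\<psi>' z v) \<le> K * poincare_disc z v" and K: "0 \<le> K"
  shows "norm (\<psi> (\<delta> s) - \<psi> (\<delta> 0)) \<le> K * disc_length \<delta>"
proof -
  obtain S where S: "finite S" "{0, 1} \<subseteq> S"
    "\<And>t. t \<in> {0..1} - S \<Longrightarrow> (\<delta> has_vector_derivative vector_derivative \<delta> (at t)) (at t)"
    using ball_path_differentiable[OF \<delta>] by metis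
  let ?p = "\<lambda>t. poincare_disc (\<delta> t) (vector_derivative \<delta> (at t))"
  let ?f = "\<lambda>t. \<psi>' (\<delta> t) (vector_derivative \<delta> (at t))"
  have int: "?p integrable_on {0..1}" by (rule disc_length_integrable[OF \<delta>])
  have nn: "0 \<le> ?p t" if "t \<in> {0..1}" for t
    by (rule poincare_disc_nonneg[OF ball_path_in_ball[OF \<delta> that]])
  have ints: "?p integrable_on {0..s}" using int s by (auto intro: integrable_subinterval_real)
  have c\<psi>: "continuous_on \<D> \<psi>" 
    using \<psi> by (intro continuous_at_imp_continuous_on ballI) (metis has_derivative_continuous)
  have ftc: "(?f has_integral \<psi> (\<delta> s) - \<psi> (\<delta> 0)) {0..s}"
  proof (rule fundamental_theorem_of_calculus_interior_strong[OF S(1), of 0 s "\<lambda>t. \<psi> (\<delta> t)"])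
    show "0 \<le> s" using s by simp
    show "continuous_on {0..s} (\<lambda>t. \<psi> (\<delta> t))"
      using s ball_path_in_ball[OF \<delta>]
      by (intro continuous_on_compose2[OF c\<psi> continuous_on_subset[OF ball_path_continuous[OF \<delta>]]]) auto
    fix t assume t: "t \<in> {0<..<s} - S"
    then have t': "t \<in> {0..1} - S" using s by auto
    have "((\<psi> \<circ> \<delta>) has_vector_derivative ?f t) (at t)"
      using t' by (intro has_vector_derivative_chain S(3)[OF t'] \<psi> ball_path_in_ball[OF \<delta>]) auto
    then show "((\<lambda>t. \<psi> (\<delta> t)) has_vector_derivative ?f t) (at t)" by (simp add: o_def)
  qed
  have "norm (\<psi> (\<delta> s) - \<psi> (\<delta> 0)) = norm (integral {0..s} ?f)"
    using integral_unique[OF ftc] by simp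
  also have "\<dots> \<le> integral {0..s} (\<lambda>t. K * ?p t)"
    using s by (intro integral_norm_bound_integral has_integral_integrable[OF ftc] integrable_on_mult_right ints bnd ball_path_in_ball[OF \<delta>]) auto
  also have "\<dots> = K * integral {0..s} ?p" by simp
  also have "\<dots> \<le> K * disc_length \<delta>"
    unfolding disc_length_def using s K
    by (intro mult_left_mono integral_subset_le ints int) (auto intro: nn)
  finally show ?thesis .
qed

lemma ball_path_compose:
  fixes F :: "complex \<Rightarrow> 'b::euclidean_space"
  assumes F: "C1_on \<D> F" "F ` \<D> \<subseteq> ball 0 1" and \<delta>: "ball_path \<delta>"
  shows "ball_path (F \<circ> \<delta>)"
proof -
  have cF: "continuous_on \<D> F" by (rule C1_on_continuous[OF F(1)])
  have im: "\<delta> ` {0..1} \<subseteq> \<D>" using ball_path_in_ball[OF \<delta>] by blast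
  obtain S where S: "finite S" "\<And>a b. 0 \<le> a \<Longrightarrow> a < b \<Longrightarrow> b \<le> 1 \<Longrightarrow> {a<..<b} \<inter> S = {} \<Longrightarrow> C1_arc a b \<delta>"
    using ball_path_differentiable[OF \<delta>] by metis
  show ?thesis unfolding ball_path_def
  proof (intro conjI)
    show "path (F \<circ> \<delta>)"
      unfolding path_def by (intro continuous_on_compose ball_path_continuous[OF \<delta>] continuous_on_subset[OF cF im])
    show "path_image (F \<circ> \<delta>) \<subseteq> ball 0 1"
      unfolding path_image_def image_comp[symmetric] using im F(2) by blast
    show "piecewise (\<lambda>a b. C1_arc a b (F \<circ> \<delta>))"
      unfolding piecewise_def
    proof (intro exI[of _ S] conjI S(1) allI impI)
      fix a b assume ab: "0 \<le> a \<and> a < b \<and> b \<le> 1 \<and> {a<..<b} \<inter> S = {}"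
      have "\<delta> ` {a..b} \<subseteq> \<delta> ` {0..1}" using ab by (intro image_mono) auto
      then show "C1_arc a b (F \<circ> \<delta>)"
        using ab im by (intro C1_arc_compose[OF F(1)] S(2)) auto
    qed
  qed
qed

lemma cayley_klein_length_compose_le:
  fixes F :: "complex \<Rightarrow> 'b::euclidean_space"
  assumes F: "C1_on \<D> F" "F ` \<D> \<subseteq> ball 0 1" and \<delta>: "ball_path \<delta>"
    and bnd: "\<And>t v. t \<in> {0..1} \<Longrightarrow> cayley_klein (F (\<delta> t)) (frechet_derivative F (at (\<delta> t)) v) \<le> K * poincare_disc (\<delta> t) v"
  shows "cayley_klein_length (F \<circ> \<delta>) \<le> K * disc_length \<delta>"
proof -
  obtain S where S: "finite S" "{0, 1} \<subseteq> S"
    "\<And>t. t \<in> {0..1} - S \<Longrightarrow> (\<delta> has_vector_derivative vector_derivative \<delta> (at t)) (at t)"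
    using ball_path_differentiable[OF \<delta>] by metis
  let ?c = "\<lambda>t. cayley_klein ((F \<circ> \<delta>) t) (vector_derivative (F \<circ> \<delta>) (at t))"
  let ?c' = "\<lambda>t. if t \<in> S then 0 else ?c t"
  let ?p = "\<lambda>t. K * poincare_disc (\<delta> t) (vector_derivative \<delta> (at t))"
  let ?p' = "\<lambda>t. if t \<in> S then 0 else ?p t"
  have ic: "?c integrable_on {0..1}"
    by (rule ball_path_speed_integrable[OF ball_path_compose[OF F \<delta>] cayley_klein_continuous])
  have ip: "?p integrable_on {0..1}"
    by (intro integrable_on_mult_right disc_length_integrable \<delta>)
  have ic': "?c' integrable_on {0..1}" by (rule integrable_spike_finite[OF S(1) _ ic]) auto
  have ip': "?p' integrable_on {0..1}" by (rule integrable_spike_finite[OF S(1) _ ip]) auto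
  have "?c' t \<le> ?p' t" if t: "t \<in> {0..1}" for t
  proof (cases "t \<in> S")
    case False
    have D: "(F has_derivative frechet_derivative F (at (\<delta> t))) (at (\<delta> t))"
      using F(1) ball_path_in_ball[OF \<delta> t] by (auto simp: C1_on_def frechet_derivative_works simp del: mem_ball_0)
    have "(F \<circ> \<delta> has_vector_derivative frechet_derivative F (at (\<delta> t)) (vector_derivative \<delta> (at t))) (at t)"
      using False t by (intro has_vector_derivative_chain S(3) D) auto
    then show ?thesis
      using False bnd[OF t] vector_derivative_at by fastforce
  qed simp
  then have "integral {0..1} ?c' \<le> integral {0..1} ?p'"
    by (rule integral_le[OF ic' ip'])
  moreover have "integral {0..1} ?c' = integral {0..1} ?c" by (rule integral_spike[OF negligible_finite[OF S(1)]]) auto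
  moreover have "integral {0..1} ?p' = integral {0..1} ?p" by (rule integral_spike[OF negligible_finite[OF S(1)]]) auto
  ultimately show ?thesis by (simp add: cayley_klein_length_def disc_length_def)
qed

context surface_covered_by_disc begin

lemma surface_path_of_disc_path:
  assumes \<delta>: "ball_path \<delta>"
  shows "surface_path M A (h \<circ> \<delta>)"
proof -
  have im: "\<delta> ` {0..1} \<subseteq> \<D>" using ball_path_in_ball[OF \<delta>] by blast
  obtain S where S: "finite S" "\<And>a b. 0 \<le> a \<Longrightarrow> a < b \<Longrightarrow> b \<le> 1 \<Longrightarrow> {a<..<b} \<inter> S = {} \<Longrightarrow> C1_arc a b \<delta>"
    using ball_path_differentiable[OF \<delta>] by metis
  show ?thesis unfolding surface_path_def
  proof (intro conjI)
    show "path (h \<circ> \<delta>)"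
      unfolding path_def by (intro continuous_on_compose ball_path_continuous[OF \<delta>] continuous_on_subset[OF h_cont im])
    show "path_image (h \<circ> \<delta>) \<subseteq> M"
      unfolding path_image_def image_comp[symmetric] using im h_image by blast
    show "piecewise (\<lambda>a b. \<forall>(U, \<phi>)\<in>A. \<forall>c d. a \<le> c \<and> c < d \<and> d \<le> b \<and> (h \<circ> \<delta>) ` {c..d} \<subseteq> U \<longrightarrow> C1_arc c d (\<phi> \<circ> (h \<circ> \<delta>)))"
      unfolding piecewise_def
    proof (intro exI[of _ S] conjI S(1) allI impI ballI, clarify)
      fix a b c d :: real and U \<phi>
      assume ab: "0 \<le> a" "a < b" "b \<le> 1" "{a<..<b} \<inter> S = {}" and cA: "(U, \<phi>) \<in> A"
        and cd: "a \<le> c" "c < d" "d \<le> b" and sub: "(h \<circ> \<delta>) ` {c..d} \<subseteq> U"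
      have "C1_arc c d ((\<phi> \<circ> h) \<circ> \<delta>)"
      proof (rule C1_arc_compose_locally_conformal[OF C1_arc_subinterval[OF S(2)[OF ab] cd(1,3)] cd(2)])
        fix t assume t: "t \<in> {c..d}"
        then have "\<delta> t \<in> \<D>" using ab cd by (intro ball_path_in_ball[OF \<delta>]) auto
        moreover have "h (\<delta> t) \<in> U" using t sub by auto
        ultimately show "locally_conformal (\<phi> \<circ> h) (\<delta> t)" by (rule locally_conformal_chart[OF cA])
      qed
      then show "C1_arc c d (\<phi> \<circ> (h \<circ> \<delta>))" by (simp add: comp_assoc)
    qed
  qed
qed

text \<open>
  Near each parameter the lift is a local inverse of \<open>\<phi> \<circ> h\<close> applied to the path in the chart
  \<open>\<phi>\<close>, so it inherits the smoothness required of the path in charts.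
\<close>

lemma lift_surface_path:
  assumes \<gamma>: "surface_path M A \<gamma>" and z0: "z0 \<in> \<D>" "h z0 = \<gamma> 0"
  obtains \<delta> where "ball_path \<delta>" "\<delta> 0 = z0" "\<And>t. t \<in> {0..1} \<Longrightarrow> h (\<delta> t) = \<gamma> t"
proof -
  have c\<gamma>: "continuous_on {0..1} \<gamma>" and im: "\<gamma> ` {0..1} \<subseteq> M"
    using \<gamma> by (auto simp: surface_path_def path_def path_image_def)
  obtain \<delta> where \<delta>: "continuous_on {0..1} \<delta>" "\<delta> ` {0..1} \<subseteq> \<D>" "\<delta> 0 = z0" "\<And>t. t \<in> {0..1} \<Longrightarrow> h (\<delta> t) = \<gamma> t"
    using covering_space_path_lift[OF cover z0(1) c\<gamma> im z0(2)[symmetric]] by blast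
  obtain S where S: "finite S" "\<And>a b U \<phi> c d. 0 \<le> a \<Longrightarrow> a < b \<Longrightarrow> b \<le> 1 \<Longrightarrow> {a<..<b} \<inter> S = {} \<Longrightarrow> (U, \<phi>) \<in> A \<Longrightarrow>
       a \<le> c \<Longrightarrow> c < d \<Longrightarrow> d \<le> b \<Longrightarrow> \<gamma> ` {c..d} \<subseteq> U \<Longrightarrow> C1_arc c d (\<phi> \<circ> \<gamma>)"
    using \<gamma> unfolding surface_path_def piecewise_def by fast
  have "C1_arc a b \<delta>" if ab: "0 \<le> a" "a < b" "b \<le> 1" "{a<..<b} \<inter> S = {}" for a b
  proof (rule C1_arc_local[OF ab(2)])
    fix t assume t: "t \<in> {a..b}"
    then have t01: "t \<in> {0..1}" and ab01: "{a..b} \<subseteq> {0..1}" using ab by auto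
    have \<delta>t: "\<delta> t \<in> \<D>" using \<delta>(2) t01 by blast
    obtain U \<phi> where c: "(U, \<phi>) \<in> A" "h (\<delta> t) \<in> U" using chart_exists[OF h_in_M[OF \<delta>t]] by blast
    obtain N k where N: "open N" "\<delta> t \<in> N" "\<And>w. w \<in> N \<Longrightarrow> k ((\<phi> \<circ> h) w) = w"
       "\<And>y. y \<in> (\<phi> \<circ> h) ` N \<Longrightarrow> locally_conformal k y"
      using locally_conformal_inverse[OF locally_conformal_chart[OF c(1) \<delta>t c(2)]] by metis
    obtain e where e: "0 < e" "\<delta> ` {max a (t - e)..min b (t + e)} \<subseteq> N \<inter> (\<D> \<inter> h -` U)"
      using continuous_on_interval_nhd[OF continuous_on_subset[OF \<delta>(1) ab01] t, of "N \<inter> (\<D> \<inter> h -` U)"]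
        N(1,2) open_chart_preimage[OF c(1)] \<delta>t c(2) by auto
    let ?c = "max a (t - e)" and ?d = "min b (t + e)"
    have cd: "a \<le> ?c" "?c < ?d" "?d \<le> b" using t e(1) ab by auto
    have in01: "s \<in> {0..1}" if "s \<in> {?c..?d}" for s using that ab by auto
    have "\<gamma> ` {?c..?d} \<subseteq> U" using e(2) \<delta>(4)[OF in01] by fastforce
    then have C: "C1_arc ?c ?d (\<phi> \<circ> \<gamma>)" by (rule S(2)[OF ab c(1) cd])
    have \<phi>\<gamma>: "(\<phi> \<circ> \<gamma>) s = (\<phi> \<circ> h) (\<delta> s)" "\<delta> s \<in> N" if "s \<in> {?c..?d}" for s
      using \<delta>(4)[OF in01[OF that]] e(2) that by auto
    have "C1_arc ?c ?d (k \<circ> (\<phi> \<circ> \<gamma>))"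
      by (rule C1_arc_compose_locally_conformal[OF C cd(2)]) (use N(4) \<phi>\<gamma> in auto)
    then have "C1_arc ?c ?d \<delta>"
      by (rule C1_arc_cong) (use N(3) \<phi>\<gamma> in simp)
    then show "\<exists>e>0. C1_arc (max a (t - e)) (min b (t + e)) \<delta>" using e(1) by blast
  qed
  then have "ball_path \<delta>"
    unfolding ball_path_def path_def path_image_def piecewise_def using \<delta>(1,2) S(1) by blast
  then show thesis using that \<delta> by blast
qed

lemma poincare_length_lift:
  assumes iso: "\<And>z \<zeta>. z \<in> \<D> \<Longrightarrow> poincare_metric M A (h z) (disc_differential A h z \<zeta>) = poincare_disc z \<zeta>"
    and \<delta>: "ball_path \<delta>" and \<gamma>: "\<And>t. t \<in> {0..1} \<Longrightarrow> h (\<delta> t) = \<gamma> t"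
  shows "poincare_length M A \<gamma> = disc_length \<delta>"
proof -
  obtain S where S: "finite S" "{0, 1} \<subseteq> S"
    "\<And>t. t \<in> {0..1} - S \<Longrightarrow> (\<delta> has_vector_derivative vector_derivative \<delta> (at t)) (at t)"
    using ball_path_differentiable[OF \<delta>] by metis
  have "poincare_metric M A (\<gamma> t) (surface_velocity A \<gamma> t) = poincare_disc (\<delta> t) (vector_derivative \<delta> (at t))"
    if t: "t \<in> {0..1} - S" for t
  proof -
    have \<delta>t: "\<delta> t \<in> \<D>" using t by (intro ball_path_in_ball[OF \<delta>]) auto
    have t1: "t \<in> {0<..<1}" using t S(2) by (auto simp: less_le)
    have "surface_velocity A \<gamma> t = disc_differential A h (\<delta> t) (vector_derivative \<delta> (at t))"
    proof
      fix c
      show "surface_velocity A \<gamma> t c = disc_differential A h (\<delta> t) (vector_derivative \<delta> (at t)) c"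
      proof (cases "c \<in> charts_at A (\<gamma> t)")
        case False
        then show ?thesis using \<gamma>[of t] t by (simp add: surface_velocity_def disc_differential_def)
      next
        case True
        obtain U \<phi> where cU: "c = (U, \<phi>)" by fastforce
        have c: "(U, \<phi>) \<in> A" "h (\<delta> t) \<in> U" using True cU \<gamma>[of t] t by (auto simp: charts_at_def)
        obtain L where L: "((\<phi> \<circ> h) has_derivative L) (at (\<delta> t))"
          using locally_conformal_has_derivative[OF locally_conformal_chart[OF c(1) \<delta>t c(2)]] by blast
        have "((\<phi> \<circ> h) \<circ> \<delta> has_vector_derivative L (vector_derivative \<delta> (at t))) (at t)"
          by (rule has_vector_derivative_chain[OF S(3)[OF t] L])
        then have "(\<phi> \<circ> \<gamma> has_vector_derivative L (vector_derivative \<delta> (at t))) (at t)"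
          by (rule has_vector_derivative_transform_within_open[where S = "{0<..<1}"]) (use t1 \<gamma> in auto)
        then show ?thesis
          using True disc_differential_chart[OF c(1) \<delta>t c(2) L] vector_derivative_at
          by (fastforce simp: surface_velocity_def cU)
      qed
    qed
    then show ?thesis using iso[OF \<delta>t] \<gamma>[of t] t by simp
  qed
  then show ?thesis
    unfolding poincare_length_def disc_length_def
    by (intro integral_spike[OF negligible_finite[OF S(1)]]) auto
qed

end

section \<open>Conformal harmonic maps of surfaces into the ball\<close>

locale conformal_harmonic_into_ball = surface_covered_by_disc M A h
  for M :: "'a::{t2_space,second_countable_topology} set" and A :: "'a chart set" and h :: "complex \<Rightarrow> 'a" +
  fixes f :: "'a \<Rightarrow> real ^ 'n"
  assumes iso: "\<And>z \<zeta>. z \<in> \<D> \<Longrightarrow> poincare_metric M A (h z) (disc_differential A h z \<zeta>) = poincare_disc z \<zeta>"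
    and into_ball: "f ` M \<subseteq> ball 0 1" and harmonic: "conformal_harmonic A f"
begin

abbreviation lift :: "complex \<Rightarrow> real ^ 'n"
  where "lift \<equiv> f \<circ> h"

abbreviation dlift :: "complex \<Rightarrow> complex \<Rightarrow> real ^ 'n"
  where "dlift z \<equiv> frechet_derivative lift (at z)"

definition parametrizes :: "(real ^ 'n) set \<Rightarrow> (real ^ 'n \<Rightarrow> complex) \<Rightarrow> bool"
  where "parametrizes \<Delta> k \<longleftrightarrow> affine_disc \<Delta> \<and> homeomorphism \<D> \<Delta> lift k \<and>
        (\<forall>w\<in>\<D>. \<forall>L. (lift has_derivative L) (at w) \<longrightarrow> inj L)"

text \<open>
  This is the outcome of equality in the Schwarz--Pick lemma.  It does not mention the point where
  equality holds, so that its failure means strict inequality at all points.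
\<close>

definition extremal :: bool
  where "extremal \<longleftrightarrow> (\<exists>\<Delta> k. parametrizes \<Delta> k)"

lemma lift_harmonic: "disc_harmonic lift"
  by (rule disc_harmonic_lift[OF harmonic])

lemma lift_C1: "C1_on \<D> lift"
  by (rule disc_harmonic_C1_on[OF lift_harmonic])

lemma lift_into_ball: "lift ` \<D> \<subseteq> ball 0 1"
  unfolding image_comp[symmetric] h_image by (rule into_ball)

lemma lift_schwarz_pick:
  assumes z: "z \<in> \<D>"
  shows "surface_differential A f (h z) (disc_differential A h z \<zeta>) = dlift z \<zeta>"
    and "cayley_klein (lift z) (dlift z \<zeta>) \<le> poincare_disc z \<zeta>"
    and "cayley_klein (lift z) (dlift z \<zeta>) = poincare_disc z \<zeta> \<Longrightarrow> \<zeta> \<noteq> 0 \<Longrightarrow> extremal"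
proof -
  obtain L k where L: "(lift has_derivative L) (at z)" "\<And>v. norm (L v) = k * norm v"
    "\<And>\<zeta>. surface_differential A f (h z) (disc_differential A h z \<zeta>) = L \<zeta>"
    using lift_derivative[OF harmonic z] by blast
  have LD: "dlift z = L" using frechet_derivative_at[OF L(1)] by simp
  show "surface_differential A f (h z) (disc_differential A h z \<zeta>) = dlift z \<zeta>"
    unfolding LD by (rule L(3))
  show "cayley_klein (lift z) (dlift z \<zeta>) \<le> poincare_disc z \<zeta>"
    unfolding LD by (rule schwarz_pick(1)[OF lift_harmonic lift_into_ball z L(1,2)])
  show extremal if "cayley_klein (lift z) (dlift z \<zeta>) = poincare_disc z \<zeta>" "\<zeta> \<noteq> 0"
    unfolding extremal_def parametrizes_def using schwarz_pick(2)[OF lift_harmonic lift_into_ball z L(1,2)] that LD by metis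
qed

lemma differential_le:
  assumes "p \<in> M" "\<xi> \<in> tangent_space A p"
  shows "cayley_klein (f p) (surface_differential A f p \<xi>) \<le> poincare_metric M A p \<xi>"
    and "cayley_klein (f p) (surface_differential A f p \<xi>) = poincare_metric M A p \<xi> \<Longrightarrow> \<xi> \<noteq> zero_tangent \<Longrightarrow> extremal"
proof -
  obtain z where z: "z \<in> \<D>" "h z = p" using assms(1) h_image by blast
  obtain \<zeta> where \<zeta>: "\<xi> = disc_differential A h z \<zeta>"
    using tangent_vector_lift[OF z(1)] assms(2) z(2) by blast
  have eqs: "surface_differential A f p \<xi> = dlift z \<zeta>" "poincare_metric M A p \<xi> = poincare_disc z \<zeta>" "f p = lift z"
    using lift_schwarz_pick(1)[OF z(1), of \<zeta>] iso[OF z(1), of \<zeta>] z(2) \<zeta> by simp_all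
  show "cayley_klein (f p) (surface_differential A f p \<xi>) \<le> poincare_metric M A p \<xi>"
    unfolding eqs by (rule lift_schwarz_pick(2)[OF z(1)])
  assume "cayley_klein (f p) (surface_differential A f p \<xi>) = poincare_metric M A p \<xi>" "\<xi> \<noteq> zero_tangent"
  then show extremal
    using lift_schwarz_pick(3)[OF z(1)] disc_differential_zero[OF z(1)] \<zeta> unfolding eqs by metis
qed

text \<open>
  If \<open>f \<circ> h\<close> is injective then so is the covering \<open>h\<close>, which is then a homeomorphism.  In a chart, a zero of
  \<open>dx\<close> would be a zero of the differential by conformality, contradicting the injectivity of the
  differential of \<open>f \<circ> h\<close>.
\<close>

lemma extremal_imp_disc:
  assumes extremal
  shows "conformally_equivalent_disc M A \<and> (\<exists>\<Delta>. affine_disc \<Delta> \<and> conformal_diffeo_onto M A f \<Delta>)"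
proof -
  obtain \<Delta> k where "parametrizes \<Delta> k"
    using assms unfolding extremal_def by blast
  then have \<Delta>: "affine_disc \<Delta>" and k: "homeomorphism \<D> \<Delta> lift k"
    and inj: "\<And>w L. w \<in> \<D> \<Longrightarrow> (lift has_derivative L) (at w) \<Longrightarrow> inj L"
    unfolding parametrizes_def by simp_all
  have "inj_on h \<D>"
  proof (rule inj_onI)
    fix x y assume xy: "x \<in> \<D>" "y \<in> \<D>" "h x = h y"
    have "x = k (lift x)" using homeomorphism_apply1[OF k xy(1)] by simp
    also have "\<dots> = k (lift y)" using xy(3) by simp
    also have "\<dots> = y" using homeomorphism_apply1[OF k xy(2)] by simp
    finally show "x = y" .
  qed
  then obtain l where l: "homeomorphism \<D> M h l"
    using injective_covering_homeomorphism[OF cover] by blast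
  have "conformal_from_disc A h" using covering by (simp add: universal_conformal_covering_def)
  then have 1: "conformally_equivalent_disc M A"
    unfolding conformally_equivalent_disc_def using l by blast
  have "homeomorphism M \<Delta> (lift \<circ> l) (h \<circ> k)"
    by (rule homeomorphism_compose[OF homeomorphism_symD[OF l] k])
  then have "homeomorphism M \<Delta> f (h \<circ> k)"
    by (rule homeomorphism_cong) (use homeomorphism_apply2[OF l] in auto)
  moreover have "C1_on (\<phi> ` U) (local_rep (U, \<phi>) f) \<and>
     (\<forall>z\<in>\<phi> ` U. norm (dx (local_rep (U, \<phi>) f) z) = norm (dy (local_rep (U, \<phi>) f) z) \<and>
         dx (local_rep (U, \<phi>) f) z \<bullet> dy (local_rep (U, \<phi>) f) z = 0 \<and> dx (local_rep (U, \<phi>) f) z \<noteq> 0)"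
    if c: "(U, \<phi>) \<in> A" for U \<phi>
  proof (intro conjI ballI)
    let ?R = "local_rep (U, \<phi>) f"
    have R: "harmonic_on (\<phi> ` U) (\<lambda>z. ?R z $ i)" for i
      using harmonic c unfolding conformal_harmonic_def Let_def by blast
    have comp: "C1_on (\<phi> ` U) (\<lambda>z. ?R z $ i)" for i
      using R[of i] by (simp add: harmonic_on_def C2_on_def)
    have D: "(?R has_derivative frechet_derivative ?R (at z)) (at z)" if "z \<in> \<phi> ` U" for z
      using local_rep_derivative[OF harmonic c that] by (metis differentiableI frechet_derivative_works)
    have "continuous_on (\<phi> ` U) (dir_deriv v ?R)" if v: "v \<in> {1, \<i>}" for v
    proof (subst continuous_on_componentwise, intro ballI)
      fix b :: "real ^ 'n" assume "b \<in> Basis"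
      then obtain i where b: "b = axis i 1" by (auto simp: Basis_vec_def)
      have "dir_deriv v ?R z \<bullet> b = dir_deriv v (\<lambda>z. ?R z $ i) z" if z: "z \<in> \<phi> ` U" for z
      proof -
        have "((\<lambda>z. ?R z $ i) has_derivative (\<lambda>v. frechet_derivative ?R (at z) v $ i)) (at z)"
          by (rule bounded_linear.has_derivative[OF bounded_linear_vec_nth D[OF z]])
        from frechet_derivative_at[OF this, symmetric] show ?thesis
          by (simp add: dir_deriv_def b inner_axis)
      qed
      then have "continuous_on (\<phi> ` U) (\<lambda>z. dir_deriv v ?R z \<bullet> b) \<longleftrightarrow> continuous_on (\<phi> ` U) (dir_deriv v (\<lambda>z. ?R z $ i))"
        by (intro continuous_on_cong) auto
      then show "continuous_on (\<phi> ` U) (\<lambda>z. dir_deriv v ?R z \<bullet> b)"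
        using comp[of i] v by (auto simp: C1_on_def)
    qed
    then show "C1_on (\<phi> ` U) ?R"
      unfolding C1_on_def using D by (auto simp: differentiable_def)
    fix z assume z: "z \<in> \<phi> ` U"
    show "norm (dx ?R z) = norm (dy ?R z)" "dx ?R z \<bullet> dy ?R z = 0"
      using harmonic c z unfolding conformal_harmonic_def Let_def by blast+
    obtain p where p: "p \<in> U" "z = \<phi> p" using z by blast
    have "p \<in> M" using p(1) openin_imp_subset[OF chartD(1)[OF c]] by blast
    then obtain w where w: "w \<in> \<D>" "h w = p" using h_image by blast
    show "dx ?R z \<noteq> 0"
    proof
      assume 0: "dx ?R z = 0"
      obtain K m where K: "(?R has_derivative K) (at z)" "\<And>v. norm (K v) = m * norm v"
        using local_rep_derivative[OF harmonic c z] by blast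
      have "K 1 = 0" using 0 frechet_derivative_at[OF K(1)] by (simp add: dir_deriv_def)
      then have K0: "K v = 0" for v using K(2)[of 1] K(2)[of v] by simp
      obtain L where L: "((\<phi> \<circ> h) has_derivative L) (at w)"
        using locally_conformal_has_derivative[OF locally_conformal_chart[OF c w(1)]] w(2) p(1) by blast
      have "(?R \<circ> (\<phi> \<circ> h) has_derivative K \<circ> L) (at w)"
        using L K(1) p(2) w(2) by (intro diff_chain_at) auto
      then have "(lift has_derivative K \<circ> L) (at w)"
        by (rule has_derivative_transform_within_open[OF _ open_chart_preimage[OF c]])
          (use w p local_rep_compose[OF c, of _ f] in auto)
      then have "inj (K \<circ> L)" by (rule inj[OF w(1)])
      moreover have "(K \<circ> L) 0 = (K \<circ> L) 1" by (simp add: K0)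
      ultimately have "(0::complex) = 1" by (rule injD)
      then show False by simp
    qed
  qed
  ultimately have "conformal_diffeo_onto M A f \<Delta>"
    unfolding conformal_diffeo_onto_def Let_def by blast
  then show ?thesis using 1 \<Delta> by blast
qed

text \<open>
  The image under \<open>f \<circ> h\<close> of a lift of \<open>\<gamma>\<close> competes in the Cayley--Klein distance.  The factor \<open>K\<close> is \<open>1\<close> for
  the distance-decreasing property and smaller than \<open>1\<close> in the discussion of equality.
\<close>

lemma cayley_klein_dist_le_length:
  assumes \<gamma>: "surface_path M A \<gamma>" and z: "z \<in> \<D>" "h z = pathstart \<gamma>"
    and bnd: "\<And>\<delta> t v. ball_path \<delta> \<Longrightarrow> \<delta> 0 = z \<Longrightarrow> disc_length \<delta> = poincare_length M A \<gamma> \<Longrightarrow> t \<in> {0..1} \<Longrightarrow>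
      cayley_klein (lift (\<delta> t)) (dlift (\<delta> t) v) \<le> K * poincare_disc (\<delta> t) v"
  shows "cayley_klein_dist (f (pathstart \<gamma>)) (f (pathfinish \<gamma>)) \<le> K * poincare_length M A \<gamma>"
proof -
  obtain \<delta> where \<delta>: "ball_path \<delta>" "\<delta> 0 = z" "\<And>t. t \<in> {0..1} \<Longrightarrow> h (\<delta> t) = \<gamma> t"
    using lift_surface_path[OF \<gamma> z(1)] z(2) by (auto simp: pathstart_def)
  have len: "poincare_length M A \<gamma> = disc_length \<delta>"
    by (rule poincare_length_lift[OF iso \<delta>(1,3)])
  have bp: "ball_path (lift \<circ> \<delta>)" by (rule ball_path_compose[OF lift_C1 lift_into_ball \<delta>(1)])
  have ends: "pathstart (lift \<circ> \<delta>) = f (pathstart \<gamma>)" "pathfinish (lift \<circ> \<delta>) = f (pathfinish \<gamma>)"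
    using \<delta>(3)[of 0] \<delta>(3)[of 1] by (simp_all add: pathstart_def pathfinish_def)
  have "cayley_klein_dist (f (pathstart \<gamma>)) (f (pathfinish \<gamma>)) \<le> cayley_klein_length (lift \<circ> \<delta>)"
    unfolding cayley_klein_dist_def
    by (rule cInf_lower) (use bp ends cayley_klein_length_nonneg in \<open>auto intro!: bdd_belowI[of _ 0]\<close>)
  also have "\<dots> \<le> K * disc_length \<delta>"
    by (rule cayley_klein_length_compose_le[OF lift_C1 lift_into_ball \<delta>(1)]) (use bnd[OF \<delta>(1,2)] len in auto)
  finally show ?thesis by (simp add: len)
qed

lemma surface_path_exists:
  assumes "p \<in> M" "q \<in> M"
  shows "\<exists>\<gamma>. surface_path M A \<gamma> \<and> pathstart \<gamma> = p \<and> pathfinish \<gamma> = q"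
proof -
  obtain z w where zw: "z \<in> \<D>" "h z = p" "w \<in> \<D>" "h w = q" using assms h_image by blast
  have "ball_path (linepath z w)" unfolding ball_path_def
  proof (intro conjI)
    show "path_image (linepath z w) \<subseteq> ball 0 1"
      using zw by (simp add: closed_segment_subset)
    show "piecewise (\<lambda>a b. C1_arc a b (linepath z w))"
      unfolding piecewise_def C1_arc_def
      by (intro exI[of _ "{}"] conjI allI impI exI[of _ "\<lambda>_. w - z"] ballI has_vector_derivative_linepath_within) auto
  qed simp
  then have "surface_path M A (h \<circ> linepath z w)" by (rule surface_path_of_disc_path)
  then show ?thesis using zw by (intro exI[of _ "h \<circ> linepath z w"]) (simp add: pathstart_compose pathfinish_compose)
qed

lemma dist_le:
  assumes p: "p \<in> M" and q: "q \<in> M"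
  shows "cayley_klein_dist (f p) (f q) \<le> poincare_dist M A p q"
  unfolding poincare_dist_def
proof (rule cInf_greatest)
  show "{poincare_length M A \<gamma> |\<gamma>. surface_path M A \<gamma> \<and> pathstart \<gamma> = p \<and> pathfinish \<gamma> = q} \<noteq> {}"
    using surface_path_exists[OF p q] by blast
  fix x assume "x \<in> {poincare_length M A \<gamma> |\<gamma>. surface_path M A \<gamma> \<and> pathstart \<gamma> = p \<and> pathfinish \<gamma> = q}"
  then obtain \<gamma> where \<gamma>: "surface_path M A \<gamma>" "pathstart \<gamma> = p" "pathfinish \<gamma> = q" "x = poincare_length M A \<gamma>" by blast
  obtain z where z: "z \<in> \<D>" "h z = p" using p h_image by blast
  have "cayley_klein_dist (f (pathstart \<gamma>)) (f (pathfinish \<gamma>)) \<le> 1 * poincare_length M A \<gamma>"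
    by (rule cayley_klein_dist_le_length[OF \<gamma>(1) z(1)])
      (use z \<gamma> lift_schwarz_pick(2) ball_path_in_ball in \<open>auto simp del: mem_ball_0\<close>)
  then show "cayley_klein_dist (f p) (f q) \<le> x" using \<gamma> by simp
qed

text \<open>
  The points over \<open>q\<close> stay outside a ball around \<open>z\<close>, and Poincare lengths dominate Euclidean lengths.
\<close>

lemma poincare_dist_pos:
  assumes p: "p \<in> M" and q: "q \<in> M" and pq: "p \<noteq> q"
  shows "0 < poincare_dist M A p q"
proof -
  obtain z where z: "z \<in> \<D>" "h z = p" using p h_image by blast
  have "openin (top_of_set \<D>) (\<D> \<inter> h -` (- {q}))"
    by (intro continuous_openin_preimage_gen h_cont) auto
  then have "open (\<D> \<inter> h -` (- {q}))" using openin_open_trans open_ball by blast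
  moreover have "z \<in> \<D> \<inter> h -` (- {q})" using z pq by simp
  ultimately obtain r where r: "0 < r" "ball z r \<subseteq> \<D> \<inter> h -` (- {q})"
    unfolding open_contains_ball by blast
  have "r \<le> poincare_dist M A p q"
    unfolding poincare_dist_def
  proof (rule cInf_greatest)
    show "{poincare_length M A \<gamma> |\<gamma>. surface_path M A \<gamma> \<and> pathstart \<gamma> = p \<and> pathfinish \<gamma> = q} \<noteq> {}"
      using surface_path_exists[OF p q] by blast
    fix x assume "x \<in> {poincare_length M A \<gamma> |\<gamma>. surface_path M A \<gamma> \<and> pathstart \<gamma> = p \<and> pathfinish \<gamma> = q}"
    then obtain \<gamma> where \<gamma>: "surface_path M A \<gamma>" "pathstart \<gamma> = p" "pathfinish \<gamma> = q" "x = poincare_length M A \<gamma>" by blast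
    obtain \<delta> where \<delta>: "ball_path \<delta>" "\<delta> 0 = z" "\<And>t. t \<in> {0..1} \<Longrightarrow> h (\<delta> t) = \<gamma> t"
      using lift_surface_path[OF \<gamma>(1) z(1)] z(2) \<gamma>(2) by (auto simp: pathstart_def)
    have "norm (\<delta> 1 - \<delta> 0) \<le> 1 * disc_length \<delta>"
    proof (rule disc_length_lower_bound[OF \<delta>(1), where \<psi> = "\<lambda>x. x" and \<psi>' = "\<lambda>z v. v"])
      fix z v :: complex assume "z \<in> \<D>"
      then have "0 < 1 - (norm z)\<^sup>2" "1 - (norm z)\<^sup>2 \<le> 1" by (auto simp: power_less_one_iff)
      then show "norm v \<le> 1 * poincare_disc z v"
        by (simp add: poincare_disc_def pos_le_divide_eq mult_left_le)
    qed auto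
    moreover have "\<delta> 1 \<notin> ball z r"
      using r(2) \<delta>(3)[of 1] \<gamma>(3) by (auto simp: pathfinish_def)
    ultimately show "r \<le> x"
      using \<delta>(2) \<gamma>(4) poincare_length_lift[OF iso \<delta>(1,3)] by (simp add: dist_norm norm_minus_commute)
  qed
  then show ?thesis using r(1) by simp
qed

text \<open>
  The function \<open>ln (1 - |z|\<^sup>2)\<close> is Lipschitz with constant \<open>2\<close> for the Poincare metric.
\<close>

lemma disc_path_norm_bound:
  assumes \<delta>: "ball_path \<delta>" and t: "t \<in> {0..1}"
  shows "(norm (\<delta> t))\<^sup>2 \<le> 1 - (1 - (norm (\<delta> 0))\<^sup>2) * exp (- (2 * disc_length \<delta>))"
proof -
  have pos: "0 < 1 - (norm z)\<^sup>2" if "z \<in> \<D>" for z :: complex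
    using that by (simp add: power_less_one_iff)
  have "norm (ln (1 - (norm (\<delta> t))\<^sup>2) - ln (1 - (norm (\<delta> 0))\<^sup>2)) \<le> 2 * disc_length \<delta>"
  proof (rule disc_length_lower_bound[OF \<delta> t, where \<psi> = "\<lambda>z. ln (1 - (norm z)\<^sup>2)" and \<psi>' = "\<lambda>z v. - (2 * (z \<bullet> v)) / (1 - (norm z)\<^sup>2)"])
    fix z :: complex assume z: "z \<in> \<D>"
    have "((\<lambda>z. 1 - z \<bullet> z) has_derivative (\<lambda>v. - (2 * (z \<bullet> v)))) (at z)"
      by (auto intro!: derivative_eq_intros simp: inner_commute)
    moreover have "0 < 1 - z \<bullet> z" using pos[OF z] by (simp add: power2_norm_eq_inner)
    ultimately have "((\<lambda>z. ln (1 - z \<bullet> z)) has_derivative (\<lambda>v. - (2 * (z \<bullet> v)) / (1 - z \<bullet> z))) (at z)"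
      by (auto intro!: derivative_eq_intros simp: divide_inverse fun_eq_iff inner_commute)
    then show "((\<lambda>z. ln (1 - (norm z)\<^sup>2)) has_derivative (\<lambda>v. - (2 * (z \<bullet> v)) / (1 - (norm z)\<^sup>2))) (at z)"
      by (simp add: power2_norm_eq_inner)
    fix v :: complex
    have "\<bar>z \<bullet> v\<bar> \<le> norm z * norm v" by (rule Cauchy_Schwarz_ineq2)
    also have "\<dots> \<le> 1 * norm v" using z by (intro mult_right_mono) auto
    finally show "norm (- (2 * (z \<bullet> v)) / (1 - (norm z)\<^sup>2)) \<le> 2 * poincare_disc z v"
      using pos[OF z] by (simp add: poincare_disc_def abs_mult divide_right_mono)
  qed auto
  then have "ln (1 - (norm (\<delta> 0))\<^sup>2) - 2 * disc_length \<delta> \<le> ln (1 - (norm (\<delta> t))\<^sup>2)"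
    by (simp add: abs_le_iff)
  then have "exp (ln (1 - (norm (\<delta> 0))\<^sup>2) - 2 * disc_length \<delta>) \<le> exp (ln (1 - (norm (\<delta> t))\<^sup>2))" by simp
  then have "(1 - (norm (\<delta> 0))\<^sup>2) * exp (- (2 * disc_length \<delta>)) \<le> 1 - (norm (\<delta> t))\<^sup>2"
    using pos[OF ball_path_in_ball[OF \<delta>, of 0]] pos[OF ball_path_in_ball[OF \<delta> t]]
    by (simp add: exp_diff exp_minus divide_inverse)
  then show ?thesis by simp
qed

lemma cayley_klein_scaleR: "cayley_klein x (c *\<^sub>R v) = \<bar>c\<bar> * cayley_klein x v"
proof -
  have "(norm (c *\<^sub>R v))\<^sup>2 / (1 - (norm x)\<^sup>2) + (x \<bullet> (c *\<^sub>R v))\<^sup>2 / (1 - (norm x)\<^sup>2)\<^sup>2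
     = c\<^sup>2 * ((norm v)\<^sup>2 / (1 - (norm x)\<^sup>2) + (x \<bullet> v)\<^sup>2 / (1 - (norm x)\<^sup>2)\<^sup>2)"
    by (simp add: power_mult_distrib distrib_left)
  then show ?thesis by (simp add: cayley_klein_def real_sqrt_mult)
qed

text \<open>
  By homogeneity it suffices to consider unit vectors at the points of a compact disc, where the quotient of the two
  metrics is continuous and attains its maximum.
\<close>

lemma not_extremal_imp_strict:
  assumes ne: "\<not> extremal" and \<rho>: "0 \<le> \<rho>" "\<rho> < 1"
  obtains m where "0 \<le> m" "m < 1"
    "\<And>z v. z \<in> cball 0 \<rho> \<Longrightarrow> cayley_klein (lift z) (dlift z v) \<le> m * poincare_disc z v"
proof -
  have sub: "cball 0 \<rho> \<subseteq> \<D>" using \<rho> by auto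
  define g where "g = (\<lambda>(z, v). cayley_klein (lift z) (dlift z v) * (1 - (norm z)\<^sup>2))"
  have dl: "dlift z v = Re v *\<^sub>R dx lift z + Im v *\<^sub>R dy lift z" if "z \<in> \<D>" for z v
  proof -
    have "lift differentiable (at z)" using lift_C1 that unfolding C1_on_def by blast
    from fun_cong[OF frechet_derivative_at[OF differentiable_dx_dy[OF this]], of v]
    show ?thesis by (rule sym)
  qed
  have "continuous_on (cball 0 \<rho> \<times> sphere 0 1) g"
  proof -
    have c: "continuous_on \<D> lift" "continuous_on \<D> (dx lift)" "continuous_on \<D> (dy lift)"
      using C1_on_continuous[OF lift_C1] lift_C1 by (simp_all add: C1_on_def)
    have c2: "continuous_on (cball 0 \<rho> \<times> sphere (0::complex) 1) (\<lambda>w. k (fst w))" if "continuous_on \<D> k" for k :: "complex \<Rightarrow> real ^ 'n"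
      by (rule continuous_on_compose2[OF that]) (use sub in \<open>auto intro!: continuous_intros\<close>)
    have "continuous_on (cball 0 \<rho> \<times> sphere (0::complex) 1) (\<lambda>w. (\<lambda>(x, v). cayley_klein x v)
        (lift (fst w), Re (snd w) *\<^sub>R dx lift (fst w) + Im (snd w) *\<^sub>R dy lift (fst w)))"
    proof (rule continuous_on_compose2[OF cayley_klein_continuous])
      show "continuous_on (cball 0 \<rho> \<times> sphere (0::complex) 1)
          (\<lambda>w. (lift (fst w), Re (snd w) *\<^sub>R dx lift (fst w) + Im (snd w) *\<^sub>R dy lift (fst w)))"
        by (intro continuous_intros c2 c)
      show "(\<lambda>w. (lift (fst w), Re (snd w) *\<^sub>R dx lift (fst w) + Im (snd w) *\<^sub>R dy lift (fst w)))
          ` (cball 0 \<rho> \<times> sphere (0::complex) 1) \<subseteq> ball 0 1 \<times> UNIV"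
      proof (rule image_subsetI)
        fix w :: "complex \<times> complex" assume "w \<in> cball 0 \<rho> \<times> sphere 0 1"
        then have "fst w \<in> \<D>" using sub by (metis mem_Times_iff subsetD)
        then have "lift (fst w) \<in> ball 0 1" using lift_into_ball by (rule image_subset_iff[THEN iffD1, rule_format, rotated])
        then show "(lift (fst w), Re (snd w) *\<^sub>R dx lift (fst w) + Im (snd w) *\<^sub>R dy lift (fst w)) \<in> ball 0 1 \<times> UNIV"
          by (rule SigmaI) simp
      qed
    qed
    then have "continuous_on (cball 0 \<rho> \<times> sphere (0::complex) 1) (\<lambda>w. cayley_klein (lift (fst w))
        (Re (snd w) *\<^sub>R dx lift (fst w) + Im (snd w) *\<^sub>R dy lift (fst w)) * (1 - (norm (fst w))\<^sup>2))"
      by (intro continuous_intros) simp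
    moreover have "continuous_on (cball 0 \<rho> \<times> sphere (0::complex) 1) (\<lambda>w. cayley_klein (lift (fst w))
        (Re (snd w) *\<^sub>R dx lift (fst w) + Im (snd w) *\<^sub>R dy lift (fst w)) * (1 - (norm (fst w))\<^sup>2))
       \<longleftrightarrow> continuous_on (cball 0 \<rho> \<times> sphere 0 1) g"
      by (intro continuous_on_cong refl) (use sub in \<open>auto simp: g_def dl simp del: o_apply\<close>)
    ultimately show ?thesis by simp
  qed
  moreover have "compact (cball (0::complex) \<rho> \<times> sphere (0::complex) 1)" by (intro compact_Times) auto
  moreover have "cball (0::complex) \<rho> \<times> sphere (0::complex) 1 \<noteq> {}"
    using \<rho> norm_one by force
  ultimately obtain w0 where w0: "w0 \<in> cball 0 \<rho> \<times> sphere 0 1" "\<And>w. w \<in> cball 0 \<rho> \<times> sphere 0 1 \<Longrightarrow> g w \<le> g w0"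
    using continuous_attains_sup by metis
  obtain z0 v0 where zv: "w0 = (z0, v0)" by fastforce
  have z0: "z0 \<in> \<D>" "norm v0 = 1" "v0 \<noteq> 0" using w0(1) zv sub by auto
  have pos: "0 < 1 - (norm z)\<^sup>2" if "z \<in> \<D>" for z :: complex
    using that by (simp add: power_less_one_iff)
  have "cayley_klein (lift z0) (dlift z0 v0) < poincare_disc z0 v0"
    using lift_schwarz_pick(2)[OF z0(1), of v0] lift_schwarz_pick(3)[OF z0(1) _ z0(3)] ne by fastforce
  then have lt: "g w0 < 1"
    using pos[OF z0(1)] z0(2) by (simp add: g_def zv poincare_disc_def pos_less_divide_eq del: o_apply)
  have ball: "norm (lift z) \<le> 1" if "z \<in> \<D>" for z
    using lift_into_ball that by (force simp del: o_apply)
  have ge: "0 \<le> g w0"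
    using cayley_klein_nonneg[OF ball[OF z0(1)]] pos[OF z0(1)] by (simp add: g_def zv del: o_apply)
  show thesis
  proof (rule that[OF ge lt])
    fix z v :: complex assume z: "z \<in> cball 0 \<rho>"
    then have zD: "z \<in> \<D>" using sub by blast
    show "cayley_klein (lift z) (dlift z v) \<le> g w0 * poincare_disc z v"
    proof (cases "v = 0")
      case True
      then show ?thesis using dl[OF zD, of 0] by (simp add: cayley_klein_def poincare_disc_def)
    next
      case False
      define u where "u = v /\<^sub>R norm v"
      have u: "norm u = 1" "v = norm v *\<^sub>R u" using False by (simp_all add: u_def)
      have "g (z, u) \<le> g w0" using w0(2) z u(1) by simp
      then have "cayley_klein (lift z) (dlift z u) \<le> g w0 / (1 - (norm z)\<^sup>2)"
        using pos[OF zD] by (simp add: g_def pos_le_divide_eq del: o_apply)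
      then have "norm v * cayley_klein (lift z) (dlift z u) \<le> norm v * (g w0 / (1 - (norm z)\<^sup>2))"
        by (rule mult_left_mono) simp
      moreover have "dlift z v = norm v *\<^sub>R dlift z u"
        unfolding dl[OF zD] using arg_cong[OF u(2), of Re] arg_cong[OF u(2), of Im]
        by (simp add: scaleR_add_right)
      ultimately show ?thesis
        by (simp add: cayley_klein_scaleR poincare_disc_def mult.commute del: o_apply)
    qed
  qed
qed

text \<open>
  Otherwise all paths from \<open>p\<close> to \<open>q\<close> of length at most \<open>d + 1\<close>, where \<open>d\<close> is the Poincare distance, have lifts in
  one compact disc, on which the Cayley--Klein metric is at most \<open>m < 1\<close> times the Poincare metric.  Hence \<open>d \<le> m * x\<close> for the
  lengths \<open>x\<close> of these paths, which come arbitrarily close to \<open>d > 0\<close>.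
\<close>

lemma dist_eq_imp_extremal:
  assumes p: "p \<in> M" and q: "q \<in> M" and pq: "p \<noteq> q"
    and eq: "cayley_klein_dist (f p) (f q) = poincare_dist M A p q"
  shows extremal
proof (rule ccontr)
  assume ne: "\<not> extremal"
  define d where "d = poincare_dist M A p q"
  have d: "0 < d" unfolding d_def by (rule poincare_dist_pos[OF p q pq])
  obtain z where z: "z \<in> \<D>" "h z = p" using p h_image by blast
  define b where "b = (1 - (norm z)\<^sup>2) * exp (- (2 * (d + 1)))"
  have b: "0 < b" "b \<le> 1"
  proof -
    show "0 < b" using z by (simp add: b_def power_less_one_iff)
    show "b \<le> 1" unfolding b_def using z d by (intro mult_le_one) (auto simp: power_le_one)
  qed
  define \<rho> where "\<rho> = sqrt (1 - b)"
  have \<rho>: "0 \<le> \<rho>" "\<rho> < 1" using b by (auto simp: \<rho>_def)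
  obtain m where m: "0 \<le> m" "m < 1"
    "\<And>z v. z \<in> cball 0 \<rho> \<Longrightarrow> cayley_klein (lift z) (dlift z v) \<le> m * poincare_disc z v"
    using not_extremal_imp_strict[OF ne \<rho>] by blast
  let ?X = "{poincare_length M A \<gamma> |\<gamma>. surface_path M A \<gamma> \<and> pathstart \<gamma> = p \<and> pathfinish \<gamma> = q}"
  have short: "d \<le> m * x" if x: "x \<in> ?X" "x \<le> d + 1" for x
  proof -
    obtain \<gamma> where \<gamma>: "surface_path M A \<gamma>" "pathstart \<gamma> = p" "pathfinish \<gamma> = q" "x = poincare_length M A \<gamma>"
      using x(1) by blast
    have "cayley_klein_dist (f (pathstart \<gamma>)) (f (pathfinish \<gamma>)) \<le> m * poincare_length M A \<gamma>"
    proof (rule cayley_klein_dist_le_length[OF \<gamma>(1) z(1)])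
      show "h z = pathstart \<gamma>" using z \<gamma> by simp
      fix \<delta> t v assume \<delta>: "ball_path \<delta>" "\<delta> 0 = z" "disc_length \<delta> = poincare_length M A \<gamma>" and t: "t \<in> {0..1::real}"
      have "(1 - (norm z)\<^sup>2) * exp (- (2 * (d + 1))) \<le> (1 - (norm (\<delta> 0))\<^sup>2) * exp (- (2 * disc_length \<delta>))"
        using \<delta>(2,3) x(2) \<gamma>(4) z(1) by (intro mult_mono) (auto simp: power_le_one)
      then have "(norm (\<delta> t))\<^sup>2 \<le> 1 - b"
        using disc_path_norm_bound[OF \<delta>(1) t] by (simp add: b_def)
      then have "\<delta> t \<in> cball 0 \<rho>" by (simp add: \<rho>_def real_le_rsqrt)
      then show "cayley_klein (lift (\<delta> t)) (dlift (\<delta> t) v) \<le> m * poincare_disc (\<delta> t) v" by (rule m(3))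
    qed
    then show ?thesis using \<gamma> eq by (simp add: d_def)
  qed
  have ne: "?X \<noteq> {}" using surface_path_exists[OF p q] by blast
  \<comment> \<open>The bound \<open>d * (1 - m)\<close> on the excess is small enough because \<open>m * (2 - m) < 1\<close>.\<close>
  have "\<exists>x\<in>?X. x < d + min 1 (d * (1 - m))"
  proof (rule ccontr)
    assume "\<not> (\<exists>x\<in>?X. x < d + min 1 (d * (1 - m)))"
    then have "d + min 1 (d * (1 - m)) \<le> Inf ?X" by (intro cInf_greatest[OF ne]) force
    moreover have "0 < d * (1 - m)" using d m by simp
    ultimately show False by (simp add: d_def poincare_dist_def min_def split: if_splits)
  qed
  then obtain x where x: "x \<in> ?X" "x < d + min 1 (d * (1 - m))" by blast
  then have x: "x \<in> ?X" "x < d + 1" "x < d + d * (1 - m)" by linarith+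
  have "d \<le> m * x" using short x by simp
  also have "\<dots> \<le> m * (d + d * (1 - m))" using x(3) m(1) by (intro mult_left_mono) auto
  also have "\<dots> = d - d * (1 - m)\<^sup>2" by (simp add: power2_eq_square algebra_simps)
  finally have "d * (1 - m)\<^sup>2 \<le> 0" by simp
  then show False using d m by (simp add: mult_le_0_iff)
qed

end

section \<open>The Schwarz--Pick lemma on hyperbolic surfaces\<close>

theorem theorem2p6:
  fixes M :: "'a::{t2_space,second_countable_topology} set"
    and A :: "'a chart set"
    and f :: "'a \<Rightarrow> real ^ 'n"
  assumes "3 \<le> CARD('n)"
    and "conformal_surface M A"
    and "connected M"
    and "hyperbolic_surface M A"
    and "f ` M \<subseteq> ball 0 1"
    and "conformal_harmonic A f"
  shows "(\<forall>p\<in>M. \<forall>\<xi>\<in>tangent_space A p.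
            cayley_klein (f p) (surface_differential A f p \<xi>) \<le> poincare_metric M A p \<xi>) \<and>
         (\<forall>p\<in>M. \<forall>q\<in>M. cayley_klein_dist (f p) (f q) \<le> poincare_dist M A p q) \<and>
         ((\<exists>p\<in>M. \<exists>\<xi>\<in>tangent_space A p. \<xi> \<noteq> zero_tangent \<and>
             cayley_klein (f p) (surface_differential A f p \<xi>) = poincare_metric M A p \<xi>) \<or>
          (\<exists>p\<in>M. \<exists>q\<in>M. p \<noteq> q \<and> cayley_klein_dist (f p) (f q) = poincare_dist M A p q)
          \<longrightarrow> conformally_equivalent_disc M A \<and>
              (\<exists>\<Delta>. affine_disc \<Delta> \<and> conformal_diffeo_onto M A f \<Delta>))"
proof -
  obtain h where h: "surface_covered_by_disc M A h"
    "\<And>z \<zeta>. z \<in> \<D> \<Longrightarrow> poincare_metric M A (h z) (disc_differential A h z \<zeta>) = poincare_disc z \<zeta>"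
    using poincare_metric_covering[OF assms(2,4)] by blast
  then interpret conformal_harmonic_into_ball M A h f
    unfolding conformal_harmonic_into_ball_def conformal_harmonic_into_ball_axioms_def
    using assms(5,6) by blast
  show ?thesis
    using differential_le dist_le dist_eq_imp_extremal extremal_imp_disc by blast
qed

end
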